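(* Assume $r\ne0$. For all $\lambda\in\Lambda$, $$\frac{\overline R_\lambda(\underline1+z)}{B_\lambda}=\sum_\mu\frac{R_\mu(\rho+\lambda)}{R_\mu(\rho+\mu)}\,\frac{\overline R_\mu(z)}{B_\mu},$$ where the sum is over all $\mu\in\Lambda$ with $\mu\sqsubseteq\lambda$ and, in case $n$ is even, additionally with $[\mu]_1=[\lambda]_1$.
   Context: Let $k$ be a field of characteristic zero, $n\ge 1$, $\mathcal P=k[z_1,\dots,z_n]$, and let $W\subseteq S_n$ be the group of permutations $\pi$ with $\pi(i)\equiv i \bmod 2$ for all $i$, acting by permuting variables. $\Lambda$ is the set of integer tuples $\lambda=(\lambda_1\ge\dots\ge\lambda_n\ge 0)$ and $|\lambda|_{\rm odd}=\sum_{i\text{ odd}}\lambda_i$. Fix $r\in k$ which is not a negative rational number and put $\rho=((n-1)r,(n-2)r,\dots,r,0)$. For $\lambda\in\Lambda$ let $[\lambda]_m=\lambda_m-\lambda_{m+1}+\dots+(-1)^{n-m}\lambda_n$; in particular $[\lambda]_1=\lambda_1-\lambda_2+\lambda_3-\cdots$. $\underline1=(1,\dots,1)$. $R_\lambda(z)=R_\lambda(z;r)\in\mathcal P^W$ is the unique $W$-invariant polynomial of degree $|\lambda|_{\rm odd}$ which satisfies $R_\lambda(\rho+\mu)=0$ for all $\mu\in\Lambda$ with $|\mu|_{\rm odd}\le|\lambda|_{\rm odd}$, $\mu\ne\lambda$, and in which the monomial $z^{[\lambda]}$ has coefficient $1$ (it is known that this exists and is unique, and that $R_\lambda(\rho+\lambda)\ne0$).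 $\overline R_\lambda$ is its homogeneous component of highest degree $|\lambda|_{\rm odd}$. With $[x\uparrow m]=x(x+1)\cdots(x+m-1)$, $$B_\lambda=\frac{\prod_{1\le i<j\le n,\ j-i\text{ odd}}[(j-i+1)r\uparrow\lambda_i-\lambda_j]}{\prod_{1\le i<j\le n,\ j-i\text{ even}}[(j-i)r\uparrow\lambda_i-\lambda_j]} .$$ For $\mu,\lambda\in\Lambda$, $\mu\sqsubseteq\lambda$ means $\mu_i\le\lambda_i$ for all $i$ and $[\mu]_1\le[\lambda]_1$. *)

theory Defs
  imports Complex_Main "HOL-Library.Poly_Mapping" "HOL-Combinatorics.Permutations"
begin

text \<open>
  Polynomials in variables \<open>z\<^sub>i\<close> indexed by naturals: finitely supported maps from monomials
  (finitely supported exponent vectors) to coefficients, with the convolution product of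
  \<^theory>\<open>HOL-Library.Poly_Mapping\<close>. The ring \<open>k[z\<^sub>1,\<dots>,z\<^sub>n]\<close> is the subset \<open>polys n\<close>.
\<close>

type_synonym 'k mvpoly = "(nat \<Rightarrow>\<^sub>0 nat) \<Rightarrow>\<^sub>0 'k"

definition polys :: "nat \<Rightarrow> 'k::zero mvpoly set" where
  "polys n = {p. \<forall>m\<in>Poly_Mapping.keys p. Poly_Mapping.keys m \<subseteq> {1..n}}"

definition Const :: "'k::zero \<Rightarrow> 'k mvpoly" where
  "Const c = Poly_Mapping.single 0 c"

definition Var :: "nat \<Rightarrow> 'k::zero_neq_one mvpoly" where
  "Var i = Poly_Mapping.single (Poly_Mapping.single i 1) 1"

text \<open>Value of \<open>p\<close> at \<open>x\<close> in a ring to which the coefficients are mapped by \<open>\<phi>\<close>.\<close>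

definition eval_via :: "('k::zero \<Rightarrow> 'b::comm_semiring_1) \<Rightarrow> (nat \<Rightarrow> 'b) \<Rightarrow> 'k mvpoly \<Rightarrow> 'b" where
  "eval_via \<phi> x p =
     (\<Sum>m\<in>Poly_Mapping.keys p. \<phi> (Poly_Mapping.lookup p m) *
        (\<Prod>i\<in>Poly_Mapping.keys m. x i ^ Poly_Mapping.lookup m i))"

definition eval_at :: "(nat \<Rightarrow> 'k::comm_semiring_1) \<Rightarrow> 'k mvpoly \<Rightarrow> 'k" where
  "eval_at x p = eval_via (\<lambda>c. c) x p"

definition subst :: "(nat \<Rightarrow> 'k::comm_semiring_1 mvpoly) \<Rightarrow> 'k mvpoly \<Rightarrow> 'k mvpoly" where
  "subst f p = eval_via Const f p"

definition mon_degree :: "(nat \<Rightarrow>\<^sub>0 nat) \<Rightarrow> nat" where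
  "mon_degree m = (\<Sum>i\<in>Poly_Mapping.keys m. Poly_Mapping.lookup m i)"

text \<open>Total degree; the zero polynomial gets degree \<open>0\<close>.\<close>

definition total_degree :: "'k::zero mvpoly \<Rightarrow> nat" where
  "total_degree p = Max (insert 0 (mon_degree ` Poly_Mapping.keys p))"

definition hom_component :: "nat \<Rightarrow> 'k::comm_monoid_add mvpoly \<Rightarrow> 'k mvpoly" where
  "hom_component d p =
     (\<Sum>m\<in>{m\<in>Poly_Mapping.keys p. mon_degree m = d}.
        Poly_Mapping.single m (Poly_Mapping.lookup p m))"

definition W :: "nat \<Rightarrow> (nat \<Rightarrow> nat) set" where
  "W n = {\<pi>. \<pi> permutes {1..n} \<and> (\<forall>i. \<pi> i mod 2 = i mod 2)}"

definition invariants :: "nat \<Rightarrow> 'k::comm_semiring_1 mvpoly set" where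
  "invariants n = {p\<in>polys n. \<forall>\<pi>\<in>W n. subst (\<lambda>i. Var (\<pi> i)) p = p}"

text \<open>
  Tuples are functions on \<open>nat\<close> whose entries are those at \<open>1,\<dots>,n\<close>; they vanish elsewhere, so that
  each tuple has exactly one representative.
\<close>

definition \<Lambda> :: "nat \<Rightarrow> (nat \<Rightarrow> nat) set" where
  "\<Lambda> n = {lam. (\<forall>i j. 1 \<le> i \<and> i \<le> j \<and> j \<le> n \<longrightarrow> lam j \<le> lam i) \<and> (\<forall>i. i \<notin> {1..n} \<longrightarrow> lam i = 0)}"

definition odd_size :: "nat \<Rightarrow> (nat \<Rightarrow> nat) \<Rightarrow> nat" where
  "odd_size n lam = (\<Sum>i | i \<in> {1..n} \<and> odd i. lam i)"

definition alt :: "nat \<Rightarrow> (nat \<Rightarrow> nat) \<Rightarrow> nat \<Rightarrow> int" where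
  "alt n lam m = (\<Sum>j=m..n. (- 1) ^ (j - m) * int (lam j))"

text \<open>
  The monomial \<open>z\<^bsup>[lam]\<^esup>\<close>, with exponent \<open>[lam]\<^sub>i\<close> at \<open>z\<^sub>i\<close>. For \<open>lam \<in> \<Lambda> n\<close> these alternating sums are
  nonnegative, so \<open>nat\<close> does not truncate.
\<close>

definition alt_mon :: "nat \<Rightarrow> (nat \<Rightarrow> nat) \<Rightarrow> (nat \<Rightarrow>\<^sub>0 nat)" where
  "alt_mon n lam = (\<Sum>i=1..n. Poly_Mapping.single i (nat (alt n lam i)))"

definition shifted :: "nat \<Rightarrow> 'k::comm_semiring_1 \<Rightarrow> (nat \<Rightarrow> nat) \<Rightarrow> nat \<Rightarrow> 'k" where
  \<comment> \<open>the point \<open>\<rho> + \<mu>\<close>; only its coordinates \<open>1,\<dots>,n\<close> matter\<close>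
  "shifted n r \<mu> i = of_nat (n - i) * r + of_nat (\<mu> i)"

definition is_R :: "nat \<Rightarrow> 'k::field_char_0 \<Rightarrow> (nat \<Rightarrow> nat) \<Rightarrow> 'k mvpoly \<Rightarrow> bool" where
  "is_R n r lam p \<longleftrightarrow>
     p \<in> invariants n \<and>
     total_degree p = odd_size n lam \<and>
     (\<forall>\<mu>\<in>\<Lambda> n. odd_size n \<mu> \<le> odd_size n lam \<and> \<mu> \<noteq> lam \<longrightarrow> eval_at (shifted n r \<mu>) p = 0) \<and>
     Poly_Mapping.lookup p (alt_mon n lam) = 1"

definition R :: "nat \<Rightarrow> 'k::field_char_0 \<Rightarrow> (nat \<Rightarrow> nat) \<Rightarrow> 'k mvpoly" where
  "R n r lam = (THE p. is_R n r lam p)"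

definition R_top :: "nat \<Rightarrow> 'k::field_char_0 \<Rightarrow> (nat \<Rightarrow> nat) \<Rightarrow> 'k mvpoly" where
  "R_top n r lam = hom_component (odd_size n lam) (R n r lam)"

text \<open>
  For \<open>lam \<in> \<Lambda> n\<close> and \<open>i < j\<close> the natural number differences \<open>lam i - lam j\<close> and \<open>j - i\<close> are not truncated.
\<close>

definition B :: "nat \<Rightarrow> 'k::field_char_0 \<Rightarrow> (nat \<Rightarrow> nat) \<Rightarrow> 'k" where
  "B n r lam =
     (\<Prod>(i, j) | 1 \<le> i \<and> i < j \<and> j \<le> n \<and> odd (j - i).
        pochhammer (of_nat (j - i + 1) * r) (lam i - lam j)) /
     (\<Prod>(i, j) | 1 \<le> i \<and> i < j \<and> j \<le> n \<and> even (j - i).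
        pochhammer (of_nat (j - i) * r) (lam i - lam j))"

definition preceq :: "nat \<Rightarrow> (nat \<Rightarrow> nat) \<Rightarrow> (nat \<Rightarrow> nat) \<Rightarrow> bool" where
  "preceq n \<mu> lam \<longleftrightarrow> (\<forall>i\<in>{1..n}. \<mu> i \<le> lam i) \<and> alt n \<mu> 1 \<le> alt n lam 1"

end

theory Submission
  imports Defs "HOL-Computational_Algebra.Polynomial"
begin

text \<open>
  Write \<open>b\<^sub>\<mu>(\<lambda>) = R\<^sub>\<mu>(\<rho> + \<lambda>) / R\<^sub>\<mu>(\<rho> + \<mu>)\<close>. An explicit difference operator \<open>D\<close>, with steps \<open>s\<close> that
  decrease an odd entry and possibly an even one and with coefficients \<open>c\<^sub>s(z)\<close> that vanish at
  \<open>\<rho> + \<lambda>\<close> when \<open>\<lambda> - s\<close> leaves \<open>\<Lambda>\<close>, preserves invariant polynomials and their degree. By uniqueness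
  of interpolation every \<open>R\<^sub>\<mu>\<close> is an eigenfunction of it, which reads (for even \<open>n\<close>, where only steps
  preserving \<open>[\<lambda>]\<^sub>1\<close> occur, among tuples with \<open>[\<mu>]\<^sub>1 = [\<lambda>]\<^sub>1\<close>)
  \<open>(|\<lambda>| - |\<mu>|) b\<^sub>\<mu>(\<lambda>) = \<Sum>\<^sub>s c\<^sub>s(\<rho> + \<lambda>) b\<^sub>\<mu>(\<lambda> - s)\<close>. The operator with \<open>r\<close> replaced by \<open>-r\<close> and
  increasing steps lowers the degree by one; its leading part is \<open>\<Sum>\<^sub>i \<partial>\<^sub>i\<close> by Lagrange interpolation, and
  vanishing at the points \<open>\<rho> + \<kappa>\<close> expresses its value on \<open>R\<^sub>\<lambda>\<close> through the \<open>R\<close> of \<open>\<lambda> - s\<close>. Normalising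
  by \<open>B\<close> turns this into \<open>\<Sum>\<^sub>i \<partial>\<^sub>i\<close> acting on the normalised leading parts with the same coefficients \<open>c\<^sub>s(\<rho> + \<lambda>)\<close>,
  so both sides of the formula satisfy the same differential equation along the line \<open>z + u(1,\<dots>,1)\<close>.
\<close>

section \<open>Polynomials and their values\<close>

text \<open>The coefficients have poles where two coordinates of equal parity coincide. These cancel
  only on invariant polynomials; so the operators are defined at points with distinct coordinates
  and recognised as polynomials through divisibility by the squared Vandermonde product
  \<open>discr\<close>. The numerator has factors z_p - z_(p+1) - r, which at \<rho> + \<lambda>
  equal \<lambda>_p - \<lambda>_(p+1); this removes illegal steps. The last entry has no right
  neighbour, and the extra factor \<open>step_weight\<close> takes over there. That factor also
  fixes the eigenvalue: up to a constant, the sum of the entries whose index has the parity of n.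
  For odd n this is the odd size; for even n it is the even-indexed sum, and its differences agree
  with those of the odd size only if [\<mu>]_1 = [\<lambda>]_1, whence the extra condition. The role
  of B: like the explicit values of R_\<mu> at \<rho> + \<mu>, it is a product over pairs of
  indices, and B divided by these values changes along a step by exactly the quotient of the raising
  and the lowering coefficient. All non-vanishing reduces to a r + b \<noteq> 0 for naturals a, b
  that are not both 0.\<close>

abbreviation "lookup \<equiv> Poly_Mapping.lookup"
abbreviation "keys \<equiv> Poly_Mapping.keys"
abbreviation "single \<equiv> Poly_Mapping.single"

section \<open>Monomials and evaluation homomorphisms\<close>

definition mon :: "(nat \<Rightarrow> 'b::comm_semiring_1) \<Rightarrow> (nat \<Rightarrow>\<^sub>0 nat) \<Rightarrow> 'b" where
  "mon x m = (\<Prod>i\<in>keys m. x i ^ lookup m i)"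

lemma mon_superset:
  assumes "finite S" "keys m \<subseteq> S"
  shows "mon x m = (\<Prod>i\<in>S. x i ^ lookup m i)"
  unfolding mon_def using assms
  by (intro prod.mono_neutral_left) (auto simp: in_keys_iff)

lemma mon_0 [simp]: "mon x 0 = 1"
  by (simp add: mon_def)

lemma mon_add: "mon x (m + m') = mon x m * mon x m'"
proof -
  let ?S = "keys m \<union> keys m'"
  have "keys (m + m') \<subseteq> ?S" by (rule keys_add)
  then show ?thesis
    by (simp add: mon_superset[of ?S] lookup_add power_add prod.distrib)
qed

lemma mon_single: "mon x (single i k) = x i ^ k"
  by (cases "k = 0") (simp_all add: mon_def)

lemma mon_degree_superset:
  assumes "finite S" "keys m \<subseteq> S"
  shows "mon_degree m = (\<Sum>i\<in>S. lookup m i)"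
  unfolding mon_degree_def using assms
  by (intro sum.mono_neutral_left) (auto simp: in_keys_iff)

lemma eval_via_mon: "eval_via \<phi> x p = (\<Sum>m\<in>keys p. \<phi> (lookup p m) * mon x m)"
  by (simp add: eval_via_def mon_def)

lemma poly_mapping_sum_single: "p = (\<Sum>m\<in>keys p. single m (lookup p m))"
  by (rule poly_mapping_eqI) (simp add: lookup_sum lookup_single when_def in_keys_iff)

text \<open>Multiplicativity of evaluation is proved once for an abstract coefficient map. The three
  instances below give values at points, substitution of polynomials, and restriction to a
  line.\<close>

locale coeff_hom =
  fixes \<phi> :: "'k::comm_semiring_1 \<Rightarrow> 'b::comm_semiring_1"
  assumes zero: "\<phi> 0 = 0" and one: "\<phi> 1 = 1"
    and add: "\<phi> (a + b) = \<phi> a + \<phi> b" and mult: "\<phi> (a * b) = \<phi> a * \<phi> b"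
begin

lemma eval_superset:
  assumes "finite S" "keys p \<subseteq> S"
  shows "eval_via \<phi> x p = (\<Sum>m\<in>S. \<phi> (lookup p m) * mon x m)"
  unfolding eval_via_mon using assms
  by (intro sum.mono_neutral_left) (auto simp: in_keys_iff zero)

lemma eval_0: "eval_via \<phi> x 0 = 0"
  by (simp add: eval_via_def)

lemma eval_add: "eval_via \<phi> x (p + q) = eval_via \<phi> x p + eval_via \<phi> x q"
proof -
  let ?S = "keys p \<union> keys q"
  have "keys (p + q) \<subseteq> ?S" by (rule keys_add)
  then show ?thesis
    by (simp add: eval_superset[of ?S] lookup_add add distrib_right sum.distrib)
qed

lemma eval_sum: "eval_via \<phi> x (sum f A) = (\<Sum>a\<in>A. eval_via \<phi> x (f a))"
  by (induction A rule: infinite_finite_induct) (simp_all add: eval_0 eval_add)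

lemma eval_single: "eval_via \<phi> x (single m c) = \<phi> c * mon x m"
  by (cases "c = 0") (simp_all add: eval_via_mon zero)

lemma eval_Const: "eval_via \<phi> x (Const c) = \<phi> c"
  by (simp add: Const_def eval_single)

lemma eval_Var: "eval_via \<phi> x (Var i) = x i"
  by (simp add: Var_def eval_single mon_single one)

lemma eval_mult: "eval_via \<phi> x (p * q) = eval_via \<phi> x p * eval_via \<phi> x q"
proof -
  have "p * q = (\<Sum>m\<in>keys p. \<Sum>m'\<in>keys q. single (m + m') (lookup p m * lookup q m'))"
    by (subst poly_mapping_sum_single[of p], subst poly_mapping_sum_single[of q])
      (simp only: sum_product mult_single)
  then have "eval_via \<phi> x (p * q)
      = (\<Sum>m\<in>keys p. \<Sum>m'\<in>keys q. (\<phi> (lookup p m) * mon x m) * (\<phi> (lookup q m') * mon x m'))"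
    by (simp only: eval_sum eval_single mon_add mult ac_simps)
  then show ?thesis
    by (simp only: eval_via_mon sum_product)
qed

end

lemma coeff_hom_id: "coeff_hom (\<lambda>c. c)"
  by standard auto

lemma Const_0 [simp]: "Const 0 = 0" by (simp add: Const_def)
lemma Const_1 [simp]: "Const 1 = 1" by (simp add: Const_def)
lemma Const_add: "Const (a + b) = Const a + Const b" by (simp add: Const_def single_add)
lemma Const_mult: "Const (a * b) = Const a * Const (b :: 'k::comm_semiring_1)"
  by (simp add: Const_def mult_single)
lemma coeff_hom_Const: "coeff_hom (Const :: 'k::comm_semiring_1 \<Rightarrow> _)"
  by standard (auto simp: Const_add Const_mult)

lemma coeff_hom_poly: "coeff_hom (\<lambda>c::'k::comm_semiring_1. [:c:])"
  by standard (auto simp: one_pCons mult.commute)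

lemma eval_at_simps [simp]:
  "eval_at x 0 = 0" "eval_at x (Const c) = c" "eval_at x (Var i) = x i"
  "eval_at x (p + q) = eval_at x p + eval_at x q"
  "eval_at x (p * q) = eval_at x p * eval_at x q"
  "eval_at x (sum f A) = (\<Sum>a\<in>A. eval_at x (f a))"
  unfolding eval_at_def
  by (simp_all add: coeff_hom.eval_0[OF coeff_hom_id] coeff_hom.eval_Const[OF coeff_hom_id]
      coeff_hom.eval_Var[OF coeff_hom_id] coeff_hom.eval_add[OF coeff_hom_id]
      coeff_hom.eval_mult[OF coeff_hom_id] coeff_hom.eval_sum[OF coeff_hom_id])

lemma eval_at_1 [simp]: "eval_at x 1 = 1"
  using eval_at_simps(2)[of x 1] by simp

lemma eval_at_prod [simp]: "eval_at x (prod f A) = (\<Prod>a\<in>A. eval_at x (f a))"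
  by (induction A rule: infinite_finite_induct) simp_all

lemma eval_at_uminus [simp]: "eval_at x (- p :: 'k::comm_ring_1 mvpoly) = - eval_at x p"
  using eval_at_simps(4)[of x p "- p"] by (simp add: add_eq_0_iff)

lemma eval_at_minus [simp]: "eval_at x (p - q :: 'k::comm_ring_1 mvpoly) = eval_at x p - eval_at x q"
  using eval_at_simps(4)[of x p "- q"] by simp

lemma eval_at_mon: "eval_at x p = (\<Sum>m\<in>keys p. lookup p m * mon x m)"
  by (simp add: eval_at_def eval_via_mon)

lemma subst_simps [simp]:
  "subst f 0 = 0" "subst f (Const c) = Const c" "subst f (Var i) = f i"
  "subst f (p + q) = subst f p + subst f q"
  "subst f (p * q) = subst f p * subst f q"
  "subst f (sum g A) = (\<Sum>a\<in>A. subst f (g a))"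
  unfolding subst_def
  by (simp_all add: coeff_hom.eval_0[OF coeff_hom_Const] coeff_hom.eval_Const[OF coeff_hom_Const]
      coeff_hom.eval_Var[OF coeff_hom_Const] coeff_hom.eval_add[OF coeff_hom_Const]
      coeff_hom.eval_mult[OF coeff_hom_Const] coeff_hom.eval_sum[OF coeff_hom_Const])

lemma subst_minus [simp]: "subst f (p - q :: 'k::comm_ring_1 mvpoly) = subst f p - subst f q"
  by (metis add_diff_cancel_right' diff_add_cancel subst_simps(4))

text \<open>Constants and variables generate the polynomial ring, so facts comparing ring
  homomorphisms, such as evaluation after substitution, reduce to generators.\<close>

lemma mvpoly_induct [case_names Const Var add mult]:
  fixes p :: "'k::comm_semiring_1 mvpoly"
  assumes C: "\<And>c. P (Const c)" and V: "\<And>i. P (Var i)"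
    and A: "\<And>p q. P p \<Longrightarrow> P q \<Longrightarrow> P (p + q)" and M: "\<And>p q. P p \<Longrightarrow> P q \<Longrightarrow> P (p * q)"
  shows "P p"
proof -
  have sng1: "P (single m (1::'k))" for m
  \<comment> \<open>The rule only rewrites m as a finite sum of one-variable exponents; the genuine
    induction runs over the set of summands.\<close>
  proof (induction m rule: poly_mapping_sum_single[THEN ssubst])
    case 1
    have "P (single (\<Sum>i\<in>S. single i (lookup m i)) 1)" if "finite S" for S
      using that
    proof (induction S)
      case empty
      then show ?case using C[of 1] by simp
    next
      case (insert i S)
      have "P (single (single i k) 1)" for k
      proof (induction k)
        case 0
        then show ?case using C[of 1] by simp
      next
        case (Suc k)
        have "single (single i (Suc k)) (1::'k) = Var i * single (single i k) 1"
          by (simp add: Var_def mult_single flip: single_add)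
        then show ?case using M[OF V Suc] by simp
      qed
      from M[OF this insert.IH]
      show ?case using insert.hyps by (simp add: mult_single)
    qed
    then show ?case by simp
  qed
  have single: "P (single m c)" for m c
  proof -
    have "single m c = Const c * single m 1" by (simp add: Const_def mult_single)
    then show ?thesis using M[OF C sng1] by simp
  qed
  have "P (\<Sum>m\<in>S. single m (lookup p m))" if "finite S" for S
    using that by (induction S) (use C[of 0] A single in auto)
  then show ?thesis using poly_mapping_sum_single[of p] by (metis finite_keys)
qed

lemma eval_at_subst: "eval_at x (subst f p) = eval_at (\<lambda>i. eval_at x (f i)) p"
  by (induction p rule: mvpoly_induct) simp_all

text \<open>The univariate polynomial p(x + t v) in t. From the origin its coefficients are the
  homogeneous parts at v; from a general x its coefficient of t is the derivative of p at x in the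
  direction v.\<close>

definition line :: "'k::comm_semiring_1 mvpoly \<Rightarrow> (nat \<Rightarrow> 'k) \<Rightarrow> (nat \<Rightarrow> 'k) \<Rightarrow> 'k poly" where
  "line p x v = eval_via (\<lambda>c. [:c:]) (\<lambda>i. [:x i, v i:]) p"

lemma line_simps [simp]:
  "line 0 x v = 0" "line (Const c) x v = [:c:]" "line (Var i) x v = [:x i, v i:]"
  "line (p + q) x v = line p x v + line q x v"
  "line (p * q) x v = line p x v * line q x v"
  "line (sum f A) x v = (\<Sum>a\<in>A. line (f a) x v)"
  unfolding line_def
  by (simp_all add: coeff_hom.eval_0[OF coeff_hom_poly] coeff_hom.eval_Const[OF coeff_hom_poly]
      coeff_hom.eval_Var[OF coeff_hom_poly] coeff_hom.eval_add[OF coeff_hom_poly]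
      coeff_hom.eval_mult[OF coeff_hom_poly] coeff_hom.eval_sum[OF coeff_hom_poly])

lemma line_1 [simp]: "line 1 x v = 1"
  using line_simps(2)[of 1 x v] by (simp add: one_pCons)

lemma line_prod [simp]: "line (prod f A) x v = (\<Prod>a\<in>A. line (f a) x v)"
  by (induction A rule: infinite_finite_induct) simp_all

lemma line_minus [simp]: "line (p - q :: 'k::comm_ring_1 mvpoly) x v = line p x v - line q x v"
  by (metis add_diff_cancel_right' diff_add_cancel line_simps(4))

lemma poly_line: "poly (line p x v) t = eval_at (\<lambda>i. x i + t * v i) p"
  by (induction p rule: mvpoly_induct) simp_all

lemma line_subst_shift: "line (subst (\<lambda>i. Var i + Const (s i)) p) x v = line p (\<lambda>i. x i + s i) v"
  by (induction p rule: mvpoly_induct) simp_all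

lemma line_pcompose: "pcompose (line p x v) [:u, 1:] = line p (\<lambda>i. x i + u * v i) v"
  by (induction p rule: mvpoly_induct) (simp_all add: pcompose_add pcompose_mult pcompose_pCons ac_simps)

lemma lookup_hom_component:
  "lookup (hom_component d p) m = (if mon_degree m = d then lookup p m else 0)"
proof -
  have "lookup (hom_component d p) m
      = (\<Sum>m'\<in>{m\<in>keys p. mon_degree m = d}. if m' = m then lookup p m' else 0)"
    unfolding hom_component_def lookup_sum by (intro sum.cong) (auto simp: lookup_single when_def)
  also have "\<dots> = (if m \<in> {m\<in>keys p. mon_degree m = d} then lookup p m else 0)"
    by (rule sum.delta) simp
  finally show ?thesis by (auto simp: in_keys_iff)
qed

lemma mon_scaled: "mon (\<lambda>i. [:0, y i:]) m = monom (mon y m) (mon_degree m)"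
proof -
  have "(\<Prod>i\<in>S. [:0, y i:] ^ lookup m i) = monom (\<Prod>i\<in>S. y i ^ lookup m i) (\<Sum>i\<in>S. lookup m i)"
    if "finite S" for S
    using that
  proof (induction S)
    case (insert i S)
    have "[:0, y i:] = monom (y i) 1" by (simp add: monom_altdef)
    then show ?case using insert by (simp add: monom_power mult_monom)
  qed (simp add: one_pCons monom_0)
  then show ?thesis by (simp add: mon_def mon_degree_def)
qed

lemma line_0: "line p (\<lambda>_. 0) y = (\<Sum>m\<in>keys p. monom (lookup p m * mon y m) (mon_degree m))"
  by (simp add: line_def eval_via_mon mon_scaled smult_monom)

text \<open>On a ray from the origin all monomials of degree k contribute to t^k. Degree bounds and
  leading parts can thus be read off from values at points.\<close>

lemma coeff_line_0: "coeff (line p (\<lambda>_. 0) y) k = eval_at y (hom_component k p)"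
proof -
  have K: "keys (hom_component k p) = {m\<in>keys p. mon_degree m = k}"
    by (auto simp: in_keys_iff lookup_hom_component split: if_splits)
  have "coeff (line p (\<lambda>_. 0) y) k = (\<Sum>m\<in>keys p. if mon_degree m = k then lookup p m * mon y m else 0)"
    by (simp add: line_0 coeff_sum)
  also have "\<dots> = (\<Sum>m\<in>{m\<in>keys p. mon_degree m = k}. lookup p m * mon y m)"
    by (intro sum.mono_neutral_cong_right) auto
  finally show ?thesis by (simp add: eval_at_mon K lookup_hom_component)
qed

text \<open>Makes the exponents of the Kronecker substitution distinct.\<close>

lemma digits_unique:
  fixes a b :: "nat \<Rightarrow> nat"
  assumes "\<And>i. i < K \<Longrightarrow> a i < N" "\<And>i. i < K \<Longrightarrow> b i < N"
    and "(\<Sum>i<K. a i * N ^ i) = (\<Sum>i<K. b i * N ^ i)" and "i < K"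
  shows "a i = b i"
  using assms
proof (induction K arbitrary: a b i)
  case (Suc K)
  have e: "(\<Sum>i<Suc K. c i * N ^ i) = c 0 + N * (\<Sum>i<K. c (Suc i) * N ^ i)" for c :: "nat \<Rightarrow> nat"
    by (subst sum.lessThan_Suc_shift) (simp add: sum_distrib_left ac_simps)
  have eq: "a 0 + N * (\<Sum>i<K. a (Suc i) * N ^ i) = b 0 + N * (\<Sum>i<K. b (Suc i) * N ^ i)"
    using Suc.prems(3) unfolding e .
  have lt: "a 0 < N" "b 0 < N" using Suc.prems by auto
  have 0: "a 0 = b 0"
    using arg_cong[OF eq, of "\<lambda>z. z mod N"] lt by simp
  with eq lt have "(\<Sum>i<K. a (Suc i) * N ^ i) = (\<Sum>i<K. b (Suc i) * N ^ i)" by simp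
  from Suc.IH[of "\<lambda>i. a (Suc i)" "\<lambda>i. b (Suc i)", OF _ _ this] Suc.prems 0
  show ?case by (cases i) auto
qed simp

text \<open>Kronecker substitution \<open>z\<^sub>i \<mapsto> t\<^bsup>N^i\<^esup>\<close> separates the finitely many monomials of a polynomial.\<close>

lemma eval_at_eq_0_imp:
  fixes p :: "'k::field_char_0 mvpoly"
  assumes "\<And>x. eval_at x p = 0"
  shows "p = 0"
proof (rule poly_mapping_eqI)
  fix m0
  \<comment> \<open>\<open>K\<close> exceeds every variable index and \<open>N\<close> every
    exponent occurring in p, so an exponent vector is the base \<open>N\<close> digit sequence of
    its \<open>step_weight\<close>.\<close>
  define K where "K = Suc (Max (insert 0 (\<Union>m\<in>keys p. keys m)))"
  define N where "N = Suc (Max (insert 0 (\<Union>m\<in>keys p. lookup m ` keys m)))"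
  define step_weight where "step_weight m = (\<Sum>i<K. lookup m i * N ^ i)" for m :: "nat \<Rightarrow>\<^sub>0 nat"
  have K: "keys m \<subseteq> {..<K}" if "m \<in> keys p" for m
    using that by (auto simp: K_def less_Suc_eq_le intro!: Max_ge)
  have N: "lookup m i < N" if "m \<in> keys p" for m i
  proof (cases "i \<in> keys m")
    case True
    then show ?thesis using that by (auto simp: N_def less_Suc_eq_le intro!: Max_ge)
  qed (simp add: N_def in_keys_iff)
  have inj: "m = m0" if "m \<in> keys p" "m0 \<in> keys p" "step_weight m = step_weight m0" for m
  proof (rule poly_mapping_eqI)
    fix i
    show "lookup m i = lookup m0 i"
    proof (cases "i < K")
      case True
      show ?thesis
        by (rule digits_unique[of K "lookup m" N "lookup m0"]) (use that True N in \<open>auto simp: step_weight_def\<close>)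
    next
      case False
      then show ?thesis using K that by (metis in_keys_iff lessThan_iff subsetD)
    qed
  qed
  define P where "P = (\<Sum>m\<in>keys p. monom (lookup p m) (step_weight m))"
  have "poly P t = 0" for t
  proof -
    have "mon (\<lambda>i. t ^ (N ^ i)) m = t ^ step_weight m" if "m \<in> keys p" for m
      using K[OF that]
      by (simp add: mon_superset[of "{..<K}"] step_weight_def power_sum ac_simps flip: power_mult)
    then have "poly P t = eval_at (\<lambda>i. t ^ (N ^ i)) p"
      by (simp add: P_def poly_sum poly_monom eval_at_mon)
    then show ?thesis using assms by simp
  qed
  then have P0: "P = 0" using poly_all_0_iff_0 by blast
  show "lookup p m0 = lookup 0 m0"
  proof (cases "m0 \<in> keys p")
    case True
    have "coeff P (step_weight m0) = (\<Sum>m\<in>keys p. if m = m0 then lookup p m else 0)"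
      unfolding P_def coeff_sum coeff_monom using inj True by (intro sum.cong) auto
    also have "\<dots> = lookup p m0" using True by simp
    finally show ?thesis using P0 by simp
  qed (simp add: in_keys_iff)
qed

text \<open>The polynomial ring has no zero divisors, so multiplying by g removes the exceptional
  points. With g a common denominator, identities need checking only where all fractions are
  defined.\<close>

lemma mvpoly_eqI_generic:
  fixes p q g :: "'k::field_char_0 mvpoly"
  assumes "g \<noteq> 0" "\<And>x. eval_at x g \<noteq> 0 \<Longrightarrow> eval_at x p = eval_at x q"
  shows "p = q"
proof -
  have "eval_at x (g * (p - q)) = 0" for x
    using assms(2)[of x] by (cases "eval_at x g = 0") auto
  then have "g * (p - q) = 0" by (rule eval_at_eq_0_imp)
  then show ?thesis using assms(1) by simp
qed

lemma mvpoly_eqI: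
  fixes p q :: "'k::field_char_0 mvpoly"
  assumes "\<And>x. eval_at x p = eval_at x q"
  shows "p = q"
  using mvpoly_eqI_generic[of 1 p q] assms by simp

text \<open>A bound instead of the exact \<open>total_degree\<close>: it passes to sums even when
  leading terms cancel, and it is all that interpolation needs.\<close>

definition deg_le :: "nat \<Rightarrow> 'k::zero mvpoly \<Rightarrow> bool" where
  "deg_le d p \<longleftrightarrow> (\<forall>m\<in>keys p. mon_degree m \<le> d)"

lemma total_degree_le_iff: "total_degree p \<le> d \<longleftrightarrow> deg_le d p"
  by (auto simp: total_degree_def deg_le_def)

lemma deg_le_mono: "deg_le d p \<Longrightarrow> d \<le> e \<Longrightarrow> deg_le e p"
  by (auto simp: deg_le_def)

lemma degree_line_le:
  assumes "deg_le d p" shows "degree (line p (\<lambda>_. 0) y) \<le> d"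
  unfolding line_0 using assms
  by (intro degree_sum_le) (auto simp: deg_le_def intro: order.trans[OF degree_monom_le])

text \<open>By \<open>coeff_line_0\<close> a component of degree above d vanishes wherever g does
  not, hence it is zero.\<close>

lemma deg_le_generic:
  fixes p g :: "'k::field_char_0 mvpoly"
  assumes "g \<noteq> 0" "\<And>y. eval_at y g \<noteq> 0 \<Longrightarrow> degree (line p (\<lambda>_. 0) y) \<le> d"
  shows "deg_le d p"
  unfolding deg_le_def
proof (intro ballI leI notI)
  fix m assume m: "m \<in> keys p" "d < mon_degree m"
  have "hom_component (mon_degree m) p = 0"
    by (rule mvpoly_eqI_generic[OF assms(1)])
      (use assms(2) m in \<open>auto simp flip: coeff_line_0 intro!: coeff_eq_0\<close>, meson order.strict_trans1)
  then have "lookup p m = 0" using lookup_hom_component[of "mon_degree m" p m] by simp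
  with m show False by (simp add: in_keys_iff)
qed

lemma deg_le_iff:
  fixes p :: "'k::field_char_0 mvpoly"
  shows "deg_le d p \<longleftrightarrow> (\<forall>y. degree (line p (\<lambda>_. 0) y) \<le> d)"
  using degree_line_le[of d p] deg_le_generic[of 1 p d] by auto

lemma deg_le_mult:
  "deg_le d p \<Longrightarrow> deg_le e q \<Longrightarrow> deg_le (d + e) (p * q :: 'k::field_char_0 mvpoly)"
  unfolding deg_le_iff by (auto intro: order.trans[OF degree_mult_le] add_mono)

lemma deg_le_add: "deg_le d p \<Longrightarrow> deg_le d q \<Longrightarrow> deg_le d (p + q :: 'k::field_char_0 mvpoly)"
  unfolding deg_le_iff by (auto intro: degree_add_le)

lemma deg_le_minus: "deg_le d p \<Longrightarrow> deg_le d q \<Longrightarrow> deg_le d (p - q :: 'k::field_char_0 mvpoly)"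
  unfolding deg_le_iff by (auto intro: degree_diff_le)

lemma deg_le_sum:
  "(\<And>a. a \<in> A \<Longrightarrow> deg_le d (f a)) \<Longrightarrow> deg_le d (sum f A :: 'k::field_char_0 mvpoly)"
  by (induction A rule: infinite_finite_induct) (auto simp: deg_le_add deg_le_def[of _ 0])

lemma deg_le_Const [simp]: "deg_le d (Const c)"
  by (auto simp: deg_le_def Const_def mon_degree_def split: if_splits)

lemma deg_le_Var: "deg_le 1 (Var i :: 'k::field_char_0 mvpoly)"
  unfolding deg_le_iff by simp

lemma hom_component_sum_eq:
  assumes "deg_le d p" shows "p = (\<Sum>k\<le>d. hom_component k p)"
proof (rule poly_mapping_eqI)
  fix m
  show "lookup p m = lookup (\<Sum>k\<le>d. hom_component k p) m"
    using assms by (auto simp: lookup_sum lookup_hom_component deg_le_def in_keys_iff)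
qed

section \<open>Dependence on coordinates, and homogeneous polynomials along lines\<close>

lemma line_cong:
  assumes "p \<in> polys n" "\<And>i. i \<in> {1..n} \<Longrightarrow> x i = x' i" "\<And>i. i \<in> {1..n} \<Longrightarrow> v i = v' i"
  shows "line p x v = line p x' v'"
  unfolding line_def eval_via_def
  by (intro sum.cong arg_cong2[of _ _ _ _ "(*)"] prod.cong refl arg_cong2[of _ _ _ _ "(^)"])
    (use assms in \<open>auto simp: polys_def subset_iff\<close>)

lemma eval_at_cong:
  assumes "p \<in> polys n" "\<And>i. i \<in> {1..n} \<Longrightarrow> x i = x' i"
  shows "eval_at x p = eval_at x' p"
  unfolding eval_at_def eval_via_def
  by (intro sum.cong arg_cong2[of _ _ _ _ "(*)"] prod.cong refl arg_cong2[of _ _ _ _ "(^)"])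
    (use assms in \<open>auto simp: polys_def subset_iff\<close>)

lemma eval_at_hom_scale:
  fixes f :: "'k::field_char_0 mvpoly"
  shows "eval_at (\<lambda>i. t * x i) (hom_component k f) = t ^ k * eval_at x (hom_component k f)"
proof -
  have "mon (\<lambda>i. t * x i) m = t ^ mon_degree m * mon x m" for m
    by (simp add: mon_def mon_degree_def power_mult_distrib prod.distrib power_sum)
  then show ?thesis
    unfolding eval_at_mon sum_distrib_left
    by (intro sum.cong) (auto simp: in_keys_iff lookup_hom_component split: if_splits)
qed

lemma deg_le_hom: "deg_le k (hom_component k f)"
  by (auto simp: deg_le_def in_keys_iff lookup_hom_component split: if_splits)

lemma degree_line_mon_le: "degree (mon (\<lambda>i. [:x i, v i:]) m) \<le> mon_degree m"
proof -
  have "degree (\<Prod>i\<in>S. [:x i, v i:] ^ lookup m i) \<le> (\<Sum>i\<in>S. lookup m i)" if "finite S" for S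
    using that
  proof (induction S)
    case (insert i S)
    have "degree ([:x i, v i:] ^ lookup m i) \<le> 1 * lookup m i"
      by (rule order.trans[OF degree_power_le mult_right_mono]) auto
    then show ?case using insert
      by (auto intro: order.trans[OF degree_mult_le] add_mono)
  qed auto
  then show ?thesis by (simp add: mon_def mon_degree_def)
qed

lemma degree_line_le':
  assumes "deg_le d p" shows "degree (line p x v) \<le> d"
  unfolding line_def eval_via_mon using assms
  by (intro degree_sum_le) (auto simp: deg_le_def intro: order.trans[OF degree_smult_le] order.trans[OF degree_line_mon_le])

lemma poly_eqI_nonzero:
  fixes p q :: "'k::field_char_0 poly"
  assumes "\<And>t. t \<noteq> 0 \<Longrightarrow> poly p t = poly q t"
  shows "p = q"
proof -
  have "poly ([:0, 1:] * (p - q)) t = 0" for t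
    using assms[of t] by (cases "t = 0") auto
  then have "[:0, 1:] * (p - q) = 0" using poly_all_0_iff_0 by blast
  then show ?thesis by simp
qed

text \<open>Homogeneity gives h(s + t y) = t^k h(y + s/t): exchanging base point and direction
  reverses the coefficients.\<close>

lemma line_hom_reverse:
  fixes f :: "'k::field_char_0 mvpoly" and k :: nat
  defines "h \<equiv> hom_component k f"
  shows "line h s y = (\<Sum>j\<le>k. monom (coeff (line h y s) j) (k - j))"
proof (rule poly_eqI_nonzero)
  fix t :: 'k assume t: "t \<noteq> 0"
  have "poly (line h s y) t = eval_at (\<lambda>i. t * (y i + inverse t * s i)) h"
    using t by (simp add: poly_line distrib_left add.commute mult.assoc[symmetric])
  also have "\<dots> = t ^ k * poly (line h y s) (inverse t)"
    unfolding h_def eval_at_hom_scale by (simp add: poly_line)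
  also have "poly (line h y s) (inverse t) = (\<Sum>j\<le>k. coeff (line h y s) j * inverse t ^ j)"
    by (subst poly_as_sum_of_monoms'[symmetric, of _ k])
      (simp_all add: degree_line_le' deg_le_hom h_def poly_sum poly_monom)
  also have "t ^ k * \<dots> = (\<Sum>j\<le>k. coeff (line h y s) j * t ^ (k - j))"
    unfolding sum_distrib_left using t by (intro sum.cong) (auto simp: power_diff field_simps)
  finally show "poly (line h s y) t = poly (\<Sum>j\<le>k. monom (coeff (line h y s) j) (k - j)) t"
    by (simp add: poly_sum poly_monom)
qed

section \<open>Linear factors, directional derivatives and invariants\<close>

lemma polys_0 [intro, simp]: "0 \<in> polys n" by (simp add: polys_def)

lemma polys_Const [intro, simp]: "Const c \<in> polys n"
  by (auto simp: polys_def Const_def)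

lemma polys_1 [intro, simp]: "(1 :: 'k::comm_semiring_1 mvpoly) \<in> polys n"
  using polys_Const[of "1 :: 'k" n] by simp

lemma polys_Var [intro]: "i \<in> {1..n} \<Longrightarrow> Var i \<in> polys n"
  by (auto simp: polys_def Var_def)

lemma polys_add [intro]: "p \<in> polys n \<Longrightarrow> q \<in> polys n \<Longrightarrow> p + q \<in> polys n"
  using keys_add[of p q] by (fastforce simp: polys_def)

lemma polys_uminus [intro]: "p \<in> polys n \<Longrightarrow> - p \<in> polys n"
  for p :: "'k::comm_ring_1 mvpoly"
  by (auto simp: polys_def in_keys_iff)

lemma polys_minus [intro]: "p \<in> polys n \<Longrightarrow> q \<in> polys n \<Longrightarrow> p - q \<in> polys n"
  for p :: "'k::comm_ring_1 mvpoly"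
  using polys_add[of p n "- q"] by auto

lemma polys_mult [intro]: "p \<in> polys n \<Longrightarrow> q \<in> polys n \<Longrightarrow> p * q \<in> polys n"
  for p :: "'k::comm_semiring_1 mvpoly"
  unfolding polys_def
proof safe
  fix m i
  assume p: "\<forall>m\<in>keys p. keys m \<subseteq> {1..n}" and q: "\<forall>m\<in>keys q. keys m \<subseteq> {1..n}"
    and m: "m \<in> keys (p * q)" and i: "i \<in> keys m"
  from m obtain a b where "m = a + b" "a \<in> keys p" "b \<in> keys q" using keys_mult by blast
  with p q i show "i \<in> {1..n}" using keys_add[of a b] by blast
qed

lemma polys_sum [intro]: "(\<And>a. a \<in> A \<Longrightarrow> f a \<in> polys n) \<Longrightarrow> sum f A \<in> polys n"
  by (induction A rule: infinite_finite_induct) auto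

lemma polys_prod [intro]: "(\<And>a. a \<in> A \<Longrightarrow> f a \<in> polys n) \<Longrightarrow> prod f A \<in> polys n"
  for f :: "_ \<Rightarrow> 'k::comm_semiring_1 mvpoly"
  by (induction A rule: infinite_finite_induct) auto

lemma polys_power [intro]: "p \<in> polys n \<Longrightarrow> p ^ k \<in> polys n"
  for p :: "'k::comm_semiring_1 mvpoly"
  by (induction k) auto

lemma polys_subst:
  fixes p :: "'k::comm_semiring_1 mvpoly"
  assumes "p \<in> polys n" "\<And>i. i \<in> {1..n} \<Longrightarrow> f i \<in> polys n'"
  shows "subst f p \<in> polys n'"
  unfolding subst_def eval_via_def
proof (intro polys_sum polys_mult polys_Const polys_prod polys_power)
  fix m i assume "m \<in> keys p" "i \<in> keys m"
  then have "i \<in> {1..n}" using assms(1) unfolding polys_def by blast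
  then show "f i \<in> polys n'" by (rule assms(2))
qed

lemma polys_shift: "p \<in> polys n \<Longrightarrow> subst (\<lambda>i. Var i + Const (s i)) p \<in> polys n"
  by (rule polys_subst[of p n], assumption, intro polys_add polys_Var polys_Const)

lemma polys_hom_component: "p \<in> polys n \<Longrightarrow> hom_component d p \<in> polys n"
  by (auto simp: polys_def in_keys_iff lookup_hom_component split: if_splits)

text \<open>A linear form \<open>z\<^sub>a - q\<close> with \<open>q\<close> free of \<open>z\<^sub>a\<close> is prime: it is the kernel of the substitution
  \<open>z\<^sub>a \<mapsto> q\<close>.\<close>

definition replace_var :: "nat \<Rightarrow> 'k mvpoly \<Rightarrow> 'k mvpoly \<Rightarrow> 'k::comm_semiring_1 mvpoly" where
  "replace_var a q p = subst (\<lambda>i. if i = a then q else Var i) p"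

lemma replace_var_simps [simp]:
  "replace_var a q 0 = 0" "replace_var a q 1 = 1" "replace_var a q (Const c) = Const c"
  "replace_var a q (Var i) = (if i = a then q else Var i)"
  "replace_var a q (u + v) = replace_var a q u + replace_var a q v" "replace_var a q (u * v) = replace_var a q u * replace_var a q v"
  unfolding replace_var_def using subst_simps(2)[of _ 1] by simp_all

lemma replace_var_minus [simp]: "replace_var a q (u - v :: 'k::comm_ring_1 mvpoly) = replace_var a q u - replace_var a q v"
  by (simp add: replace_var_def)

lemma eval_at_replace_var: "eval_at x (replace_var a q p) = eval_at (x(a := eval_at x q)) p"
  unfolding replace_var_def eval_at_subst by (rule arg_cong[of _ _ "\<lambda>f. eval_at f p"]) auto

lemma dvd_diff_subst:
  fixes p :: "'k::field_char_0 mvpoly"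
  shows "Var a - q dvd p - replace_var a q p"
proof (induction p rule: mvpoly_induct)
  case (add p1 p2)
  then have "Var a - q dvd (p1 - replace_var a q p1) + (p2 - replace_var a q p2)"
    by (rule dvd_add)
  then show ?case by (simp add: algebra_simps)
next
  case (mult p1 p2)
  let ?s = "replace_var a q"
  have "Var a - q dvd p1 * (p2 - ?s p2) + (p1 - ?s p1) * ?s p2"
    using mult by (intro dvd_add dvd_mult dvd_mult2)
  then show ?case by (simp add: algebra_simps)
qed auto

lemma linear_dvd_iff:
  fixes p :: "'k::field_char_0 mvpoly"
  assumes "replace_var a q q = q"
  shows "Var a - q dvd p \<longleftrightarrow> replace_var a q p = 0"
proof
  assume "Var a - q dvd p"
  then obtain u where "p = (Var a - q) * u" by (auto elim: dvdE)
  then show "replace_var a q p = 0" using assms by simp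
next
  assume "replace_var a q p = 0"
  then show "Var a - q dvd p" using dvd_diff_subst[of a q p] by simp
qed

lemma Var_diff_nonzero:
  "a \<noteq> b \<Longrightarrow> Var a - Var b \<noteq> (0 :: 'k::field_char_0 mvpoly)"
proof
  assume "a \<noteq> b" "Var a - Var b = (0 :: 'k mvpoly)"
  from arg_cong[OF this(2), of "eval_at (\<lambda>i. if i = a then 1 else 0)"] this(1) show False by simp
qed

lemma prime_elem_linear:
  fixes q :: "'k::field_char_0 mvpoly"
  assumes "replace_var a q q = q" "Var a - q \<noteq> 0"
  shows "prime_elem (Var a - q)"
  unfolding prime_elem_def
proof (intro conjI allI impI)
  show "\<not> Var a - q dvd 1" using linear_dvd_iff[OF assms(1), of 1] by simp
qed (use assms in \<open>auto simp: linear_dvd_iff\<close>)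

lemma prime_elem_power_dvd_mult:
  fixes p :: "'a::idom"
  assumes "prime_elem p" "p ^ e dvd a * b" "\<not> p dvd a"
  shows "p ^ e dvd b"
  using assms(2)
proof (induction e arbitrary: b)
  case (Suc e)
  have "p dvd a * b" using Suc.prems by (rule dvd_trans[rotated]) simp
  then have "p dvd b" using assms by (auto simp: prime_elem_def)
  then obtain c where c: "b = p * c" by (auto elim: dvdE)
  have "p * p ^ e dvd p * (a * c)" using Suc.prems by (simp add: c ac_simps)
  then have "p ^ e dvd a * c" using assms(1) by (simp add: prime_elem_def)
  from Suc.IH[OF this] show ?case by (simp add: c mult_dvd_mono)
qed simp

lemma prime_elem_not_dvd_prod:
  fixes p :: "'a::idom"
  assumes "finite T" "prime_elem p" "\<And>t. t \<in> T \<Longrightarrow> \<not> p dvd f t"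
  shows "\<not> p dvd (\<Prod>t\<in>T. f t)"
  using assms by (induction T) (auto simp: prime_elem_def)

text \<open>Successive division: a prime dividing none of the earlier factors must have its full
  power in the cofactor. This replaces an appeal to unique factorisation.\<close>

lemma prod_prime_power_dvd:
  fixes l :: "'i \<Rightarrow> 'a::idom"
  assumes "finite S" "\<And>s. s \<in> S \<Longrightarrow> prime_elem (l s)"
    "\<And>s t. s \<in> S \<Longrightarrow> t \<in> S \<Longrightarrow> s \<noteq> t \<Longrightarrow> \<not> l s dvd l t"
    "\<And>s. s \<in> S \<Longrightarrow> l s ^ e dvd G"
  shows "(\<Prod>s\<in>S. l s ^ e) dvd G"
  using assms
proof (induction S)
  case (insert s S)
  have "(\<Prod>s\<in>S. l s ^ e) dvd G"
    by (rule insert.IH) (use insert.prems in auto)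
  then obtain K where K: "G = (\<Prod>s\<in>S. l s ^ e) * K" by (rule dvdE)
  have p: "prime_elem (l s)" by (rule insert.prems) simp
  have "\<not> l s dvd l t ^ e" if "t \<in> S" for t
    using prime_elem_dvd_power[OF p] insert.prems(2)[of s t] that insert.hyps by auto
  then have "\<not> l s dvd (\<Prod>t\<in>S. l t ^ e)"
    by (rule prime_elem_not_dvd_prod[OF insert.hyps(1) p])
  moreover have "l s ^ e dvd (\<Prod>s\<in>S. l s ^ e) * K"
    using insert.prems(3)[of s] K by simp
  ultimately have "l s ^ e dvd K" using prime_elem_power_dvd_mult[OF p] by blast
  then have "(\<Prod>s\<in>S. l s ^ e) * l s ^ e dvd G" unfolding K by (rule mult_dvd_mono[OF dvd_refl])
  then show ?case using insert.hyps by (simp add: mult.commute)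
qed simp

lemma coeff_line_const: "coeff (line p y v) 0 = eval_at y (p :: 'k::comm_semiring_1 mvpoly)"
proof -
  have "coeff (line p y v) 0 = poly (line p y v) 0" by (rule poly_0_coeff_0[symmetric])
  also have "\<dots> = eval_at y p" unfolding poly_line by simp
  finally show ?thesis .
qed

lemma coeff_mult_1: "coeff (p * q) 1 = coeff p 0 * coeff q 1 + coeff p 1 * coeff q 0"
  for p q :: "'a::comm_semiring_1 poly"
  by (simp add: coeff_mult)

text \<open>The directional derivative is linear in the direction; on products this is the Leibniz
  rule \<open>coeff_mult_1\<close>.\<close>

lemma coeff_line_linear:
  fixes p :: "'k::comm_semiring_1 mvpoly"
  shows "coeff (line p y (\<lambda>i. \<Sum>s\<in>S. c s * v s i)) 1 = (\<Sum>s\<in>S. c s * coeff (line p y (v s)) 1)"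
proof (induction p rule: mvpoly_induct)
  case (add p q)
  then show ?case by (simp add: distrib_left sum.distrib)
next
  case (mult p q)
  have "(\<Sum>s\<in>S. c s * coeff (line (p * q) y (v s)) 1)
      = (\<Sum>s\<in>S. eval_at y p * (c s * coeff (line q y (v s)) 1)
          + (c s * coeff (line p y (v s)) 1) * eval_at y q)"
    by (intro sum.cong refl) (simp only: line_simps coeff_mult_1 coeff_line_const distrib_left ac_simps)
  also have "\<dots> = coeff (line (p * q) y (\<lambda>i. \<Sum>s\<in>S. c s * v s i)) 1"
    by (simp only: line_simps coeff_mult_1 coeff_line_const mult sum.distrib sum_distrib_left sum_distrib_right)
  finally show ?case by simp
qed (simp_all add: coeff_pCons)

text \<open>A finite difference loses one degree, and its new leading part is a derivative. After
  the reversal \<open>line_hom_reverse\<close>, only the linear coefficient of the part of degree d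
  + 1 reaches t^d.\<close>

lemma line_shift_top:
  fixes f :: "'k::field_char_0 mvpoly" and s y :: "nat \<Rightarrow> 'k"
  assumes "deg_le (Suc d) f"
  defines "g \<equiv> line f s y - line f (\<lambda>_. 0) y"
  shows "degree g \<le> d" and "coeff g d = coeff (line (hom_component (Suc d) f) y s) 1"
proof -
  define h where "h k = hom_component k f" for k
  have f: "f = (\<Sum>k\<le>Suc d. h k)" unfolding h_def by (rule hom_component_sum_eq[OF assms(1)])
  have z: "line (h k) (\<lambda>_. 0) y = monom (eval_at y (h k)) k" for k
  proof -
    have "coeff (line (h k) y (\<lambda>_. 0)) j = (if j = 0 then eval_at y (h k) else 0)" for j
    proof -
      have "line (h k) y (\<lambda>_. 0) = [:eval_at y (h k):]" by (rule poly_eqI_nonzero) (simp add: poly_line)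
      then show ?thesis by (cases j) auto
    qed
    then have c: "coeff (line (h k) y (\<lambda>_. 0)) j = (if j = 0 then eval_at y (h k) else 0)" for j .
    have "line (h k) (\<lambda>_. 0) y = (\<Sum>j\<le>k. monom (coeff (line (h k) y (\<lambda>_. 0)) j) (k - j))"
      unfolding h_def by (rule line_hom_reverse)
    also have "\<dots> = (\<Sum>j\<le>k. if j = 0 then monom (eval_at y (h k)) k else 0)"
      by (intro sum.cong) (auto simp: c)
    finally show ?thesis by simp
  qed
  have e: "line (h k) s y - line (h k) (\<lambda>_. 0) y = (\<Sum>j\<in>{1..k}. monom (coeff (line (h k) y s) j) (k - j))" for k
  proof -
    have "line (h k) s y = (\<Sum>j\<le>k. monom (coeff (line (h k) y s) j) (k - j))"
      unfolding h_def by (rule line_hom_reverse)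
    also have "\<dots> = monom (coeff (line (h k) y s) 0) k + (\<Sum>j\<in>{1..k}. monom (coeff (line (h k) y s) j) (k - j))"
    proof -
      have "{..k} = insert 0 {1..k}" by auto
      then show ?thesis by simp
    qed
    finally show ?thesis by (simp add: z coeff_line_const)
  qed
  have lf: "line f x v = (\<Sum>k\<le>Suc d. line (h k) x v)" for x v
    by (subst f) (simp only: line_simps)
  have "g = (\<Sum>k\<le>Suc d. line (h k) s y - line (h k) (\<lambda>_. 0) y)"
    unfolding g_def lf by (rule sum_subtractf[symmetric])
  then have g: "g = (\<Sum>k\<le>Suc d. \<Sum>j\<in>{1..k}. monom (coeff (line (h k) y s) j) (k - j))"
    by (simp only: e)
  show "degree g \<le> d"
    unfolding g by (intro degree_sum_le) (auto intro!: order.trans[OF degree_monom_le])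
  have inner: "(\<Sum>j\<in>{1..k}. if k - j = d then coeff (line (h k) y s) j else 0)
      = (if k = Suc d then coeff (line (h k) y s) 1 else 0)" if "k \<le> Suc d" for k
  proof (cases "k = Suc d")
    case True
    have "(\<Sum>j\<in>{1..k}. if k - j = d then coeff (line (h k) y s) j else 0)
        = (\<Sum>j\<in>{1..k}. if j = 1 then coeff (line (h k) y s) j else 0)"
      by (rule sum.cong) (use True in auto)
    then show ?thesis using True by simp
  qed (use that in \<open>auto intro!: sum.neutral\<close>)
  have "coeff g d = (\<Sum>k\<le>Suc d. \<Sum>j\<in>{1..k}. if k - j = d then coeff (line (h k) y s) j else 0)"
    unfolding g by (simp only: coeff_sum coeff_monom)
  also have "\<dots> = (\<Sum>k\<le>Suc d. if k = Suc d then coeff (line (h k) y s) 1 else 0)"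
    by (rule sum.cong[OF refl], rule inner) simp
  also have "\<dots> = coeff (line (h (Suc d)) y s) 1"
    by (subst sum.delta) auto
  finally show "coeff g d = coeff (line (hom_component (Suc d) f) y s) 1" by (simp add: h_def)
qed

section \<open>Invariant polynomials\<close>

lemma W_permutes: "\<pi> \<in> W n \<Longrightarrow> \<pi> permutes {1..n}" by (simp add: W_def)

lemma invariants_iff:
  fixes p :: "'k::field_char_0 mvpoly"
  shows "p \<in> invariants n \<longleftrightarrow>
    p \<in> polys n \<and> (\<forall>\<pi>\<in>W n. \<forall>x. eval_at (\<lambda>i. x (\<pi> i)) p = eval_at x p)"
proof -
  have "subst (\<lambda>i. Var (\<pi> i)) p = p \<longleftrightarrow> (\<forall>x. eval_at (\<lambda>i. x (\<pi> i)) p = eval_at x p)" for \<pi>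
  proof
    assume e: "subst (\<lambda>i. Var (\<pi> i)) p = p"
    have "eval_at x (subst (\<lambda>i. Var (\<pi> i)) p) = eval_at (\<lambda>i. x (\<pi> i)) p" for x
      by (simp add: eval_at_subst)
    then show "\<forall>x. eval_at (\<lambda>i. x (\<pi> i)) p = eval_at x p" unfolding e by simp
  next
    assume "\<forall>x. eval_at (\<lambda>i. x (\<pi> i)) p = eval_at x p"
    then show "subst (\<lambda>i. Var (\<pi> i)) p = p"
      by (intro mvpoly_eqI) (simp add: eval_at_subst)
  qed
  then show ?thesis unfolding invariants_def by blast
qed

lemma invariants_polys: "p \<in> invariants n \<Longrightarrow> p \<in> polys n"
  by (simp add: invariants_def)

lemma invariants_add: "p \<in> invariants n \<Longrightarrow> q \<in> invariants n \<Longrightarrow> p + q \<in> invariants n"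
  and invariants_minus: "p \<in> invariants n \<Longrightarrow> q \<in> invariants n \<Longrightarrow> p - q \<in> invariants n"
  and invariants_mult: "p \<in> invariants n \<Longrightarrow> q \<in> invariants n \<Longrightarrow> p * q \<in> invariants n"
  and invariants_Const: "Const c \<in> invariants n"
  for p :: "'k::field_char_0 mvpoly" and c :: 'k
  by (auto simp: invariants_iff)

lemma invariants_sum: "(\<And>a. a \<in> A \<Longrightarrow> f a \<in> invariants n) \<Longrightarrow> sum f A \<in> invariants n"
  for f :: "_ \<Rightarrow> 'k::field_char_0 mvpoly"
  by (auto simp: invariants_iff polys_sum)

lemma invariants_shift:
  fixes p :: "'k::field_char_0 mvpoly"
  assumes "p \<in> invariants n" shows "subst (\<lambda>i. Var i + Const c) p \<in> invariants n"
  unfolding invariants_iff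
proof (intro conjI ballI allI)
  show "subst (\<lambda>i. Var i + Const c) p \<in> polys n"
    using assms by (intro polys_shift) (simp add: invariants_polys)
  fix \<pi> x assume "\<pi> \<in> W n"
  then have "eval_at (\<lambda>i. y (\<pi> i)) p = eval_at y p" for y
    using assms by (auto simp: invariants_iff)
  from this[of "\<lambda>i. x i + c"]
  show "eval_at (\<lambda>i. x (\<pi> i)) (subst (\<lambda>i. Var i + Const c) p) = eval_at x (subst (\<lambda>i. Var i + Const c) p)"
    by (simp add: eval_at_subst)
qed

section \<open>Difference operators on invariants\<close>

text \<open>For odd \<open>n\<close> there is one even index less than there are odd ones. The extra index \<open>n + 1\<close>
  stands for an even variable at infinity: differences with it count as \<open>1\<close> and steps do not move it.
  This treats both parities of \<open>n\<close> at once.\<close>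

definition odd_idx :: "nat \<Rightarrow> nat set" where "odd_idx n = {i \<in> {1..n}. odd i}"
definition even_idx :: "nat \<Rightarrow> nat set" where "even_idx n = {j \<in> {1..Suc n}. even j}"

abbreviation steps :: "nat \<Rightarrow> (nat \<times> nat) set" where "steps n \<equiv> odd_idx n \<times> even_idx n"

definition step_vec :: "nat \<Rightarrow> nat \<times> nat \<Rightarrow> nat \<Rightarrow> nat" where
  "step_vec n s p = (if p = fst s then 1 else 0) + (if p = snd s \<and> p \<le> n then 1 else 0)"

definition node_diff :: "nat \<Rightarrow> 'k \<Rightarrow> (nat \<Rightarrow> 'k) \<Rightarrow> nat \<Rightarrow> nat \<Rightarrow> 'k::field" where
  "node_diff n a x p q = (if p = Suc n \<or> q = Suc n then 1 else x p - x q - a)"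

text \<open>Each moved index is paired with the unmoved indices of the opposite parity here, and
  with those of its own parity in \<open>step_den\<close>. At \<rho> + \<mu> with a = r, a factor
  for neighbours p, p + 1 vanishes when their entries are equal, that is, when lowering only the
  entry at p would destroy the order.\<close>

definition step_num :: "nat \<Rightarrow> 'k \<Rightarrow> (nat \<Rightarrow> 'k) \<Rightarrow> nat \<times> nat \<Rightarrow> 'k::field" where
  "step_num n a x s = (\<Prod>q\<in>even_idx n - {snd s}. node_diff n a x (fst s) q) * (\<Prod>q\<in>odd_idx n - {fst s}. node_diff n a x (snd s) q)"

definition step_den :: "nat \<Rightarrow> (nat \<Rightarrow> 'k) \<Rightarrow> nat \<times> nat \<Rightarrow> 'k::field" where
  "step_den n x s = (\<Prod>q\<in>odd_idx n - {fst s}. node_diff n 0 x (fst s) q) * (\<Prod>q\<in>even_idx n - {snd s}. node_diff n 0 x (snd s) q)"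

definition step_coeff :: "nat \<Rightarrow> 'k \<Rightarrow> (nat \<Rightarrow> 'k) \<Rightarrow> nat \<times> nat \<Rightarrow> 'k::field" where
  "step_coeff n a x s = step_num n a x s / step_den n x s"

definition parity_pairs :: "nat \<Rightarrow> (nat \<times> nat) set" where
  "parity_pairs n = {(p, q). p \<in> {1..n} \<and> q \<in> {1..n} \<and> p \<noteq> q \<and> even p = even q}"

definition generic :: "nat \<Rightarrow> (nat \<Rightarrow> 'k) \<Rightarrow> bool" where
  "generic n x \<longleftrightarrow> (\<forall>(p, q)\<in>parity_pairs n. x p \<noteq> x q)"

text \<open>Each unordered pair occurs in both orders, so this is up to sign the square of a product
  of two Vandermonde determinants. The squaring makes it W-invariant, and it is a multiple of every
  \<open>step_den\<close>.\<close>

definition discr :: "nat \<Rightarrow> 'k::field_char_0 mvpoly" where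
  "discr n = (\<Prod>(p, q)\<in>parity_pairs n. Var p - Var q)"

lemma finite_sets [simp]: "finite (odd_idx n)" "finite (even_idx n)" "finite (parity_pairs n)"
proof -
  show "finite (odd_idx n)" "finite (even_idx n)" by (auto simp: odd_idx_def even_idx_def)
  show "finite (parity_pairs n)"
    by (rule finite_subset[of _ "{1..n} \<times> {1..n}"]) (auto simp: parity_pairs_def)
qed

lemma even_idx_eq: "even_idx n = Suc ` odd_idx n"
proof
  show "even_idx n \<subseteq> Suc ` odd_idx n"
  proof
    fix j assume "j \<in> even_idx n"
    then have "j = Suc (j - 1)" "j - 1 \<in> odd_idx n" by (auto simp: even_idx_def odd_idx_def elim!: evenE)
    then show "j \<in> Suc ` odd_idx n" by (rule image_eqI)
  qed
qed (auto simp: even_idx_def odd_idx_def)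

lemma card_even_idx: "card (even_idx n) = card (odd_idx n)"
  by (simp add: even_idx_eq card_image)

lemma eval_discr: "eval_at x (discr n) = (\<Prod>(p, q)\<in>parity_pairs n. x p - x q)"
  by (simp add: discr_def case_prod_beta)

lemma generic_iff: "generic n x \<longleftrightarrow> eval_at x (discr n) \<noteq> 0"
  by (auto simp: eval_discr generic_def)

lemma discr_nonzero: "discr n \<noteq> (0 :: 'k::field_char_0 mvpoly)"
  unfolding discr_def prod_zero_iff[OF finite_sets(3)]
  by (auto simp: parity_pairs_def dest: Var_diff_nonzero)

lemma eqI_generic:
  fixes p q :: "'k::field_char_0 mvpoly"
  assumes "\<And>x. generic n x \<Longrightarrow> eval_at x p = eval_at x q"
  shows "p = q"
  by (rule mvpoly_eqI_generic[OF discr_nonzero[of n]]) (use assms in \<open>auto simp: generic_iff\<close>)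

lemma node_diff_prod_eq:
  fixes x :: "nat \<Rightarrow> 'k::field"
  assumes "p \<in> odd_idx n \<or> p \<in> even_idx n"
  shows "(\<Prod>q\<in>(if odd p then odd_idx n else even_idx n) - {p}. node_diff n 0 x p q) = (\<Prod>(p', q)\<in>{t \<in> parity_pairs n. fst t = p}. x p' - x q)"
proof -
  let ?X = "if odd p then odd_idx n else even_idx n"
  have "(\<Prod>q\<in>?X - {p}. node_diff n 0 x p q) = (\<Prod>q\<in>{q \<in> ?X - {p}. p \<noteq> Suc n \<and> q \<noteq> Suc n}. node_diff n 0 x p q)"
    by (rule prod.mono_neutral_right) (auto simp: node_diff_def)
  also have "\<dots> = (\<Prod>(p', q)\<in>{t \<in> parity_pairs n. fst t = p}. x p' - x q)"
    by (rule prod.reindex_bij_witness[of _ snd "\<lambda>q. (p, q)"])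
       (use assms in \<open>auto simp: parity_pairs_def node_diff_def odd_idx_def even_idx_def split: if_splits\<close>)
  finally show ?thesis .
qed

lemma step_den_eq:
  fixes x :: "nat \<Rightarrow> 'k::field"
  assumes "s \<in> steps n"
  shows "step_den n x s = (\<Prod>(p, q)\<in>{t \<in> parity_pairs n. fst t \<in> {fst s, snd s}}. x p - x q)"
proof -
  have o: "odd (fst s)" "even (snd s)" using assms by (auto simp: odd_idx_def even_idx_def)
  have "{t \<in> parity_pairs n. fst t \<in> {fst s, snd s}} = {t \<in> parity_pairs n. fst t = fst s} \<union> {t \<in> parity_pairs n. fst t = snd s}" by auto
  moreover have "{t \<in> parity_pairs n. fst t = fst s} \<inter> {t \<in> parity_pairs n. fst t = snd s} = {}" using o by auto
  ultimately show ?thesis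
    using node_diff_prod_eq[of "fst s" n x] node_diff_prod_eq[of "snd s" n x] assms o
    by (auto simp: step_den_def prod.union_disjoint mem_Times_iff)
qed

lemma step_den_nonzero:
  fixes x :: "nat \<Rightarrow> 'k::field"
  assumes "s \<in> steps n" "generic n x"
  shows "step_den n x s \<noteq> 0"
  using assms by (auto simp: step_den_eq[OF assms(1)] generic_def)

text \<open>Used with a = r, \<eta> = -1 and a linear weight for lowering, and with a = -r, \<eta> =
  1 and weight 1 for raising. Taking differences kills constants and costs one degree before the
  weight is applied.\<close>

definition step_op :: "nat \<Rightarrow> 'k \<Rightarrow> 'k \<Rightarrow> (nat \<times> nat \<Rightarrow> 'k mvpoly) \<Rightarrow> 'k mvpoly \<Rightarrow> (nat \<Rightarrow> 'k) \<Rightarrow> 'k::field" where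
  "step_op n a \<eta> w f x = (\<Sum>s\<in>steps n. eval_at x (w s) * step_coeff n a x s *
     (eval_at (\<lambda>p. x p + \<eta> * of_nat (step_vec n s p)) f - eval_at x f))"

section \<open>Equivariance under the permutation group\<close>

context
  fixes n :: nat and \<pi> :: "nat \<Rightarrow> nat"
  assumes pi: "\<pi> \<in> W n"
begin

lemma pi_inj: "inj \<pi>"
  using permutes_inj[OF W_permutes[OF pi]] .

lemma pi_even: "even (\<pi> p) = even p"
  using pi by (simp add: W_def even_iff_mod_2_eq_zero)

lemma pi_mem: "\<pi> p \<in> {1..n} \<longleftrightarrow> p \<in> {1..n}"
  by (rule permutes_in_image[OF W_permutes[OF pi]])

lemma pi_fix: "p \<notin> {1..n} \<Longrightarrow> \<pi> p = p"
  by (rule permutes_not_in[OF W_permutes[OF pi]])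

lemma pi_Suc: "\<pi> p = Suc n \<longleftrightarrow> p = Suc n"
  using pi_fix[of "Suc n"] injD[OF pi_inj, of p "Suc n"] by auto

lemma pi_le: "\<pi> p \<le> n \<longleftrightarrow> p \<le> n"
  using pi_mem[of p] pi_fix[of p] by (cases "p \<in> {1..n}") auto

lemma image_pi: "(\<And>p. \<pi> p \<in> X \<longleftrightarrow> p \<in> X) \<Longrightarrow> \<pi> ` X = X"
proof -
  assume X: "\<And>p. \<pi> p \<in> X \<longleftrightarrow> p \<in> X"
  have "p \<in> \<pi> ` X" if "p \<in> X" for p
  proof -
    obtain q where "p = \<pi> q" using permutes_surj[OF W_permutes[OF pi]] by (rule surjE)
    then show ?thesis using X that by auto
  qed
  then show ?thesis using X by auto
qed

lemma pi_odd_idx: "\<pi> ` odd_idx n = odd_idx n"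
proof (rule image_pi)
  show "\<pi> p \<in> odd_idx n \<longleftrightarrow> p \<in> odd_idx n" for p unfolding odd_idx_def mem_Collect_eq using pi_mem[of p] pi_even[of p] by blast
qed

lemma pi_even_idx: "\<pi> ` even_idx n = even_idx n"
proof (rule image_pi)
  have e: "even_idx n = {j. even j \<and> (j \<in> {1..n} \<or> j = Suc n)}" by (auto simp: even_idx_def)
  show "\<pi> p \<in> even_idx n \<longleftrightarrow> p \<in> even_idx n" for p
    unfolding e mem_Collect_eq using pi_mem[of p] pi_even[of p] pi_Suc[of p] by blast
qed

lemma node_diff_pi: "node_diff n a (\<lambda>i. x (\<pi> i)) p q = node_diff n a x (\<pi> p) (\<pi> q)"
  by (simp add: node_diff_def pi_Suc)

lemma prod_pi: "\<pi> ` X = X \<Longrightarrow> (\<Prod>q\<in>X - {j}. h (\<pi> q)) = (\<Prod>q\<in>X - {\<pi> j}. h q)"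
proof -
  assume "\<pi> ` X = X"
  then have "\<pi> ` (X - {j}) = X - {\<pi> j}"
    using inj_on_image_set_diff[OF pi_inj, of X "{j}"] by simp
  then show ?thesis
    using prod.reindex[OF inj_on_subset[OF pi_inj subset_UNIV], of h "X - {j}"] by simp
qed

lemma step_coeff_pi: "step_coeff n a (\<lambda>i. x (\<pi> i)) (i, j) = step_coeff n a x (\<pi> i, \<pi> j)"
  by (simp add: step_coeff_def step_num_def step_den_def node_diff_pi prod_pi[OF pi_odd_idx, of "node_diff n _ x _"] prod_pi[OF pi_even_idx, of "node_diff n _ x _"])

lemma step_vec_pi: "step_vec n (\<pi> i, \<pi> j) (\<pi> p) = step_vec n (i, j) p"
  using pi_inj by (auto simp: step_vec_def pi_le inj_eq)

lemma generic_pi: "generic n x \<Longrightarrow> generic n (\<lambda>i. x (\<pi> i))"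
  using pi_inj pi_mem pi_even by (force simp: generic_def parity_pairs_def inj_eq)

text \<open>Permuting the coordinates only renames the steps, because W permutes odd and even
  indices separately and fixes n + 1.\<close>

lemma step_op_pi:
  fixes f :: "'k::field_char_0 mvpoly"
  assumes f: "f \<in> invariants n"
    and w: "\<And>x i j. (i, j) \<in> steps n \<Longrightarrow> eval_at (\<lambda>i. x (\<pi> i)) (w (i, j)) = eval_at x (w (\<pi> i, \<pi> j))"
  shows "step_op n a \<eta> w f (\<lambda>i. x (\<pi> i)) = step_op n a \<eta> w f x"
proof -
  define F where "F s = eval_at x (w s) * step_coeff n a x s *
     (eval_at (\<lambda>p. x p + \<eta> * of_nat (step_vec n s p)) f - eval_at x f)" for s
  have inv: "eval_at (\<lambda>i. y (\<pi> i)) f = eval_at y f" for y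
    using f pi unfolding invariants_iff by blast
  have "eval_at (\<lambda>p. x (\<pi> p) + \<eta> * of_nat (step_vec n (i, j) p)) f
      = eval_at (\<lambda>p. x p + \<eta> * of_nat (step_vec n (\<pi> i, \<pi> j) p)) f" for i j
    using inv[of "\<lambda>p. x p + \<eta> * of_nat (step_vec n (\<pi> i, \<pi> j) p)"] by (simp add: step_vec_pi)
  then have "step_op n a \<eta> w f (\<lambda>i. x (\<pi> i)) = (\<Sum>(i, j)\<in>steps n. F (\<pi> i, \<pi> j))"
    unfolding step_op_def F_def by (intro sum.cong) (auto simp: w step_coeff_pi inv)
  also have "\<dots> = (\<Sum>s\<in>steps n. F (map_prod \<pi> \<pi> s))"
    by (simp add: case_prod_beta map_prod_def)
  also have "\<dots> = (\<Sum>s\<in>map_prod \<pi> \<pi> ` steps n. F s)"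
    by (subst sum.reindex) (auto intro!: inj_on_subset[OF prod.inj_map[OF pi_inj pi_inj]])
  also have "map_prod \<pi> \<pi> ` steps n = steps n"
  proof -
    have "map_prod \<pi> \<pi> ` steps n = (\<pi> ` odd_idx n) \<times> (\<pi> ` even_idx n)" by force
    then show ?thesis by (simp only: pi_odd_idx pi_even_idx)
  qed
  finally show ?thesis by (simp add: step_op_def F_def)
qed

end

section \<open>Clearing denominators, and polynomiality of the operators\<close>

definition node_diff_poly :: "nat \<Rightarrow> 'k \<Rightarrow> nat \<Rightarrow> nat \<Rightarrow> 'k::field_char_0 mvpoly" where
  "node_diff_poly n a p q = (if p = Suc n \<or> q = Suc n then 1 else Var p - Var q - Const a)"

lemma eval_node_diff_poly [simp]: "eval_at x (node_diff_poly n a p q) = node_diff n a x p q"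
  by (simp add: node_diff_poly_def node_diff_def)

definition codenom :: "nat \<Rightarrow> nat \<times> nat \<Rightarrow> 'k::field_char_0 mvpoly" where
  "codenom n s = (\<Prod>(p, q)\<in>{t \<in> parity_pairs n. fst t \<notin> {fst s, snd s}}. Var p - Var q)"

lemma eval_codenom:
  fixes x :: "nat \<Rightarrow> 'k::field_char_0"
  assumes "s \<in> steps n"
  shows "step_den n x s * eval_at x (codenom n s) = eval_at x (discr n)"
proof -
  let ?A = "{t \<in> parity_pairs n. fst t \<in> {fst s, snd s}}" and ?B = "{t \<in> parity_pairs n. fst t \<notin> {fst s, snd s}}"
  have "(\<Prod>(p, q)\<in>?A \<union> ?B. x p - x q) = (\<Prod>(p, q)\<in>?A. x p - x q) * (\<Prod>(p, q)\<in>?B. x p - x q)"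
    by (rule prod.union_disjoint) auto
  moreover have "?A \<union> ?B = parity_pairs n" by auto
  ultimately have "(\<Prod>(p, q)\<in>parity_pairs n. x p - x q) = (\<Prod>(p, q)\<in>?A. x p - x q) * (\<Prod>(p, q)\<in>?B. x p - x q)"
    by simp
  then show ?thesis by (simp add: step_den_eq[OF assms] eval_discr codenom_def case_prod_beta)
qed

definition cleared_op :: "nat \<Rightarrow> 'k \<Rightarrow> 'k \<Rightarrow> (nat \<times> nat \<Rightarrow> 'k mvpoly) \<Rightarrow> 'k mvpoly \<Rightarrow> 'k::field_char_0 mvpoly" where
  "cleared_op n a \<eta> w f = (\<Sum>s\<in>steps n. w s *
     ((\<Prod>q\<in>even_idx n - {snd s}. node_diff_poly n a (fst s) q) * (\<Prod>q\<in>odd_idx n - {fst s}. node_diff_poly n a (snd s) q)) * codenom n s *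
     (subst (\<lambda>p. Var p + Const (\<eta> * of_nat (step_vec n s p))) f - f))"

lemma eval_cleared_op:
  fixes x :: "nat \<Rightarrow> 'k::field_char_0"
  assumes "generic n x"
  shows "eval_at x (cleared_op n a \<eta> w f) = eval_at x (discr n) * step_op n a \<eta> w f x"
  unfolding cleared_op_def step_op_def sum_distrib_left eval_at_simps(6)
proof (rule sum.cong[OF refl])
  fix s assume s: "s \<in> steps n"
  have "step_num n a x s * eval_at x (codenom n s) = eval_at x (discr n) * step_coeff n a x s"
    using step_den_nonzero[OF s assms] by (simp add: step_coeff_def flip: eval_codenom[OF s])
  then have "eval_at x (w s) * (step_num n a x s * eval_at x (codenom n s)) * D
      = eval_at x (discr n) * (eval_at x (w s) * step_coeff n a x s * D)" for D
    by simp
  from this[of "eval_at (\<lambda>p. x p + \<eta> * of_nat (step_vec n s p)) f - eval_at x f"]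
  show "eval_at x (w s *
        ((\<Prod>q\<in>even_idx n - {snd s}. node_diff_poly n a (fst s) q) * (\<Prod>q\<in>odd_idx n - {fst s}. node_diff_poly n a (snd s) q)) * codenom n s *
        (subst (\<lambda>p. Var p + Const (\<eta> * of_nat (step_vec n s p))) f - f)) =
      eval_at x (discr n) *
         (eval_at x (w s) * step_coeff n a x s * (eval_at (\<lambda>p. x p + \<eta> * of_nat (step_vec n s p)) f - eval_at x f))"
    by (simp add: eval_at_subst step_num_def mult.assoc)
qed

lemma Var_diff_dvd_iff:
  fixes p :: "'k::field_char_0 mvpoly"
  assumes "a \<noteq> b"
  shows "Var a - Var b dvd p \<longleftrightarrow> (\<forall>x. x a = x b \<longrightarrow> eval_at x p = 0)"
proof -
  have "Var a - Var b dvd p \<longleftrightarrow> replace_var a (Var b) p = 0"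
    using assms by (intro linear_dvd_iff) auto
  also have "\<dots> \<longleftrightarrow> (\<forall>x. x a = x b \<longrightarrow> eval_at x p = 0)"
  proof (intro iffI allI impI)
    fix x :: "nat \<Rightarrow> 'k" assume r: "replace_var a (Var b) p = 0" and x: "x a = x b"
    have "x(a := x b) = x" using x by auto
    then show "eval_at x p = 0" using eval_at_replace_var[of x a "Var b" p] r by simp
  next
    assume e: "\<forall>x. x a = x b \<longrightarrow> eval_at x p = 0"
    show "replace_var a (Var b) p = 0"
      using assms e by (intro mvpoly_eqI) (simp add: eval_at_replace_var)
  qed
  finally show ?thesis .
qed

lemma swap_W: "(p, q) \<in> parity_pairs n \<Longrightarrow> Transposition.transpose p q \<in> W n"
proof -
  assume "(p, q) \<in> parity_pairs n"
  then have "p \<in> {1..n}" "q \<in> {1..n}" "p mod 2 = q mod 2"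
    by (auto simp: parity_pairs_def parity_cases mod2_eq_if)
  then show ?thesis
    by (auto simp: W_def Transposition.transpose_def intro!: permutes_swap_id)
qed

text \<open>The cleared operator is \<open>W\<close>-invariant and divisible by each \<open>z\<^sub>p - z\<^sub>q\<close>; the cofactor is then
  antisymmetric under \<open>p \<leftrightarrow> q\<close>, hence divisible by \<open>z\<^sub>p - z\<^sub>q\<close> once more.\<close>

lemma discr_dvd_cleared_op:
  fixes f :: "'k::field_char_0 mvpoly"
  assumes f: "f \<in> invariants n"
    and w: "\<And>\<pi> x i j. \<pi> \<in> W n \<Longrightarrow> (i, j) \<in> steps n \<Longrightarrow>
      eval_at (\<lambda>i. x (\<pi> i)) (w (i, j)) = eval_at x (w (\<pi> i, \<pi> j))"
  shows "discr n dvd cleared_op n a \<eta> w f"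
proof -
  let ?G = "cleared_op n a \<eta> w f"
  define P where "P = {(p, q) \<in> parity_pairs n. p < q}"
  have finP: "finite P" by (rule finite_subset[of _ "parity_pairs n"]) (auto simp: P_def)
  have Qinv: "eval_at (\<lambda>i. x (\<pi> i)) (discr n) = eval_at x (discr n)" if "\<pi> \<in> W n" for \<pi> and x :: "nat \<Rightarrow> 'k"
  proof -
    have "(\<Prod>(p, q)\<in>parity_pairs n. x (\<pi> p) - x (\<pi> q)) = (\<Prod>s\<in>parity_pairs n. (case map_prod \<pi> \<pi> s of (p, q) \<Rightarrow> x p - x q))"
      by (simp add: case_prod_beta)
    also have "\<dots> = (\<Prod>(p, q)\<in>map_prod \<pi> \<pi> ` parity_pairs n. x p - x q)"
      by (subst prod.reindex) (auto intro!: inj_on_subset[OF prod.inj_map[OF pi_inj[OF that] pi_inj[OF that]]])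
    also have "map_prod \<pi> \<pi> ` parity_pairs n = parity_pairs n"
    proof (rule card_subset_eq)
      show "map_prod \<pi> \<pi> ` parity_pairs n \<subseteq> parity_pairs n"
        using pi_mem[OF that] pi_even[OF that] pi_inj[OF that] by (force simp: parity_pairs_def inj_eq)
      show "card (map_prod \<pi> \<pi> ` parity_pairs n) = card (parity_pairs n)"
        by (rule card_image) (auto intro!: inj_on_subset[OF prod.inj_map[OF pi_inj[OF that] pi_inj[OF that]]])
    qed simp
    finally show ?thesis by (simp add: eval_discr)
  qed
  have Ginv: "eval_at (\<lambda>i. x (\<pi> i)) ?G = eval_at x ?G" if "\<pi> \<in> W n" for \<pi> x
  proof -
    have "subst (\<lambda>i. Var (\<pi> i)) ?G = ?G"
    proof (rule eqI_generic[of n])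
      fix x :: "nat \<Rightarrow> 'k" assume x: "generic n x"
      have "step_op n a \<eta> w f (\<lambda>i. x (\<pi> i)) = step_op n a \<eta> w f x"
        by (rule step_op_pi[OF that f w[OF that]])
      then show "eval_at x (subst (\<lambda>i. Var (\<pi> i)) ?G) = eval_at x ?G"
        by (simp add: eval_at_subst eval_cleared_op[OF x] eval_cleared_op[OF generic_pi[OF that x]] Qinv[OF that])
    qed
    from arg_cong[OF this, of "eval_at x"] show ?thesis by (simp add: eval_at_subst)
  qed
  have sq: "(Var p - Var q) ^ 2 dvd ?G" if pq: "(p, q) \<in> parity_pairs n" for p q
  proof -
    have ne: "p \<noteq> q" using pq by (auto simp: parity_pairs_def)
    have "Var p - Var q dvd codenom n s" if s: "s \<in> steps n" for s :: "nat \<times> nat"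
    proof -
      have qp: "(q, p) \<in> parity_pairs n" using pq by (auto simp: parity_pairs_def)
      have dv: "Var u - Var v dvd codenom n s" if "(u, v) \<in> parity_pairs n" "u \<notin> {fst s, snd s}" for u v
        using dvd_prodI[of "{t \<in> parity_pairs n. fst t \<notin> {fst s, snd s}}" "(u, v)" "\<lambda>(p, q). Var p - Var q"] that
        by (simp add: codenom_def)
      show ?thesis
      \<comment> \<open>A step moves one index of each parity, so at most one of p, q is moved; the
        factor led by the other one survives in \<open>codenom\<close>.\<close>
      proof (cases "p \<in> {fst s, snd s}")
        case True
        then have "q \<notin> {fst s, snd s}" using pq s by (auto simp: parity_pairs_def odd_idx_def even_idx_def)
        then have "- (Var q - Var p) dvd codenom n s" unfolding minus_dvd_iff by (rule dv[OF qp])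
        then show ?thesis by simp
      qed (use dv[OF pq] in simp)
    qed
    then have "Var p - Var q dvd ?G"
      unfolding cleared_op_def by (intro dvd_sum dvd_mult2 dvd_mult)
    then obtain K where K: "?G = (Var p - Var q) * K" by (rule dvdE)
    let ?t = "Transposition.transpose p q"
    have "subst (\<lambda>i. Var (?t i)) K = - K"
    proof (rule mvpoly_eqI_generic[OF Var_diff_nonzero[OF ne]])
      fix x :: "nat \<Rightarrow> 'k" assume x: "eval_at x (Var p - Var q) \<noteq> 0"
      have "(x q - x p) * eval_at (\<lambda>i. x (?t i)) K = (x p - x q) * eval_at x K"
        using Ginv[OF swap_W[OF pq], of x] by (simp add: K)
      then have "(x p - x q) * (eval_at (\<lambda>i. x (?t i)) K + eval_at x K) = 0"
        by (simp add: algebra_simps)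
      then show "eval_at x (subst (\<lambda>i. Var (?t i)) K) = eval_at x (- K)"
        using x by (simp add: eval_at_subst add_eq_0_iff2)
    qed
    then have anti: "eval_at (\<lambda>i. x (?t i)) K = - eval_at x K" for x
      using eval_at_subst[of x "\<lambda>i. Var (?t i)" K] by simp
    have "Var p - Var q dvd K"
      unfolding Var_diff_dvd_iff[OF ne]
    proof (intro allI impI)
      fix x :: "nat \<Rightarrow> 'k" assume "x p = x q"
      then have "(\<lambda>i. x (?t i)) = x" by (auto simp: Transposition.transpose_def)
      with anti[of x] show "eval_at x K = 0" by simp
    qed
    then show ?thesis unfolding K power2_eq_square by (rule mult_dvd_mono[OF dvd_refl])
  qed
  have "(\<Prod>t\<in>P. (Var (fst t) - Var (snd t)) ^ 2) dvd ?G"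
  proof (rule prod_prime_power_dvd[OF finP])
    fix t assume t: "t \<in> P"
    then have ne: "fst t \<noteq> snd t" by (auto simp: P_def)
    show "prime_elem (Var (fst t) - Var (snd t) :: 'k mvpoly)"
      by (rule prime_elem_linear[OF _ Var_diff_nonzero[OF ne]]) (use ne in auto)
    show "(Var (fst t) - Var (snd t)) ^ 2 dvd ?G" using t sq[of "fst t" "snd t"] by (simp add: P_def case_prod_beta)
    fix t' assume t': "t' \<in> P" "t \<noteq> t'"
    \<comment> \<open>A point on the hyperplane of t whose remaining coordinates are distinct and
      non-zero; it lies off the hyperplane of every other pair in \<open>P\<close>.\<close>
    define x :: "nat \<Rightarrow> 'k" where "x i = (if i = fst t \<or> i = snd t then 0 else of_nat (Suc i))" for i
    have "x (fst t') \<noteq> x (snd t')"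
      using t t' by (auto simp: x_def P_def simp del: of_nat_Suc)
    then show "\<not> Var (fst t) - Var (snd t) dvd (Var (fst t') - Var (snd t') :: 'k mvpoly)"
      unfolding Var_diff_dvd_iff[OF ne] by (auto intro!: exI[of _ x] simp: x_def)
  qed
  moreover have "discr n = (\<Prod>t\<in>P. - ((Var (fst t) - Var (snd t)) ^ 2 :: 'k mvpoly))"
  proof -
    have T: "parity_pairs n = P \<union> prod.swap ` P"
    proof
      show "parity_pairs n \<subseteq> P \<union> prod.swap ` P"
      proof
        fix t assume t: "t \<in> parity_pairs n"
        then have "t \<in> P \<or> prod.swap t \<in> P" by (auto simp: P_def parity_pairs_def)
        then show "t \<in> P \<union> prod.swap ` P" by (cases t) (force simp: image_iff)
      qed
    qed (auto simp: P_def parity_pairs_def)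
    have "P \<inter> prod.swap ` P = {}" by (auto simp: P_def)
    then have "discr n = (\<Prod>t\<in>P. Var (fst t) - Var (snd t) :: 'k mvpoly) * (\<Prod>t\<in>prod.swap ` P. Var (fst t) - Var (snd t))"
      unfolding discr_def by (subst T, subst prod.union_disjoint) (auto simp: finP case_prod_beta)
    also have "(\<Prod>t\<in>prod.swap ` P. Var (fst t) - Var (snd t) :: 'k mvpoly) = (\<Prod>t\<in>P. Var (snd t) - Var (fst t))"
      by (subst prod.reindex) (auto simp: inj_swap inj_on_subset[OF inj_swap subset_UNIV])
    finally show ?thesis
      unfolding prod.distrib[symmetric] by (simp add: power2_eq_square algebra_simps)
  qed
  then have "discr n = (- 1) ^ card P * (\<Prod>t\<in>P. (Var (fst t) - Var (snd t)) ^ 2 :: 'k mvpoly)"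
    by (simp add: prod_uminus)
  ultimately show ?thesis
    by (cases "even (card P)") simp_all
qed

lemma step_op_polynomial:
  fixes f :: "'k::field_char_0 mvpoly"
  assumes f: "f \<in> invariants n"
    and wp: "\<And>s. s \<in> steps n \<Longrightarrow> w s \<in> polys n"
    and w: "\<And>\<pi> x i j. \<pi> \<in> W n \<Longrightarrow> (i, j) \<in> steps n \<Longrightarrow>
      eval_at (\<lambda>i. x (\<pi> i)) (w (i, j)) = eval_at x (w (\<pi> i, \<pi> j))"
  obtains H where "H \<in> invariants n" "\<And>x. generic n x \<Longrightarrow> eval_at x H = step_op n a \<eta> w f x"
proof -
  obtain K where K: "cleared_op n a \<eta> w f = discr n * K" using discr_dvd_cleared_op[OF f w] by (rule dvdE)
  have eK: "eval_at x K = step_op n a \<eta> w f x" if "generic n x" for x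
    using eval_cleared_op[OF that, of a \<eta> w f] that by (simp add: K generic_iff)
  \<comment> \<open>The cofactor might involve variables outside 1..n. Setting them to 0 is
    harmless, since the operator does not see these coordinates.\<close>
  define c where "c i = (if i \<in> {1..n} then Var i else 0 :: 'k mvpoly)" for i
  define H where "H = subst c K"
  have Hp: "H \<in> polys n"
    unfolding H_def subst_def eval_via_def
    by (intro polys_sum polys_mult polys_Const polys_prod polys_power) (auto simp: c_def intro!: polys_Var)
  have eH: "eval_at x H = step_op n a \<eta> w f x" if x: "generic n x" for x
  proof -
    define y where "y i = (if i \<in> {1..n} then x i else 0)" for i
    have y: "generic n y" using x by (auto simp: generic_def parity_pairs_def y_def)
    have e: "node_diff n b y p q = node_diff n b x p q" if "p \<in> {1..Suc n}" "q \<in> {1..Suc n}" for b p q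
      using that by (auto simp: node_diff_def y_def)
    have g: "step_coeff n b y s = step_coeff n b x s" if "s \<in> steps n" for b s
      unfolding step_coeff_def step_num_def step_den_def
      by (intro arg_cong2[of _ _ _ _ "(/)"] arg_cong2[of _ _ _ _ "(*)"] prod.cong refl e)
         (use that in \<open>auto simp: odd_idx_def even_idx_def\<close>)
    have cx: "(\<lambda>i. eval_at x (c i)) = y" by (auto simp: c_def y_def)
    have "eval_at x H = eval_at y K" unfolding H_def eval_at_subst cx ..
    also have "\<dots> = step_op n a \<eta> w f y" by (rule eK[OF y])
    also have "\<dots> = step_op n a \<eta> w f x"
      unfolding step_op_def
      by (intro sum.cong refl arg_cong2[of _ _ _ _ "(*)"] arg_cong2[of _ _ _ _ "(-)"] g
            eval_at_cong[of _ n] wp invariants_polys[OF f]) (auto simp: y_def)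
    finally show ?thesis .
  qed
  have "H \<in> invariants n"
    unfolding invariants_def
  proof (intro CollectI conjI ballI Hp)
    fix \<pi> assume pi: "\<pi> \<in> W n"
    show "subst (\<lambda>i. Var (\<pi> i)) H = H"
    proof (rule eqI_generic[of n])
      fix x :: "nat \<Rightarrow> 'k" assume x: "generic n x"
      have "step_op n a \<eta> w f (\<lambda>i. x (\<pi> i)) = step_op n a \<eta> w f x"
        by (rule step_op_pi[OF pi f w[OF pi]])
      then show "eval_at x (subst (\<lambda>i. Var (\<pi> i)) H) = eval_at x H"
        by (simp add: eval_at_subst eH x generic_pi[OF pi x])
    qed
  qed
  then show ?thesis using that eH by blast
qed

section \<open>Leading coefficients and Lagrange interpolation\<close>

lemma coeff_mult_top:
  fixes p q :: "'a::comm_semiring_1 poly"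
  assumes "degree p \<le> m" "degree q \<le> k"
  shows "coeff (p * q) (m + k) = coeff p m * coeff q k"
proof -
  have "coeff (p * q) (m + k) = (\<Sum>i\<le>m + k. if i = m then coeff p m * coeff q k else 0)"
    unfolding coeff_mult
  proof (rule sum.cong[OF refl])
    fix i assume "i \<in> {..m + k}"
    then show "coeff p i * coeff q (m + k - i) = (if i = m then coeff p m * coeff q k else 0)"
      using assms by (cases i m rule: linorder_cases) (auto simp: coeff_eq_0)
  qed
  then show ?thesis by simp
qed

lemma prod_linear_top:
  fixes P :: "'i \<Rightarrow> 'a::comm_semiring_1 poly"
  assumes "finite A" "\<And>a. a \<in> A \<Longrightarrow> degree (P a) \<le> 1"
  shows "degree (prod P A) \<le> card A \<and> coeff (prod P A) (card A) = (\<Prod>a\<in>A. coeff (P a) 1)"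
  using assms
proof (induction A)
  case (insert x A)
  then have IH: "degree (prod P A) \<le> card A" "coeff (prod P A) (card A) = (\<Prod>a\<in>A. coeff (P a) 1)"
    and x: "degree (P x) \<le> 1" by auto
  have "degree (P x * prod P A) \<le> 1 + card A"
    by (rule order.trans[OF degree_mult_le]) (use IH x in auto)
  moreover have "coeff (P x * prod P A) (1 + card A) = coeff (P x) 1 * coeff (prod P A) (card A)"
    by (rule coeff_mult_top[OF x IH(1)])
  ultimately show ?case using insert.hyps IH(2) by simp
qed simp

lemma lagrange_interpolation:
  fixes y :: "'i \<Rightarrow> 'a::field"
  assumes A: "finite A" "inj_on y A" and q: "degree q < card A"
  shows "poly q t = (\<Sum>j\<in>A. poly q (y j) * (\<Prod>l\<in>A - {j}. (t - y l) / (y j - y l)))"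
proof -
  define L where "L = (\<Sum>j\<in>A. smult (poly q (y j) / (\<Prod>l\<in>A - {j}. y j - y l)) (\<Prod>l\<in>A - {j}. [:- y l, 1:]))"
  have L: "poly L t = (\<Sum>j\<in>A. poly q (y j) * (\<Prod>l\<in>A - {j}. (t - y l) / (y j - y l)))" for t
    unfolding L_def by (simp add: poly_sum poly_prod prod_dividef)
  have "degree L \<le> card A - 1"
    unfolding L_def
  proof (rule degree_sum_le[OF A(1)])
    fix j assume "j \<in> A"
    then show "degree (smult (poly q (y j) / (\<Prod>l\<in>A - {j}. y j - y l)) (\<Prod>l\<in>A - {j}. [:- y l, 1:])) \<le> card A - 1"
      using prod_linear_top[of "A - {j}" "\<lambda>l. [:- y l, 1:]"] A
      by (intro order.trans[OF degree_smult_le]) auto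
  qed
  moreover have "poly q u = poly L u" if "u \<in> y ` A" for u
  proof -
    from that obtain j0 where j0: "j0 \<in> A" "u = y j0" by auto
    have "poly L u = (\<Sum>j\<in>A. if j = j0 then poly q u else 0)"
      unfolding L
    proof (rule sum.cong[OF refl])
      fix j assume j: "j \<in> A"
      show "poly q (y j) * (\<Prod>l\<in>A - {j}. (u - y l) / (y j - y l)) = (if j = j0 then poly q u else 0)"
      proof (cases "j = j0")
        case True
        have "(\<Prod>l\<in>A - {j}. (u - y l) / (y j - y l)) = 1"
          using True j0 A(2) by (intro prod.neutral) (auto simp: inj_on_def)
        then show ?thesis using True j0 by simp
      next
        case False
        then have "(\<Prod>l\<in>A - {j}. (u - y l) / (y j - y l)) = 0"
          using j0 A(1) by (intro prod_zero) auto
        then show ?thesis using False by simp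
      qed
    qed
    then show ?thesis using j0 A(1) by simp
  qed
  moreover have "card (y ` A) = card A" by (rule card_image[OF A(2)])
  ultimately have "q = L" using q by (intro poly_eqI_degree[of "y ` A"]) auto
  then show ?thesis using L by metis
qed

lemma generic_inj_on:
  assumes "generic n x" "A \<subseteq> odd_idx n \<or> A \<subseteq> even_idx n - {Suc n}"
  shows "inj_on x A"
proof (rule inj_onI, rule ccontr)
  fix p q assume "p \<in> A" "q \<in> A" "x p = x q" "p \<noteq> q"
  moreover from this assms(2) have "(p, q) \<in> parity_pairs n" by (auto simp: parity_pairs_def odd_idx_def even_idx_def)
  ultimately show False using assms(1) by (auto simp: generic_def)
qed

text \<open>Lagrange interpolation at the even coordinates of q(t), the product of t - x_l over odd
  l other than i, evaluated at t = x_i and divided by q(x_i). For even n the degree of q is below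
  the number of nodes. For odd n it equals that number, and the index n + 1 supplies the missing
  term.\<close>

lemma sum_step_coeff_even_idx:
  fixes x :: "nat \<Rightarrow> 'k::field_char_0"
  assumes x: "generic n x" and i: "i \<in> odd_idx n"
  shows "(\<Sum>j\<in>even_idx n. step_coeff n 0 x (i, j)) = 1"
proof -
  define A where "A = even_idx n - {Suc n}"
  define C where "C = (\<Prod>q\<in>odd_idx n - {i}. x i - x q)"
  define q where "q = (\<Prod>q\<in>odd_idx n - {i}. [:- x q, 1:])"
  have iS: "i \<noteq> Suc n" and O: "p \<noteq> Suc n" if "p \<in> odd_idx n" for p using i that by (auto simp: odd_idx_def)
  have inj: "inj_on x A" "inj_on x (odd_idx n)" using generic_inj_on[OF x] by (auto simp: A_def)
  have C0: "C \<noteq> 0" using inj(2) i by (auto simp: C_def inj_on_def)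
  have qp: "poly q t = (\<Prod>q\<in>odd_idx n - {i}. t - x q)" for t by (simp add: q_def poly_prod)
  have qd: "degree q \<le> card (odd_idx n - {i})" "coeff q (card (odd_idx n - {i})) = 1"
    using prod_linear_top[of "odd_idx n - {i}" "\<lambda>l. [:- x l, 1:]"] by (auto simp: q_def)
  have main: "step_coeff n 0 x (i, j) = poly q (x j) * (\<Prod>l\<in>A - {j}. (x i - x l) / (x j - x l)) / C" if "j \<in> A" for j
  proof -
    have jS: "j \<noteq> Suc n" using that by (auto simp: A_def)
    have r: "(\<Prod>q\<in>even_idx n - {j}. node_diff n 0 x p q) = (\<Prod>q\<in>A - {j}. x p - x q)" if "p \<noteq> Suc n" for p
      unfolding A_def
      by (rule trans[OF prod.mono_neutral_right[of _ "A - {j}"]]) (use that in \<open>auto simp: node_diff_def A_def\<close>)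
    have r2: "(\<Prod>q\<in>odd_idx n - {i}. node_diff n 0 x p q) = (\<Prod>q\<in>odd_idx n - {i}. x p - x q)" if "p \<noteq> Suc n" for p
      by (rule prod.cong) (use that O in \<open>auto simp: node_diff_def\<close>)
    show ?thesis
      by (simp add: step_coeff_def step_num_def step_den_def r[OF jS] r[OF iS[OF i]] r2[OF jS] r2[OF iS[OF i]] qp C_def prod_dividef mult.commute)
  qed
  show ?thesis
  proof (cases "Suc n \<in> even_idx n")
    case False
    then have A: "A = even_idx n" by (auto simp: A_def)
    have "card (odd_idx n - {i}) < card (odd_idx n)" using i by (intro psubset_card_mono) auto
    then have "degree q < card A" using qd(1) by (simp add: A card_even_idx)
    from lagrange_interpolation[OF _ inj(1) this, of "x i"]
    have "poly q (x i) = (\<Sum>j\<in>A. poly q (x j) * (\<Prod>l\<in>A - {j}. (x i - x l) / (x j - x l)))" by (simp add: A)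
    moreover have "poly q (x i) = C" by (simp add: qp C_def)
    ultimately have "(\<Sum>j\<in>A. step_coeff n 0 x (i, j)) = C / C"
      by (simp add: main flip: sum_divide_distrib)
    then show ?thesis using C0 by (simp add: A)
  next
    case True
    \<comment> \<open>The node polynomial: it is monic of the same degree as \<open>q\<close>, so
      \<open>q - q'\<close> can be interpolated and has the values of \<open>q\<close> at the nodes,
      while the summand of n + 1 is exactly \<open>poly q' (x i) / C\<close>.\<close>
    define q' where "q' = (\<Prod>q\<in>A. [:- x q, 1:])"
    have fA: "finite A" by (simp add: A_def)
    have cA: "card A = card (odd_idx n - {i})"
      using True i by (simp add: A_def card_even_idx)
    have q'd: "degree q' \<le> card A" "coeff q' (card A) = 1"
      using prod_linear_top[of A "\<lambda>l. [:- x l, 1:]"] fA by (auto simp: q'_def)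
    have q'z: "poly q' (x j) = 0" if "j \<in> A" for j
      using that fA by (auto simp: q'_def poly_prod)
    have q'i: "poly q' (x i) = (\<Prod>q\<in>A. x i - x q)" by (simp add: q'_def poly_prod)
    have S: "poly (q - q') (x i) = (\<Sum>j\<in>A. poly q (x j) * (\<Prod>l\<in>A - {j}. (x i - x l) / (x j - x l)))"
    \<comment> \<open>Without nodes both polynomials are 1, and no strict degree bound is
      available.\<close>
    proof (cases "A = {}")
      case True
      then have c: "card (odd_idx n - {i}) = 0" using cA by simp
      have e: "odd_idx n - {i} = {}"
        by (rule card_0_eq[THEN iffD1, OF _ c]) simp
      show ?thesis unfolding q_def q'_def True e by simp
    next
      case False
      have "coeff (q - q') (card A) = 0" using qd(2) q'd(2) cA by simp
      moreover have "degree (q - q') \<le> card A" using qd(1) q'd(1) cA by (intro degree_diff_le) auto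
      ultimately have "degree (q - q') < card A"
        using False fA by (metis card_gt_0_iff coeff_0 degree_0 eq_zero_or_degree_less leading_coeff_0_iff nat_less_le)
      from lagrange_interpolation[OF fA inj(1) this, of "x i"] show ?thesis by (simp add: q'z)
    qed
    have last: "step_coeff n 0 x (i, Suc n) = poly q' (x i) / C"
    proof -
      have "(\<Prod>q\<in>even_idx n - {Suc n}. node_diff n 0 x i q) = (\<Prod>q\<in>A. x i - x q)"
        by (rule prod.cong) (use iS[OF i] in \<open>auto simp: node_diff_def A_def\<close>)
      moreover have "(\<Prod>q\<in>odd_idx n - {i}. node_diff n 0 x i q) = C"
        unfolding C_def by (rule prod.cong) (use iS[OF i] O in \<open>auto simp: node_diff_def\<close>)
      ultimately show ?thesis by (simp add: step_coeff_def step_num_def step_den_def q'i node_diff_def)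
    qed
    have "(\<Sum>j\<in>even_idx n. step_coeff n 0 x (i, j)) = step_coeff n 0 x (i, Suc n) + (\<Sum>j\<in>A. step_coeff n 0 x (i, j))"
      unfolding A_def by (rule sum.remove) (use True in auto)
    also have "(\<Sum>j\<in>A. step_coeff n 0 x (i, j)) = poly (q - q') (x i) / C"
      unfolding S by (simp add: main flip: sum_divide_distrib)
    also have "step_coeff n 0 x (i, Suc n) + \<dots> = (poly q' (x i) + poly (q - q') (x i)) / C"
      by (simp only: last add_divide_distrib)
    also have "\<dots> = C / C" by (simp add: qp C_def)
    finally show ?thesis using C0 by simp
  qed
qed

text \<open>Same interpolation with the parities exchanged. The odd coordinates are the nodes, and
  the polynomial omits j and n + 1, so its degree is always small enough.\<close>

lemma sum_step_coeff_odd_idx: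
  fixes x :: "nat \<Rightarrow> 'k::field_char_0"
  assumes x: "generic n x" and j: "j \<in> even_idx n" "j \<le> n"
  shows "(\<Sum>i\<in>odd_idx n. step_coeff n 0 x (i, j)) = 1"
proof -
  define A where "A = even_idx n - {Suc n} - {j}"
  define C where "C = (\<Prod>q\<in>A. x j - x q)"
  define q where "q = (\<Prod>q\<in>A. [:- x q, 1:])"
  have O: "p \<noteq> Suc n" if "p \<in> odd_idx n" for p using that by (auto simp: odd_idx_def)
  have inj: "inj_on x (even_idx n - {Suc n})" "inj_on x (odd_idx n)" using generic_inj_on[OF x] by auto
  have C0: "C \<noteq> 0" using inj(1) j by (auto simp: C_def A_def inj_on_def)
  have qp: "poly q t = (\<Prod>q\<in>A. t - x q)" for t by (simp add: q_def poly_prod)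
  have r: "(\<Prod>q\<in>even_idx n - {j}. node_diff n 0 x p q) = (\<Prod>q\<in>A. x p - x q)" if "p \<noteq> Suc n" for p
    by (rule trans[OF prod.mono_neutral_right[of _ A]]) (use that in \<open>auto simp: node_diff_def A_def\<close>)
  have main: "step_coeff n 0 x (i, j) = poly q (x i) * (\<Prod>l\<in>odd_idx n - {i}. (x j - x l) / (x i - x l)) / C" if "i \<in> odd_idx n" for i
  proof -
    have r2: "(\<Prod>q\<in>odd_idx n - {i}. node_diff n 0 x p q) = (\<Prod>q\<in>odd_idx n - {i}. x p - x q)" if "p \<noteq> Suc n" for p
      by (rule prod.cong) (use that O in \<open>auto simp: node_diff_def\<close>)
    have jS: "j \<noteq> Suc n" using j by auto
    show ?thesis
      by (simp add: step_coeff_def step_num_def step_den_def r[OF jS] r[OF O[OF that]] r2[OF jS] r2[OF O[OF that]] qp C_def prod_dividef)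
  qed
  have "card A \<le> card (even_idx n - {j})" unfolding A_def by (rule card_mono) auto
  also have "\<dots> < card (even_idx n)" using j(1) by (intro psubset_card_mono) auto
  finally have "degree q < card (odd_idx n)"
    using prod_linear_top[of A "\<lambda>l. [:- x l, 1:]"] by (simp add: q_def A_def card_even_idx)
  from lagrange_interpolation[OF _ inj(2) this, of "x j"]
  have "poly q (x j) = (\<Sum>i\<in>odd_idx n. poly q (x i) * (\<Prod>l\<in>odd_idx n - {i}. (x j - x l) / (x i - x l)))" by simp
  moreover have "poly q (x j) = C" by (simp add: qp C_def)
  ultimately have "(\<Sum>i\<in>odd_idx n. step_coeff n 0 x (i, j)) = C / C"
    by (simp add: main flip: sum_divide_distrib)
  then show ?thesis using C0 by simp
qed

section \<open>Leading behaviour of the difference operators\<close>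

lemma generic_scale:
  fixes y :: "nat \<Rightarrow> 'k::field"
  shows "t \<noteq> 0 \<Longrightarrow> generic n (\<lambda>i. t * y i) \<longleftrightarrow> generic n y"
  by (simp add: generic_def)

text \<open>On the ray t y the coefficient is rational in t. The power of t clears the denominator
  up to a constant and leaves the polynomial \<open>np\<close> in t.\<close>

lemma step_coeff_scale:
  fixes y :: "nat \<Rightarrow> 'k::field_char_0" and a :: 'k
  assumes s: "s \<in> steps n" and y: "generic n y" and t: "t \<noteq> 0"
  defines "lp \<equiv> \<lambda>p q. if p = Suc n \<or> q = Suc n then [:0, 1:] else [:- a, y p - y q:]"
  defines "np \<equiv> (\<Prod>q\<in>even_idx n - {snd s}. lp (fst s) q) * (\<Prod>q\<in>odd_idx n - {fst s}. lp (snd s) q)"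
  shows "t ^ (card (even_idx n - {snd s}) + card (odd_idx n - {fst s})) * step_coeff n a (\<lambda>i. t * y i) s = poly np t / step_den n y s"
proof -
  obtain i j where ij: "s = (i, j)" "i \<in> odd_idx n" "j \<in> even_idx n" using s by auto
  \<comment> \<open>Factors at the index n + 1 are 1; \<open>u\<close> supplies the missing t so
    that all factors look alike. Numerator and denominator need equally many of them because there
    are as many even as odd indices.\<close>
  define u where "u p q = (if p = Suc n \<or> q = Suc n then t else 1)" for p q
  have O: "p \<noteq> Suc n" if "p \<in> odd_idx n" for p using that by (auto simp: odd_idx_def)
  have num: "poly (lp p q) t = node_diff n a (\<lambda>i. t * y i) p q * u p q" for p q
    by (simp add: lp_def node_diff_def u_def algebra_simps)
  have den: "node_diff n 0 (\<lambda>i. t * y i) p q * u p q = t * node_diff n 0 y p q" for p q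
    by (simp add: node_diff_def u_def algebra_simps)
  have u: "(\<Prod>q\<in>even_idx n - {j}. u i q) * (\<Prod>q\<in>odd_idx n - {i}. u j q) = (\<Prod>q\<in>odd_idx n - {i}. u i q) * (\<Prod>q\<in>even_idx n - {j}. u j q)"
  proof (cases "j = Suc n")
    case True
    have "(\<Prod>q\<in>even_idx n - {j}. u i q) = 1" "(\<Prod>q\<in>odd_idx n - {i}. u i q) = 1"
      using True O ij by (auto intro!: prod.neutral simp: u_def)
    moreover have "(\<Prod>q\<in>odd_idx n - {i}. u j q) = t ^ card (odd_idx n - {i})" "(\<Prod>q\<in>even_idx n - {j}. u j q) = t ^ card (even_idx n - {j})"
      using True by (simp_all add: u_def)
    ultimately show ?thesis using ij by (simp add: card_even_idx)
  next
    case False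
    have "(\<Prod>q\<in>even_idx n - {j}. u i q) = (\<Prod>q\<in>even_idx n - {j}. u j q)" "(\<Prod>q\<in>odd_idx n - {i}. u j q) = (\<Prod>q\<in>odd_idx n - {i}. u i q)"
      using False O ij by (auto intro!: prod.cong simp: u_def)
    then show ?thesis by (simp add: mult.commute)
  qed
  have u0: "(\<Prod>q\<in>odd_idx n - {i}. u i q) * (\<Prod>q\<in>even_idx n - {j}. u j q) \<noteq> 0"
    using t by (auto simp: u_def)
  let ?U = "(\<Prod>q\<in>odd_idx n - {i}. u i q) * (\<Prod>q\<in>even_idx n - {j}. u j q)"
  have "poly np t = step_num n a (\<lambda>i. t * y i) s * ((\<Prod>q\<in>even_idx n - {j}. u i q) * (\<Prod>q\<in>odd_idx n - {i}. u j q))"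
    by (simp add: np_def ij poly_prod num step_num_def prod.distrib ac_simps)
  then have 1: "poly np t = step_num n a (\<lambda>i. t * y i) s * ?U" unfolding u .
  have 2: "step_den n (\<lambda>i. t * y i) s * ?U = t ^ (card (even_idx n - {snd s}) + card (odd_idx n - {fst s})) * step_den n y s"
  proof -
    have "step_den n (\<lambda>i. t * y i) s * ?U =
       (\<Prod>q\<in>odd_idx n - {i}. node_diff n 0 (\<lambda>i. t * y i) i q * u i q) * (\<Prod>q\<in>even_idx n - {j}. node_diff n 0 (\<lambda>i. t * y i) j q * u j q)"
      by (simp add: step_den_def ij prod.distrib ac_simps)
    also have "\<dots> = t ^ (card (even_idx n - {snd s}) + card (odd_idx n - {fst s})) * step_den n y s"
      unfolding den by (simp add: prod.distrib step_den_def ij power_add ac_simps)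
    finally show ?thesis .
  qed
  have g0: "step_den n y s \<noteq> 0" "step_den n (\<lambda>i. t * y i) s \<noteq> 0"
    using step_den_nonzero[OF s] y generic_scale[OF t] by auto
  show ?thesis
    unfolding step_coeff_def 1 using g0 u0 2 by (simp add: field_simps)
qed

text \<open>Along a ray the shift a is of lower order, so the coefficients contribute their values
  at a = 0, and the differences contribute derivatives of the leading part by
  \<open>line_shift_top\<close>. A weight of degree e adds e to the degree.\<close>

lemma step_op_top:
  fixes f :: "'k::field_char_0 mvpoly"
  assumes H: "\<And>x. generic n x \<Longrightarrow> eval_at x H = step_op n a \<eta> w f x"
    and f: "deg_le (Suc d) f"
    and w: "\<And>s t y. s \<in> steps n \<Longrightarrow> eval_at (\<lambda>i. t * y i) (w s) = t ^ e * eval_at y (w s)"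
  shows "deg_le (d + e) H"
    and "generic n y \<Longrightarrow> eval_at y (hom_component (d + e) H) =
      (\<Sum>s\<in>steps n. eval_at y (w s) * step_coeff n 0 y s *
         (\<eta> * coeff (line (hom_component (Suc d) f) y (\<lambda>p. of_nat (step_vec n s p))) 1))"
proof -
  have main: "degree (line H (\<lambda>_. 0) y) \<le> d + e \<and> coeff (line H (\<lambda>_. 0) y) (d + e) =
      (\<Sum>s\<in>steps n. eval_at y (w s) * step_coeff n 0 y s *
         (\<eta> * coeff (line (hom_component (Suc d) f) y (\<lambda>p. of_nat (step_vec n s p))) 1))"
    if y: "generic n y" for y
  proof -
    define lp where "lp p q = (if p = Suc n \<or> q = Suc n then [:0, 1:] else [:- a, y p - y q:])" for p q
    define np where "np s = (\<Prod>q\<in>even_idx n - {snd s}. lp (fst s) q) * (\<Prod>q\<in>odd_idx n - {fst s}. lp (snd s) q)" for s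
    define Df where "Df s = line f (\<lambda>p. \<eta> * of_nat (step_vec n s p)) y - line f (\<lambda>_. 0) y" for s
    define M where "M = (card (odd_idx n) - 1) + (card (odd_idx n) - 1)"
    have M: "card (even_idx n - {snd s}) + card (odd_idx n - {fst s}) = M" if "s \<in> steps n" for s
      using that by (auto simp: M_def card_even_idx)
    define Z where "Z s = smult (eval_at y (w s) / step_den n y s) (monom 1 e * (np s * Df s))" for s
    \<comment> \<open>Multiplying by t^M makes this an identity of polynomials in t; one
      \<open>M\<close> serves all steps since both index sets have the same size.\<close>
    have eq: "monom 1 M * line H (\<lambda>_. 0) y = (\<Sum>s\<in>steps n. Z s)"
    proof (rule poly_eqI_nonzero)
      fix t :: 'k assume t: "t \<noteq> 0"
      have "poly (line H (\<lambda>_. 0) y) t = step_op n a \<eta> w f (\<lambda>i. t * y i)"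
        using H[of "\<lambda>i. t * y i"] generic_scale[OF t] y by (simp add: poly_line)
      also have "t ^ M * \<dots> = (\<Sum>s\<in>steps n. poly (Z s) t)"
        unfolding step_op_def sum_distrib_left
      proof (rule sum.cong[OF refl])
        fix s assume s: "s \<in> steps n"
        have g: "t ^ M * step_coeff n a (\<lambda>i. t * y i) s = poly (np s) t / step_den n y s"
          using step_coeff_scale[OF s y t, of a] by (simp add: M[OF s] np_def lp_def)
        have D: "poly (Df s) t = eval_at (\<lambda>p. t * y p + \<eta> * of_nat (step_vec n s p)) f - eval_at (\<lambda>i. t * y i) f"
          by (simp add: Df_def poly_line add.commute)
        have "t ^ M * (eval_at (\<lambda>i. t * y i) (w s) * step_coeff n a (\<lambda>i. t * y i) s * poly (Df s) t)
            = (t ^ M * step_coeff n a (\<lambda>i. t * y i) s) * (t ^ e * eval_at y (w s)) * poly (Df s) t"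
          by (simp only: w[OF s] ac_simps)
        also have "\<dots> = poly (Z s) t"
          unfolding g by (simp add: Z_def poly_monom)
        finally show "t ^ M * (eval_at (\<lambda>i. t * y i) (w s) * step_coeff n a (\<lambda>i. t * y i) s *
           (eval_at (\<lambda>p. t * y p + \<eta> * of_nat (step_vec n s p)) f - eval_at (\<lambda>i. t * y i) f)) = poly (Z s) t"
          unfolding D .
      qed
      finally show "poly (monom 1 M * line H (\<lambda>_. 0) y) t = poly (\<Sum>s\<in>steps n. Z s) t"
        by (simp add: poly_monom poly_sum)
    qed
    have np: "degree (np s) \<le> M \<and> coeff (np s) M = step_num n 0 y s" if s: "s \<in> steps n" for s
    proof -
      have 1: "degree (\<Prod>q\<in>even_idx n - {snd s}. lp (fst s) q) \<le> card (even_idx n - {snd s})"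
        "coeff (\<Prod>q\<in>even_idx n - {snd s}. lp (fst s) q) (card (even_idx n - {snd s})) = (\<Prod>q\<in>even_idx n - {snd s}. coeff (lp (fst s) q) 1)"
        using prod_linear_top[of "even_idx n - {snd s}" "lp (fst s)"] by (auto simp: lp_def)
      have 2: "degree (\<Prod>q\<in>odd_idx n - {fst s}. lp (snd s) q) \<le> card (odd_idx n - {fst s})"
        "coeff (\<Prod>q\<in>odd_idx n - {fst s}. lp (snd s) q) (card (odd_idx n - {fst s})) = (\<Prod>q\<in>odd_idx n - {fst s}. coeff (lp (snd s) q) 1)"
        using prod_linear_top[of "odd_idx n - {fst s}" "lp (snd s)"] by (auto simp: lp_def)
      have l: "coeff (lp p q) 1 = node_diff n 0 y p q" for p q by (simp add: lp_def node_diff_def)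
      show ?thesis
        unfolding M[OF s, symmetric] np_def
        using coeff_mult_top[OF 1(1) 2(1)] order.trans[OF degree_mult_le add_mono[OF 1(1) 2(1)]]
        by (simp only: 1(2) 2(2) l step_num_def simp_thms)
    qed
    have Z: "degree (Z s) \<le> M + (d + e) \<and> coeff (Z s) (M + (d + e)) = eval_at y (w s) * step_coeff n 0 y s *
         (\<eta> * coeff (line (hom_component (Suc d) f) y (\<lambda>p. of_nat (step_vec n s p))) 1)" if s: "s \<in> steps n" for s
    proof -
      have D: "degree (Df s) \<le> d" "coeff (Df s) d = coeff (line (hom_component (Suc d) f) y (\<lambda>p. \<eta> * of_nat (step_vec n s p))) 1"
        unfolding Df_def by (rule line_shift_top[OF f])+
      have e: "coeff (line (hom_component (Suc d) f) y (\<lambda>p. \<eta> * of_nat (step_vec n s p))) 1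
          = \<eta> * coeff (line (hom_component (Suc d) f) y (\<lambda>p. of_nat (step_vec n s p))) 1"
        using coeff_line_linear[where S = "{()}" and c = "\<lambda>_. \<eta>" and v = "\<lambda>_ p. of_nat (step_vec n s p)" and y = y]
        by simp
      have "degree (np s * Df s) \<le> M + d"
        by (rule order.trans[OF degree_mult_le add_mono[OF conjunct1[OF np[OF s]] D(1)]])
      then have d1: "degree (monom 1 e * (np s * Df s)) \<le> e + (M + d)"
        by (rule order.trans[OF degree_mult_le add_mono[OF degree_monom_le]])
      have c1: "coeff (monom 1 e * (np s * Df s)) (e + (M + d)) = step_num n 0 y s * coeff (Df s) d"
      proof -
        have "coeff (np s * Df s) (M + d) = coeff (np s) M * coeff (Df s) d"
          by (rule coeff_mult_top) (use np[OF s] D(1) in auto)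
        then show ?thesis using np[OF s] by (simp add: coeff_monom_mult)
      qed
      have eM: "M + (d + e) = e + (M + d)" by simp
      show ?thesis
        unfolding eM Z_def coeff_smult c1 D(2) e step_coeff_def
        using d1 by simp
    qed
    have c: "coeff (line H (\<lambda>_. 0) y) k = (\<Sum>s\<in>steps n. coeff (Z s) (M + k))" for k
      using arg_cong[OF eq, of "\<lambda>p. coeff p (M + k)"] by (simp add: coeff_monom_mult coeff_sum)
    have "degree (line H (\<lambda>_. 0) y) \<le> d + e"
    proof (rule degree_le, intro allI impI)
      fix k assume k: "d + e < k"
      have "coeff (Z s) (M + k) = 0" if "s \<in> steps n" for s
        using conjunct1[OF Z[OF that]] k by (intro coeff_eq_0) linarith
      then show "coeff (line H (\<lambda>_. 0) y) k = 0" unfolding c by (intro sum.neutral) blast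
    qed
    moreover have "coeff (line H (\<lambda>_. 0) y) (d + e) =
      (\<Sum>s\<in>steps n. eval_at y (w s) * step_coeff n 0 y s *
         (\<eta> * coeff (line (hom_component (Suc d) f) y (\<lambda>p. of_nat (step_vec n s p))) 1))"
      unfolding c by (rule sum.cong[OF refl], rule conjunct2[OF Z])
    ultimately show ?thesis by blast
  qed
  show "deg_le (d + e) H"
    by (rule deg_le_generic[OF discr_nonzero[of n]]) (use main in \<open>auto simp: generic_iff\<close>)
  show "generic n y \<Longrightarrow> eval_at y (hom_component (d + e) H) =
      (\<Sum>s\<in>steps n. eval_at y (w s) * step_coeff n 0 y s *
         (\<eta> * coeff (line (hom_component (Suc d) f) y (\<lambda>p. of_nat (step_vec n s p))) 1))"
    using main[of y] by (simp add: coeff_line_0)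
qed

section \<open>Interpolation polynomials\<close>

text \<open>The W-orbit of n for n \<ge> 1. As \<rho>_n = 0, the product of its variables vanishes
  at \<rho> + \<mu> whenever \<mu>_n = 0. This splits interpolation into the case \<mu>_n = 0, which
  has one variable less, and the case \<mu>_n > 0, which is a translate.\<close>

definition last_class :: "nat \<Rightarrow> nat set" where "last_class n = {j \<in> {1..n}. even j = even n}"

definition class_prod :: "nat \<Rightarrow> 'k::field_char_0 mvpoly" where "class_prod n = (\<Prod>j\<in>last_class n. Var j)"

definition add_ones :: "nat \<Rightarrow> (nat \<Rightarrow> nat) \<Rightarrow> nat \<Rightarrow> nat" where
  "add_ones n \<kappa> i = \<kappa> i + (if i \<in> {1..n} then 1 else 0)"

lemma finite_last_class [simp]: "finite (last_class n)" by (simp add: last_class_def)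

lemma card_last_class: "card (last_class n) = card (odd_idx n)"
proof (cases "even n")
  case True
  then have "last_class n = even_idx n" by (auto simp: last_class_def even_idx_def le_Suc_eq)
  then show ?thesis by (simp add: card_even_idx)
next
  case False
  then have "last_class n = odd_idx n" by (auto simp: last_class_def odd_idx_def)
  then show ?thesis by simp
qed

lemma card_last_class_pos: "n \<ge> 1 \<Longrightarrow> card (last_class n) > 0"
  by (auto simp: card_gt_0_iff last_class_def)

lemma eval_class_prod: "eval_at x (class_prod n) = (\<Prod>j\<in>last_class n. x j)"
  by (simp add: class_prod_def)

lemma class_prod_nonzero: "class_prod n \<noteq> (0 :: 'k::field_char_0 mvpoly)"
proof
  assume "class_prod n = (0 :: 'k mvpoly)"
  from arg_cong[OF this, of "eval_at (\<lambda>_. 1)"] show False by (simp add: eval_class_prod)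
qed

lemma class_prod_invariants: "class_prod n \<in> invariants n"
  unfolding invariants_iff
proof (intro conjI ballI allI)
  show "class_prod n \<in> polys n"
    unfolding class_prod_def by (rule polys_prod, rule polys_Var) (auto simp: last_class_def)
  fix \<pi> and x :: "nat \<Rightarrow> 'a" assume pi: "\<pi> \<in> W n"
  have "\<pi> p \<in> last_class n \<longleftrightarrow> p \<in> last_class n" for p
    unfolding last_class_def mem_Collect_eq using pi_mem[OF pi, of p] pi_even[OF pi, of p] by blast
  then have "\<pi> ` last_class n = last_class n" by (rule image_pi[OF pi])
  then have "(\<Prod>j\<in>last_class n. x (\<pi> j)) = (\<Prod>j\<in>last_class n. x j)"
    using prod.reindex[OF inj_on_subset[OF pi_inj[OF pi] subset_UNIV], of x "last_class n"] by simp
  then show "eval_at (\<lambda>i. x (\<pi> i)) (class_prod n) = eval_at x (class_prod n)" by (simp add: eval_class_prod)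
qed

lemma class_prod_single: "class_prod n = single (\<Sum>j\<in>last_class n. single j 1) (1 :: 'k::field_char_0)"
proof -
  have "(\<Prod>j\<in>A. Var j) = single (\<Sum>j\<in>A. single j 1) (1 :: 'k)" if "finite A" for A
    using that by (induction A) (auto simp: Var_def mult_single)
  then show ?thesis by (simp add: class_prod_def)
qed

lemma deg_le_class_prod: "deg_le (card (last_class n)) (class_prod n :: 'k::field_char_0 mvpoly)"
proof -
  have "deg_le (card A) (\<Prod>j\<in>A. Var j :: 'k mvpoly)" if "finite A" for A
    using that
  proof (induction A)
    case empty
    then show ?case using deg_le_Const[of 0 "1::'k"] by simp
  next
    case (insert j A)
    then show ?case using deg_le_mult[OF deg_le_Var[of j] insert.IH] by simp
  qed
  then show ?thesis by (simp add: class_prod_def)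
qed

lemma invariants_quot:
  fixes f g h :: "'k::field_char_0 mvpoly"
  assumes f: "f \<in> invariants n" and g: "g \<in> invariants n" "g \<noteq> 0" and fg: "f = g * h"
  shows "h \<in> invariants n"
proof -
  define c where "c i = (if i \<in> {1..n} then Var i else 0 :: 'k mvpoly)" for i
  have c: "subst c p = p" if "p \<in> polys n" for p
    by (rule mvpoly_eqI) (use that in \<open>auto simp: eval_at_subst c_def intro!: eval_at_cong\<close>)
  have "g * subst c h = g * h"
    using c[OF invariants_polys[OF f]] c[OF invariants_polys[OF g(1)]] by (simp add: fg)
  then have ch: "subst c h = h" using g(2) by simp
  have "subst c h \<in> polys n"
    unfolding subst_def eval_via_def
    by (intro polys_sum polys_mult polys_Const polys_prod polys_power) (auto simp: c_def intro!: polys_Var)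
  moreover have "subst (\<lambda>i. Var (\<pi> i)) h = h" if "\<pi> \<in> W n" for \<pi>
  proof -
    have "subst (\<lambda>i. Var (\<pi> i)) f = f" "subst (\<lambda>i. Var (\<pi> i)) g = g"
      using f g that by (auto simp: invariants_def)
    then have "g * subst (\<lambda>i. Var (\<pi> i)) h = g * h" by (simp add: fg)
    then show ?thesis using g(2) by simp
  qed
  ultimately show ?thesis by (simp add: invariants_def ch)
qed

lemma line_class_prod: "line (class_prod n) (\<lambda>_. 0) y = monom (\<Prod>j\<in>last_class n. y j) (card (last_class n))"
proof -
  have "(\<Prod>j\<in>A. [:0, y j:]) = monom (\<Prod>j\<in>A. y j) (card A)" if "finite A" for A
    using that
  proof (induction A)
    case (insert j A)
    have "[:0, y j:] = monom (y j) 1" by (simp add: monom_altdef)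
    then show ?case using insert by (simp add: mult_monom)
  qed (simp add: one_pCons monom_0)
  then show ?thesis by (simp add: class_prod_def)
qed

text \<open>On a ray where \<open>class_prod\<close> does not vanish it is a single power of t, so
  degrees add.\<close>

lemma deg_le_class_prod_quot:
  fixes h :: "'k::field_char_0 mvpoly"
  assumes d: "deg_le d (class_prod n * h)" and h: "h \<noteq> 0"
  shows "card (last_class n) \<le> d" and "deg_le (d - card (last_class n)) h"
proof -
  have *: "card (last_class n) + degree (line h (\<lambda>_. 0) y) \<le> d" if "eval_at y (class_prod n) \<noteq> 0" "line h (\<lambda>_. 0) y \<noteq> 0" for y
  proof -
    have c: "(\<Prod>j\<in>last_class n. y j) \<noteq> 0" using that by (simp add: eval_class_prod)
    have "degree (line (class_prod n * h) (\<lambda>_. 0) y) = card (last_class n) + degree (line h (\<lambda>_. 0) y)"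
      using that c by (simp add: line_class_prod degree_mult_eq degree_monom_eq)
    then show ?thesis using degree_line_le[OF d, of y] by simp
  qed
  have "\<exists>y. eval_at y (class_prod n * h) \<noteq> 0"
    using h class_prod_nonzero eval_at_eq_0_imp by (metis mult_eq_0_iff)
  then obtain y where y: "eval_at y (class_prod n) \<noteq> 0" "eval_at y h \<noteq> 0" by auto
  have "poly (line h (\<lambda>_. 0) y) 1 \<noteq> 0" using y by (simp add: poly_line)
  then have "line h (\<lambda>_. 0) y \<noteq> 0" by auto
  from *[OF y(1) this] show "card (last_class n) \<le> d" by simp
  show "deg_le (d - card (last_class n)) h"
  proof (rule deg_le_generic[OF class_prod_nonzero[of n]])
    fix y :: "nat \<Rightarrow> 'k" assume y: "eval_at y (class_prod n) \<noteq> 0"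
    show "degree (line h (\<lambda>_. 0) y) \<le> d - card (last_class n)"
      using *[OF y] by (cases "line h (\<lambda>_. 0) y = 0") auto
  qed
qed

section \<open>Reduction of tuples: removing ones and dropping a zero entry\<close>

lemma Lambda_add_ones: "\<kappa> \<in> \<Lambda> n \<Longrightarrow> add_ones n \<kappa> \<in> \<Lambda> n"
  by (auto simp: \<Lambda>_def add_ones_def)

lemma odd_size_odd_idx: "odd_size n lam = (\<Sum>i\<in>odd_idx n. lam i)"
  by (simp add: odd_size_def odd_idx_def)

lemma odd_size_add_ones: "odd_size n (add_ones n \<kappa>) = odd_size n \<kappa> + card (last_class n)"
proof -
  have "(\<Sum>i\<in>odd_idx n. add_ones n \<kappa> i) = (\<Sum>i\<in>odd_idx n. \<kappa> i + 1)"
    by (rule sum.cong) (auto simp: add_ones_def odd_idx_def)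
  then show ?thesis by (simp add: odd_size_odd_idx sum_Suc card_last_class)
qed

lemma Lambda_dec:
  assumes "\<mu> \<in> \<Lambda> n" "\<mu> n > 0"
  obtains \<kappa> where "\<kappa> \<in> \<Lambda> n" "\<mu> = add_ones n \<kappa>"
proof
  have n: "n \<ge> 1" using assms by (cases n) (auto simp: \<Lambda>_def)
  have pos: "\<mu> i > 0" if "i \<in> {1..n}" for i
  proof -
    have "\<mu> n \<le> \<mu> i" using assms(1) that by (auto simp: \<Lambda>_def)
    then show ?thesis using assms(2) by simp
  qed
  show "(\<lambda>i. \<mu> i - 1) \<in> \<Lambda> n" using assms(1) by (auto simp: \<Lambda>_def intro: diff_le_mono)
  show "\<mu> = add_ones n (\<lambda>i. \<mu> i - 1)"
    using pos assms(1) by (force simp: add_ones_def \<Lambda>_def)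
qed

lemma Lambda_Suc_0: "\<mu> \<in> \<Lambda> (Suc m) \<and> \<mu> (Suc m) = 0 \<longleftrightarrow> \<mu> \<in> \<Lambda> m"
proof
  assume a: "\<mu> \<in> \<Lambda> (Suc m) \<and> \<mu> (Suc m) = 0"
  have "\<mu> i = 0" if "i \<notin> {1..m}" for i
    using a that by (cases "i = Suc m") (auto simp: \<Lambda>_def)
  then show "\<mu> \<in> \<Lambda> m" using a by (simp add: \<Lambda>_def)
next
  assume a: "\<mu> \<in> \<Lambda> m"
  have "\<mu> j \<le> \<mu> i" if "1 \<le> i" "i \<le> j" for i j
    using a that by (cases "j \<le> m") (auto simp: \<Lambda>_def)
  then show "\<mu> \<in> \<Lambda> (Suc m) \<and> \<mu> (Suc m) = 0" using a by (auto simp: \<Lambda>_def)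
qed

lemma odd_size_Suc_0: "\<mu> (Suc m) = 0 \<Longrightarrow> odd_size (Suc m) \<mu> = odd_size m \<mu>"
  unfolding odd_size_odd_idx by (rule sum.mono_neutral_right) (auto simp: odd_idx_def le_Suc_eq)

lemma shifted_add_ones: "i \<in> {1..n} \<Longrightarrow> shifted n r (add_ones n \<kappa>) i = shifted n r \<kappa> i + 1"
  by (simp add: shifted_def add_ones_def algebra_simps)

text \<open>The coordinates of \<rho> grow by r when a variable is appended. This is the origin of
  the translation by r in the restriction to m variables and by -r in the lift back.\<close>

lemma shifted_Suc: "i \<in> {1..m} \<Longrightarrow> shifted (Suc m) r \<mu> i = shifted m r \<mu> i + r"
  by (simp add: shifted_def Suc_diff_le algebra_simps)

lemma eval_shift_back:
  fixes p :: "'k::field_char_0 mvpoly"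
  assumes "p \<in> polys n"
  shows "eval_at (shifted n r (add_ones n \<kappa>)) (subst (\<lambda>i. Var i + Const (- 1)) p) = eval_at (shifted n r \<kappa>) p"
  by (simp add: eval_at_subst) (rule eval_at_cong[OF assms], simp add: shifted_add_ones)

lemma W_Suc: "\<pi> \<in> W m \<Longrightarrow> \<pi> \<in> W (Suc m)"
  by (auto simp: W_def elim!: permutes_subset)

lemma Var_dvd_iff:
  fixes p :: "'k::field_char_0 mvpoly"
  shows "Var a dvd p \<longleftrightarrow> (\<forall>x. x a = 0 \<longrightarrow> eval_at x p = 0)"
proof -
  have "Var a dvd p \<longleftrightarrow> replace_var a 0 p = 0"
    using linear_dvd_iff[of a 0 p] by simp
  also have "\<dots> \<longleftrightarrow> (\<forall>x. x a = 0 \<longrightarrow> eval_at x p = 0)"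
  proof (intro iffI allI impI)
    fix x :: "nat \<Rightarrow> 'k" assume r: "replace_var a 0 p = 0" and x: "x a = 0"
    have "x(a := 0) = x" using x by auto
    then show "eval_at x p = 0" using eval_at_replace_var[of x a 0 p] r by simp
  next
    assume "\<forall>x. x a = 0 \<longrightarrow> eval_at x p = 0"
    then show "replace_var a 0 p = 0" by (intro mvpoly_eqI) (simp add: eval_at_replace_var)
  qed
  finally show ?thesis .
qed

lemma Var_nonzero: "Var j \<noteq> (0 :: 'k::field_char_0 mvpoly)"
proof
  assume "Var j = (0 :: 'k mvpoly)"
  then have "eval_at (\<lambda>_. 1) (Var j) = eval_at (\<lambda>_. 1) (0 :: 'k mvpoly)" by (rule arg_cong)
  then show False by simp
qed

text \<open>Invariance under the transposition of j and n carries the vanishing from z_n = 0 to z_j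
  = 0; distinct variables are primes not dividing one another.\<close>

lemma class_prod_dvd:
  fixes f :: "'k::field_char_0 mvpoly"
  assumes f: "f \<in> invariants n" and z: "\<And>x. x n = 0 \<Longrightarrow> eval_at x f = 0"
  shows "class_prod n dvd f"
proof -
  have "(\<Prod>j\<in>last_class n. Var j ^ 1) dvd f"
  proof (rule prod_prime_power_dvd)
    fix j assume j: "j \<in> last_class n"
    show "prime_elem (Var j :: 'k mvpoly)" using prime_elem_linear[of j 0] Var_nonzero[of j] by simp
    show "Var j ^ 1 dvd f"
      unfolding power_one_right Var_dvd_iff
    proof (intro allI impI)
      fix x :: "nat \<Rightarrow> 'k" assume x: "x j = 0"
      let ?t = "Transposition.transpose j n"
      have "?t \<in> W n"
      proof (cases "j = n")
        case True
        then show ?thesis using permutes_id[of "{1..n}"] by (simp add: W_def id_def)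
      next
        case False
        then show ?thesis using j by (intro swap_W) (auto simp: last_class_def parity_pairs_def)
      qed
      then have "eval_at (\<lambda>i. x (?t i)) f = eval_at x f" using f by (auto simp: invariants_iff)
      then show "eval_at x f = 0" using z[of "\<lambda>i. x (?t i)"] x by simp
    qed
    fix j' assume j': "j' \<in> last_class n" "j \<noteq> j'"
    then show "\<not> Var j dvd (Var j' :: 'k mvpoly)"
      unfolding Var_dvd_iff by (auto intro!: exI[of _ "\<lambda>i. if i = j then 0 else 1"])
  qed simp
  then show ?thesis by (simp add: class_prod_def)
qed

section \<open>Restriction to the hyperplane where the last variable is 0; translations\<close>

definition restrict_last :: "nat \<Rightarrow> 'k \<Rightarrow> 'k mvpoly \<Rightarrow> 'k::field_char_0 mvpoly" where
  "restrict_last m c f = subst (\<lambda>i. if i = Suc m then 0 else Var i + Const c) f"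

lemma eval_restrict_last: "eval_at x (restrict_last m c f) = eval_at (\<lambda>i. if i = Suc m then 0 else x i + c) f"
  unfolding restrict_last_def eval_at_subst by (rule arg_cong[of _ _ "\<lambda>g. eval_at g f"]) auto

lemma restrict_last_invariants:
  fixes f :: "'k::field_char_0 mvpoly"
  assumes f: "f \<in> invariants (Suc m)"
  shows "restrict_last m c f \<in> invariants m"
  unfolding invariants_iff
proof (intro conjI ballI allI)
  show "restrict_last m c f \<in> polys m"
    unfolding restrict_last_def
  proof (rule polys_subst[OF invariants_polys[OF f]])
    fix i assume "i \<in> {1..Suc m}"
    then have i: "i \<noteq> Suc m \<Longrightarrow> i \<in> {1..m}" by auto
    show "(if i = Suc m then 0 else Var i + Const c) \<in> polys m"
    proof (cases "i = Suc m")
      case False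
      then show ?thesis unfolding if_not_P[OF False] by (intro polys_add polys_Var[OF i] polys_Const)
    qed simp
  qed
  fix \<pi> and x :: "nat \<Rightarrow> 'k" assume pi: "\<pi> \<in> W m"
  define y where "y i = (if i = Suc m then 0 else x i + c)" for i
  have "eval_at (\<lambda>i. y (\<pi> i)) f = eval_at y f"
    using f W_Suc[OF pi] unfolding invariants_iff by blast
  moreover have "(\<lambda>i. y (\<pi> i)) = (\<lambda>i. if i = Suc m then 0 else x (\<pi> i) + c)"
    using pi_Suc[OF pi] by (auto simp: y_def)
  ultimately show "eval_at (\<lambda>i. x (\<pi> i)) (restrict_last m c f) = eval_at x (restrict_last m c f)"
    unfolding eval_restrict_last y_def by simp
qed

lemma deg_le_subst_affine:
  fixes f :: "'k::field_char_0 mvpoly"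
  assumes "deg_le d f" "\<And>y. line (subst g f) (\<lambda>_. 0) y = line f (u y) (v y)"
  shows "deg_le d (subst g f)"
  unfolding deg_le_iff using assms degree_line_le' by metis

lemma line_subst: "line (subst g f) x v = eval_via (\<lambda>c. [:c:]) (\<lambda>i. line (g i) x v) f"
  for f :: "'k::field_char_0 mvpoly"
  by (induction f rule: mvpoly_induct)
     (simp_all add: coeff_hom.eval_Const[OF coeff_hom_poly] coeff_hom.eval_Var[OF coeff_hom_poly]
        coeff_hom.eval_add[OF coeff_hom_poly] coeff_hom.eval_mult[OF coeff_hom_poly])

lemma deg_le_restrict_last:
  assumes "deg_le d f" shows "deg_le d (restrict_last m c f)"
  unfolding restrict_last_def
proof (rule deg_le_subst_affine[OF assms])
  fix y :: "nat \<Rightarrow> 'a"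
  have "(\<lambda>i. line (if i = Suc m then 0 else Var i + Const c) (\<lambda>_. 0) y)
      = (\<lambda>i. [:if i = Suc m then 0 else c, if i = Suc m then 0 else y i:])" by auto
  then show "line (subst (\<lambda>i. if i = Suc m then 0 else Var i + Const c) f) (\<lambda>_. 0) y
      = line f (\<lambda>i. if i = Suc m then 0 else c) (\<lambda>i. if i = Suc m then 0 else y i)"
    unfolding line_subst by (simp add: line_def)
qed

lemma deg_le_shift:
  assumes "deg_le d f" shows "deg_le d (subst (\<lambda>i. Var i + Const (c :: 'k::field_char_0)) f)"
  by (rule deg_le_subst_affine[OF assms]) (simp add: line_subst_shift)

text \<open>Translation alters only lower degrees, so the normalising coefficient, which sits in top
  degree, survives it.\<close>

lemma lookup_shift_top:
  fixes p :: "'k::field_char_0 mvpoly"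
  assumes p: "deg_le d p" and m: "mon_degree m = d"
  shows "lookup (subst (\<lambda>i. Var i + Const c) p) m = lookup p m"
proof -
  have "hom_component d (subst (\<lambda>i. Var i + Const c) p) = hom_component d p"
  proof (rule mvpoly_eqI)
    fix y :: "nat \<Rightarrow> 'k"
    have "coeff (line p (\<lambda>_. c) y) d = coeff (line p (\<lambda>_. 0) y) d"
    proof (cases d)
      case 0
      have "p = hom_component 0 p" using hom_component_sum_eq[OF p] 0 by simp
      then have e: "eval_at x p = eval_at (\<lambda>_. 0) p" for x
        using eval_at_hom_scale[of 0 x 0 p] by simp
      show ?thesis unfolding 0 coeff_line_const by (simp only: e[of "\<lambda>_. c"])
    next
      case (Suc d')
      have "degree (line p (\<lambda>_. c) y - line p (\<lambda>_. 0) y) < d"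
        using line_shift_top(1)[of d' p "\<lambda>_. c" y] p Suc by simp
      then have "coeff (line p (\<lambda>_. c) y - line p (\<lambda>_. 0) y) d = 0" by (rule coeff_eq_0)
      then show ?thesis by simp
    qed
    then show "eval_at y (hom_component d (subst (\<lambda>i. Var i + Const c) p)) = eval_at y (hom_component d p)"
      by (simp add: line_subst_shift flip: coeff_line_0)
  qed
  from arg_cong[OF this, of "\<lambda>q. lookup q m"] show ?thesis by (simp add: lookup_hom_component m)
qed

lemma lookup_single_mult: "lookup (single a 1 * q) (a + b) = lookup q b"
  for q :: "'k::field_char_0 mvpoly"
proof -
  have "single a 1 * q = (\<Sum>m\<in>keys q. single (a + m) (lookup q m))"
    by (subst poly_mapping_sum_single[of q]) (simp add: sum_distrib_left mult_single)
  then have "lookup (single a 1 * q) (a + b) = (\<Sum>m\<in>keys q. if m = b then lookup q m else 0)"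
    by (simp add: lookup_sum lookup_single when_def)
  then show ?thesis by (simp add: in_keys_iff)
qed

lemma lookup_perm_subst:
  fixes p :: "'k::field_char_0 mvpoly"
  assumes "bij \<pi>"
  shows "lookup (subst (\<lambda>i. Var (\<pi> i)) p) k = lookup p (Poly_Mapping.map_key \<pi> k)"
proof -
  have inj: "inj \<pi>" using assms by (rule bij_is_inj)
  have mk: "lookup (Poly_Mapping.map_key \<pi> k) i = lookup k (\<pi> i)" for k :: "nat \<Rightarrow>\<^sub>0 nat" and i
    using inj by (simp add: map_key.rep_eq)
  define s where "s m = (\<Sum>i\<in>keys m. single (\<pi> i) (lookup m i))" for m :: "nat \<Rightarrow>\<^sub>0 nat"
  have s: "lookup (s m) (\<pi> i) = lookup m i" for m i
    using inj by (simp add: s_def lookup_sum lookup_single when_def inj_eq in_keys_iff)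
  have "mon (\<lambda>i. Var (\<pi> i)) m = single (s m) (1 :: 'k)" for m
  proof -
    have "(\<Prod>i\<in>A. Var (\<pi> i) ^ lookup m i) = single (\<Sum>i\<in>A. single (\<pi> i) (lookup m i)) (1::'k)" if "finite A" for A
      using that
    proof (induction A)
      case (insert i A)
      have "Var j ^ e = single (single j e) (1 :: 'k)" for j e
        by (induction e) (simp_all add: Var_def mult_single flip: single_add)
      then show ?case using insert by (simp add: mult_single)
    qed simp
    then show ?thesis by (simp add: mon_def s_def)
  qed
  then have "subst (\<lambda>i. Var (\<pi> i)) p = (\<Sum>m\<in>keys p. single (s m) (lookup p m))"
    by (simp add: subst_def eval_via_mon Const_def mult_single)
  then have "lookup (subst (\<lambda>i. Var (\<pi> i)) p) k = (\<Sum>m\<in>keys p. if s m = k then lookup p m else 0)"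
    by (simp add: lookup_sum lookup_single when_def)
  also have "\<dots> = (\<Sum>m\<in>keys p. if m = Poly_Mapping.map_key \<pi> k then lookup p m else 0)"
  proof (rule sum.cong[OF refl])
    fix m
    have "s m = k \<longleftrightarrow> m = Poly_Mapping.map_key \<pi> k"
    proof
      assume "s m = k" then show "m = Poly_Mapping.map_key \<pi> k"
        by (intro poly_mapping_eqI) (simp add: mk s flip: \<open>s m = k\<close>)
    next
      assume e: "m = Poly_Mapping.map_key \<pi> k"
      show "s m = k"
      proof (rule poly_mapping_eqI)
        fix j
        obtain i where "j = \<pi> i" using bij_is_surj[OF assms] by (rule surjE)
        then show "lookup (s m) j = lookup k j" by (simp add: s) (simp add: e mk)
      qed
    qed
    then show "(if s m = k then lookup p m else 0) = (if m = Poly_Mapping.map_key \<pi> k then lookup p m else 0)" by simp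
  qed
  also have "\<dots> = lookup p (Poly_Mapping.map_key \<pi> k)" by (simp add: in_keys_iff)
  finally show ?thesis .
qed

text \<open>A criterion on coefficients, needed because \<open>lift_invariant\<close> specifies a
  polynomial through its coefficients.\<close>

lemma invariants_lookup_iff:
  fixes p :: "'k::field_char_0 mvpoly"
  shows "p \<in> invariants n \<longleftrightarrow> p \<in> polys n \<and> (\<forall>\<pi>\<in>W n. \<forall>k. lookup p (Poly_Mapping.map_key \<pi> k) = lookup p k)"
proof -
  have "subst (\<lambda>i. Var (\<pi> i)) p = p \<longleftrightarrow> (\<forall>k. lookup p (Poly_Mapping.map_key \<pi> k) = lookup p k)" if "\<pi> \<in> W n" for \<pi>
    using lookup_perm_subst[OF permutes_bij[OF W_permutes[OF that]], of p]
    by (auto simp: poly_mapping_eq_iff fun_eq_iff)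
  then show ?thesis unfolding invariants_def by blast
qed

text \<open>Tuples arise from the empty one by appending a zero entry and by adding 1 to all
  entries.\<close>

lemma Lambda_induct [consumes 1, case_names zero Suc add_ones]:
  assumes "\<mu> \<in> \<Lambda> n" and "P 0 (\<lambda>_. 0)"
    and S: "\<And>m \<mu>. \<mu> \<in> \<Lambda> m \<Longrightarrow> P m \<mu> \<Longrightarrow> P (Suc m) \<mu>"
    and I: "\<And>n \<kappa>. n \<ge> 1 \<Longrightarrow> \<kappa> \<in> \<Lambda> n \<Longrightarrow> P n \<kappa> \<Longrightarrow> P n (add_ones n \<kappa>)"
  shows "P n \<mu>"
  using assms(1)
proof (induction n arbitrary: \<mu>)
  case 0
  then have "\<mu> = (\<lambda>_. 0)" by (auto simp: \<Lambda>_def)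
  then show ?case using assms(2) by simp
next
  case (Suc m)
  show ?case
    using Suc.prems
  proof (induction "\<mu> (Suc m)" arbitrary: \<mu>)
    case 0
    then have "\<mu> \<in> \<Lambda> m" using Lambda_Suc_0[of \<mu> m] by simp
    then show ?case using S Suc.IH by blast
  next
    case (Suc k)
    then obtain \<kappa> where k: "\<kappa> \<in> \<Lambda> (Suc m)" "\<mu> = add_ones (Suc m) \<kappa>" using Lambda_dec[of \<mu> "Suc m"] by auto
    then have "k = \<kappa> (Suc m)" using Suc.hyps(2) by (simp add: add_ones_def)
    with Suc.hyps(1) k show ?case by (auto intro: I)
  qed
qed

section \<open>Alternating sums and the normalising monomial\<close>

lemma alt_Suc_0: "\<mu> (Suc m) = 0 \<Longrightarrow> alt (Suc m) \<mu> i = alt m \<mu> i"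
  unfolding alt_def by (rule sum.mono_neutral_right) (auto simp: le_Suc_eq)

lemma alternating_sum: "i \<le> n \<Longrightarrow> (\<Sum>j=i..n. (- 1) ^ (j - i)) = (if even i = even n then 1 else 0 :: int)"
proof (induction n rule: dec_induct)
  case (step n)
  have "{i..Suc n} = insert (Suc n) {i..n}" using step by auto
  then have "(\<Sum>j=i..Suc n. (- 1) ^ (j - i)) = (- 1) ^ (Suc n - i) + (\<Sum>j=i..n. (- 1 :: int) ^ (j - i))"
    by simp
  also have "(- 1 :: int) ^ (Suc n - i) = (if even i = even n then - 1 else 1)"
    using step by (auto simp: minus_one_power_iff Suc_diff_le)
  finally show ?case using step by auto
qed simp

text \<open>The alternating sum of ones from i to n is 1 or 0 according to the parity of n - i.
  Hence adding ones multiplies the normalising monomial by \<open>class_prod\<close>.\<close>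

lemma alt_add_ones: "i \<in> {1..n} \<Longrightarrow> alt n (add_ones n \<kappa>) i = alt n \<kappa> i + (if i \<in> last_class n then 1 else 0)"
proof -
  assume i: "i \<in> {1..n}"
  have "alt n (add_ones n \<kappa>) i = (\<Sum>j=i..n. (- 1) ^ (j - i) * int (\<kappa> j) + (- 1) ^ (j - i))"
    unfolding alt_def using i by (intro sum.cong) (auto simp: add_ones_def algebra_simps)
  then show ?thesis using alternating_sum[of i n] i by (simp add: alt_def sum.distrib last_class_def)
qed

lemma lookup_alt_mon: "lookup (alt_mon n \<mu>) i = (if i \<in> {1..n} then nat (alt n \<mu> i) else 0)"
  by (simp add: alt_mon_def lookup_sum lookup_single when_def)

lemma mon_degree_alt_mon: "mon_degree (alt_mon n \<mu>) = (\<Sum>i=1..n. nat (alt n \<mu> i))"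
proof -
  have "mon_degree (alt_mon n \<mu>) = (\<Sum>i=1..n. lookup (alt_mon n \<mu>) i)"
    by (rule mon_degree_superset) (auto simp: in_keys_iff lookup_alt_mon split: if_splits)
  then show ?thesis by (simp add: lookup_alt_mon)
qed

text \<open>The sum of all [\<mu>]_i is the odd size, because the contributions of an even-indexed
  entry cancel. So the normalising monomial lies in top degree.\<close>

lemma alt_props:
  assumes "\<mu> \<in> \<Lambda> n"
  shows "(\<forall>i\<in>{1..n}. alt n \<mu> i \<ge> 0) \<and> mon_degree (alt_mon n \<mu>) = odd_size n \<mu>"
  using assms
proof (induction rule: Lambda_induct)
  case zero
  then show ?case by (simp add: mon_degree_alt_mon odd_size_def)
next
  case (Suc m \<mu>)
  then have z: "\<mu> (Suc m) = 0" using Lambda_Suc_0[of \<mu> m] by simp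
  have "alt m \<mu> (Suc m) = 0" by (simp add: alt_def)
  then show ?case using Suc.IH
    by (auto simp: alt_Suc_0[of \<mu> m, OF z] odd_size_Suc_0[of \<mu> m, OF z] mon_degree_alt_mon le_Suc_eq)
next
  case (add_ones n \<kappa>)
  have "(\<Sum>i=1..n. nat (alt n (add_ones n \<kappa>) i)) = (\<Sum>i=1..n. nat (alt n \<kappa> i) + (if i \<in> last_class n then 1 else 0))"
    using add_ones.IH by (intro sum.cong) (auto simp: alt_add_ones nat_add_distrib)
  also have "\<dots> = (\<Sum>i=1..n. nat (alt n \<kappa> i)) + card (last_class n)"
  proof -
    have "(\<Sum>i=1..n. if i \<in> last_class n then 1 else 0 :: nat) = (\<Sum>i\<in>last_class n. 1)"
      by (rule sum.mono_neutral_cong_right) (auto simp: last_class_def)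
    then show ?thesis by (simp add: sum.distrib)
  qed
  finally show ?case using add_ones.IH
    by (simp add: mon_degree_alt_mon odd_size_add_ones alt_add_ones)
qed

lemma alt_mon_add_ones:
  assumes "\<kappa> \<in> \<Lambda> n"
  shows "alt_mon n (add_ones n \<kappa>) = (\<Sum>j\<in>last_class n. single j 1) + alt_mon n \<kappa>"
proof (rule poly_mapping_eqI)
  fix i
  have "(\<Sum>j\<in>last_class n. lookup (single j 1) i) = (if i \<in> last_class n then 1 else 0 :: nat)"
    by (simp add: lookup_single when_def)
  then show "lookup (alt_mon n (add_ones n \<kappa>)) i = lookup ((\<Sum>j\<in>last_class n. single j 1) + alt_mon n \<kappa>) i"
    using alt_props[OF assms]
    by (cases "i \<in> {1..n}") (auto simp: lookup_add lookup_sum lookup_alt_mon alt_add_ones nat_add_distrib last_class_def)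
qed

lemma alt_mon_Suc_0:
  assumes "\<mu> (Suc m) = 0"
  shows "alt_mon (Suc m) \<mu> = alt_mon m \<mu>"
proof (rule poly_mapping_eqI)
  fix i
  have "alt m \<mu> (Suc m) = 0" by (simp add: alt_def)
  then show "lookup (alt_mon (Suc m) \<mu>) i = lookup (alt_mon m \<mu>) i"
    by (auto simp: lookup_alt_mon alt_Suc_0[of \<mu> m, OF assms] le_Suc_eq)
qed

text \<open>The first entry is the largest one and its index is odd, so the size bounds all
  entries.\<close>

lemma finite_Lambda: "finite {\<mu> \<in> \<Lambda> n. odd_size n \<mu> \<le> D}"
proof (rule finite_subset)
  show "finite {f. \<forall>i. (i \<in> {1..n} \<longrightarrow> f i \<in> {..D}) \<and> (i \<notin> {1..n} \<longrightarrow> f i = (0::nat))}"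
    by (rule finite_set_of_finite_funs) auto
  show "{\<mu> \<in> \<Lambda> n. odd_size n \<mu> \<le> D} \<subseteq> {f. \<forall>i. (i \<in> {1..n} \<longrightarrow> f i \<in> {..D}) \<and> (i \<notin> {1..n} \<longrightarrow> f i = (0::nat))}"
  proof (intro subsetI CollectI allI conjI impI)
    fix \<mu> i assume "\<mu> \<in> {\<mu> \<in> \<Lambda> n. odd_size n \<mu> \<le> D}" and i: "i \<in> {1..n}"
    then have m: "\<mu> \<in> \<Lambda> n" "odd_size n \<mu> \<le> D" by auto
    have "\<mu> i \<le> \<mu> 1" using m(1) i by (auto simp: \<Lambda>_def)
    also have "\<mu> 1 \<le> odd_size n \<mu>"
      unfolding odd_size_odd_idx using i by (intro member_le_sum) (auto simp: odd_idx_def)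
    finally show "\<mu> i \<in> {..D}" using m(2) by simp
  qed (auto simp: \<Lambda>_def)
qed

text \<open>Surjectivity of setting the last variable to 0 on invariants, without raising the
  degree. A monomial receives the coefficient in f of any W-conjugate free of the last variable, and
  0 if there is none.\<close>

lemma lift_invariant:
  fixes f :: "'k::field_char_0 mvpoly"
  assumes f: "f \<in> invariants m" "deg_le d f"
  obtains g where "g \<in> invariants (Suc m)" "deg_le d g"
    "\<And>k. lookup k (Suc m) = 0 \<Longrightarrow> lookup g k = lookup f k"
    "\<And>x. x (Suc m) = 0 \<Longrightarrow> eval_at x g = eval_at x f"
proof -
  let ?n = "Suc m"
  let ?mk = "\<lambda>\<pi> k :: nat \<Rightarrow>\<^sub>0 nat. Poly_Mapping.map_key \<pi> k"
  have mk: "lookup (?mk \<pi> k) i = lookup k (\<pi> i)" if "\<pi> permutes A" for \<pi> :: "nat \<Rightarrow> nat" and k i A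
    using permutes_inj[OF that] by (simp add: map_key.rep_eq)
  have mkW: "lookup (?mk \<pi> k) i = lookup k (\<pi> i)" if "\<pi> \<in> W j" for \<pi> k i j
    by (rule mk[OF W_permutes[OF that]])
  have comp: "\<pi> \<circ> \<sigma> \<in> W j" if "\<pi> \<in> W j" "\<sigma> \<in> W j" for \<pi> \<sigma> j
    using that by (auto simp: W_def permutes_compose)
  have invW: "inv \<pi> \<in> W j" if "\<pi> \<in> W j" for \<pi> j
  proof -
    have p: "\<pi> permutes {1..j}" using that by (rule W_permutes)
    have "inv \<pi> i mod 2 = i mod 2" for i
      using that permutes_inverses(1)[OF p, of i] by (metis (mono_tags, lifting) W_def mem_Collect_eq)
    then show ?thesis using permutes_inv[OF p] by (simp add: W_def)
  qed
  have finv: "lookup f (?mk \<sigma> k) = lookup f k" if "\<sigma> \<in> W m" for \<sigma> k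
    using f(1) that unfolding invariants_lookup_iff by blast
  \<comment> \<open>Independence of the chosen conjugate: the two permutations differ by
    \<open>s0\<close>, which a transposition of two variables absent from \<open>?mk \<pi> k\<close>
    turns into \<open>\<sigma>\<close> fixing m + 1, and f is invariant under
    \<open>\<sigma>\<close>.\<close>
  have wd: "lookup f (?mk \<pi> k) = lookup f (?mk \<pi>' k)"
    if pi: "\<pi> \<in> W ?n" "\<pi>' \<in> W ?n" and z: "lookup k (\<pi> ?n) = 0" "lookup k (\<pi>' ?n) = 0" for \<pi> \<pi>' k
  proof -
    define s0 where "s0 = inv \<pi> \<circ> \<pi>'"
    define \<tau> where "\<tau> = Transposition.transpose ?n (s0 ?n)"
    define \<sigma> where "\<sigma> = \<tau> \<circ> s0"
    have s0: "s0 \<in> W ?n" unfolding s0_def by (intro comp invW pi)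
    have ps0: "\<pi> (s0 i) = \<pi>' i" for i
      using permutes_inverses(1)[OF W_permutes[OF pi(1)]] by (simp add: s0_def)
    have "\<tau> \<in> W ?n"
    proof (cases "s0 ?n = ?n")
      case True
      then show ?thesis using permutes_id[of "{1..?n}"] by (simp add: \<tau>_def W_def id_def)
    next
      case False
      have "s0 ?n \<in> {1..?n}" using pi_mem[OF s0, of ?n] by simp
      moreover have "even (s0 ?n) = even ?n" by (rule pi_even[OF s0])
      ultimately show ?thesis unfolding \<tau>_def using False by (intro swap_W) (auto simp: parity_pairs_def)
    qed
    then have s: "\<sigma> \<in> W ?n" unfolding \<sigma>_def by (rule comp[OF _ s0])
    have sn: "\<sigma> ?n = ?n" by (simp add: \<sigma>_def \<tau>_def)
    have "\<sigma> permutes {1..m}"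
    proof (rule permutes_superset[OF W_permutes[OF s]])
      fix i assume "i \<in> {1..?n} - {1..m}"
      then have "i = ?n" by auto
      then show "\<sigma> i = i" using sn by simp
    qed
    then have sm: "\<sigma> \<in> W m" using s by (simp add: W_def)
    have "lookup k (\<pi> (\<sigma> i)) = lookup k (\<pi>' i)" for i
    proof (cases "s0 i = ?n \<or> s0 i = s0 ?n")
      case True
      then show ?thesis using ps0 z by (auto simp: \<sigma>_def \<tau>_def Transposition.transpose_def) (metis ps0)+
    next
      case False
      then show ?thesis by (simp add: \<sigma>_def \<tau>_def Transposition.transpose_def ps0)
    qed
    then have "?mk \<sigma> (?mk \<pi> k) = ?mk \<pi>' k"
      by (intro poly_mapping_eqI) (simp add: mkW[OF sm] mkW[OF pi(1)] mkW[OF pi(2)])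
    then show ?thesis using finv[OF sm, of "?mk \<pi> k"] by simp
  qed
  \<comment> \<open>The default 0 concerns the monomials containing every variable in the orbit of m
    + 1.\<close>
  define \<phi> where "\<phi> k = (if \<exists>\<pi>\<in>W ?n. lookup k (\<pi> ?n) = 0
      then lookup f (?mk (SOME \<pi>. \<pi> \<in> W ?n \<and> lookup k (\<pi> ?n) = 0) k) else 0)" for k
  have phi: "\<phi> k = lookup f (?mk \<pi> k)" if "\<pi> \<in> W ?n" "lookup k (\<pi> ?n) = 0" for \<pi> k
  proof -
    have "(SOME \<pi>. \<pi> \<in> W ?n \<and> lookup k (\<pi> ?n) = 0) \<in> W ?n \<and> lookup k ((SOME \<pi>. \<pi> \<in> W ?n \<and> lookup k (\<pi> ?n) = 0) ?n) = 0"
      by (rule someI[of _ \<pi>]) (use that in simp)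
    then have "lookup f (?mk (SOME \<pi>. \<pi> \<in> W ?n \<and> lookup k (\<pi> ?n) = 0) k) = lookup f (?mk \<pi> k)"
      using that by (intro wd) auto
    then show ?thesis using that by (auto simp: \<phi>_def)
  qed
  have phi_ex: "\<exists>\<pi>\<in>W ?n. ?mk \<pi> k \<in> keys f" if nz: "\<phi> k \<noteq> 0" for k
  proof -
    obtain \<pi> where p: "\<pi> \<in> W ?n" "lookup k (\<pi> ?n) = 0" using nz by (auto simp: \<phi>_def split: if_splits)
    then show ?thesis using phi[OF p] nz by (auto simp: in_keys_iff)
  qed
  have mk_inv: "?mk (inv \<pi>) (?mk \<pi> k) = k" if "\<pi> \<in> W ?n" for \<pi> k
    by (rule poly_mapping_eqI)
       (simp add: mkW[OF that] mkW[OF invW[OF that]] permutes_inverses[OF W_permutes[OF that]])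
  have "finite (W ?n)"
    by (rule finite_subset[OF _ finite_permutations[of "{1..?n}"]]) (auto simp: W_def)
  then have "finite ((\<lambda>(\<pi>, k). ?mk (inv \<pi>) k) ` (W ?n \<times> keys f))" by simp
  moreover have "{k. \<phi> k \<noteq> 0} \<subseteq> (\<lambda>(\<pi>, k). ?mk (inv \<pi>) k) ` (W ?n \<times> keys f)"
  proof
    fix k assume "k \<in> {k. \<phi> k \<noteq> 0}"
    then obtain \<pi> where "\<pi> \<in> W ?n" "?mk \<pi> k \<in> keys f" using phi_ex by blast
    then show "k \<in> (\<lambda>(\<pi>, k). ?mk (inv \<pi>) k) ` (W ?n \<times> keys f)"
      using mk_inv by (intro image_eqI[of _ _ "(\<pi>, ?mk \<pi> k)"]) auto
  qed
  ultimately have fin: "finite {k. \<phi> k \<noteq> 0}" by (rule rev_finite_subset)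
  define g where "g = Abs_poly_mapping \<phi>"
  have g: "lookup g k = \<phi> k" for k unfolding g_def using fin by simp
  have gp: "g \<in> polys ?n"
    unfolding polys_def
  proof safe
    fix k i assume k: "k \<in> keys g" and i: "i \<in> keys k"
    obtain \<pi> where p: "\<pi> \<in> W ?n" "?mk \<pi> k \<in> keys f" using phi_ex[of k] k g by (auto simp: in_keys_iff)
    obtain j where j: "i = \<pi> j" using permutes_surj[OF W_permutes[OF p(1)]] by (rule surjE)
    then have "j \<in> keys (?mk \<pi> k)" using i by (simp add: in_keys_iff mkW[OF p(1)])
    then have "j \<in> {1..m}" using p(2) invariants_polys[OF f(1)] unfolding polys_def by blast
    then show "i \<in> {1..?n}" using pi_mem[OF p(1), of j] j by simp
  qed
  have "\<phi> (?mk \<sigma> k) = \<phi> k" if s: "\<sigma> \<in> W ?n" for \<sigma> k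
  proof (cases "\<exists>\<pi>\<in>W ?n. lookup k (\<pi> ?n) = 0")
    case True
    then obtain \<pi> where p: "\<pi> \<in> W ?n" "lookup k (\<pi> ?n) = 0" by blast
    define \<pi>' where "\<pi>' = inv \<sigma> \<circ> \<pi>"
    have p': "\<pi>' \<in> W ?n" unfolding \<pi>'_def by (intro comp invW s p)
    have e: "\<sigma> (\<pi>' i) = \<pi> i" for i by (simp add: \<pi>'_def permutes_inverses[OF W_permutes[OF s]])
    have "?mk \<pi>' (?mk \<sigma> k) = ?mk \<pi> k"
      by (rule poly_mapping_eqI) (simp add: mkW[OF p'] mkW[OF s] mkW[OF p(1)] e)
    moreover have "lookup (?mk \<sigma> k) (\<pi>' ?n) = 0" by (simp add: mkW[OF s] e p)
    ultimately show ?thesis using phi[OF p'] phi[OF p] by simp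
  next
    case False
    have "\<not> (\<exists>\<pi>\<in>W ?n. lookup (?mk \<sigma> k) (\<pi> ?n) = 0)"
    proof
      assume "\<exists>\<pi>\<in>W ?n. lookup (?mk \<sigma> k) (\<pi> ?n) = 0"
      then obtain \<pi> where "\<pi> \<in> W ?n" "lookup k (\<sigma> (\<pi> ?n)) = 0" by (auto simp: mkW[OF s])
      then show False using False comp[OF s, of \<pi>] by auto
    qed
    with False show ?thesis unfolding \<phi>_def by (simp only: if_False)
  qed
  then have ginv: "g \<in> invariants ?n" unfolding invariants_lookup_iff g using gp by blast
  have gd: "deg_le d g"
    unfolding deg_le_def
  proof
    fix k assume "k \<in> keys g"
    then obtain \<pi> where p: "\<pi> \<in> W ?n" "?mk \<pi> k \<in> keys f" using phi_ex[of k] g by (auto simp: in_keys_iff)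
    have "mon_degree k = (\<Sum>i\<in>\<pi> ` keys (?mk \<pi> k). lookup k i)"
    proof (rule mon_degree_superset)
      show "keys k \<subseteq> \<pi> ` keys (?mk \<pi> k)"
      proof
        fix i assume i: "i \<in> keys k"
        obtain j where "i = \<pi> j" using permutes_surj[OF W_permutes[OF p(1)]] by (rule surjE)
        then show "i \<in> \<pi> ` keys (?mk \<pi> k)" using i by (auto simp: in_keys_iff mkW[OF p(1)])
      qed
    qed simp
    also have "\<dots> = mon_degree (?mk \<pi> k)"
      by (subst sum.reindex) (auto simp: mon_degree_def mkW[OF p(1)] intro!: inj_on_subset[OF pi_inj[OF p(1)]])
    finally show "mon_degree k \<le> d" using f(2) p(2) by (simp add: deg_le_def)
  qed
  have id: "(\<lambda>i. i) \<in> W ?n" using permutes_id[of "{1..?n}"] by (simp add: W_def id_def)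
  have gl: "lookup g k = lookup f k" if "lookup k ?n = 0" for k
  proof -
    have "?mk (\<lambda>i. i) k = k" by (rule poly_mapping_eqI) (simp add: mkW[OF id])
    then show ?thesis using phi[OF id, of k] that g by simp
  qed
  have ge: "eval_at x g = eval_at x f" if x: "x ?n = 0" for x
  proof -
    have "eval_at x p = (\<Sum>k\<in>{k \<in> keys p. lookup k ?n = 0}. lookup p k * mon x k)" for p
      unfolding eval_at_mon
    proof (rule sum.mono_neutral_right)
      show "\<forall>k\<in>keys p - {k \<in> keys p. lookup k ?n = 0}. lookup p k * mon x k = 0"
        using x by (auto simp: mon_def in_keys_iff)
    qed auto
    moreover have "{k \<in> keys g. lookup k ?n = 0} = {k \<in> keys f. lookup k ?n = 0}"
      using gl by (auto simp: in_keys_iff)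
    ultimately show ?thesis using gl by (auto intro!: sum.cong)
  qed
  show ?thesis by (rule that[OF ginv gd gl ge])
qed

text \<open>The form in which the hypotheses on r are used: denominators and differences of
  coordinates of \<rho> + \<mu> are such combinations up to sign. The case b = 0 is where r \<noteq>
  0 enters.\<close>

locale param =
  fixes r :: "'k::field_char_0"
  assumes nz: "a > 0 \<or> b > 0 \<Longrightarrow> of_nat a * r + of_nat b \<noteq> 0"
begin

lemma eval_class_prod_add_ones_nonzero: "eval_at (shifted n r (add_ones n \<kappa>)) (class_prod n) \<noteq> 0"
proof -
  have "shifted n r (add_ones n \<kappa>) j \<noteq> 0" if "j \<in> last_class n" for j
    using nz[of "n - j" "add_ones n \<kappa> j"] that by (auto simp: shifted_def add_ones_def last_class_def add.commute)
  then show ?thesis by (simp add: eval_class_prod)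
qed

text \<open>Induction on the number of variables and, inside it, on the degree. Restriction to z_n =
  0 vanishes by the case of fewer variables, so \<open>class_prod\<close> divides f; the translated
  quotient satisfies the same kind of conditions in lower degree.\<close>

lemma interpolation_unique:
  fixes f :: "'k mvpoly"
  assumes "f \<in> invariants n" "deg_le d f"
    and "\<And>\<mu>. \<mu> \<in> \<Lambda> n \<Longrightarrow> odd_size n \<mu> \<le> d \<Longrightarrow> eval_at (shifted n r \<mu>) f = 0"
  shows "f = 0"
  using assms
proof (induction n arbitrary: f d)
  case 0
  have "(\<lambda>_. 0) \<in> \<Lambda> 0" "odd_size 0 (\<lambda>_. 0) \<le> d" by (auto simp: \<Lambda>_def odd_size_def)
  then have z: "eval_at (shifted 0 r (\<lambda>_. 0)) f = 0" by (rule "0.prems"(3))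
  have "eval_at x f = 0" for x
    using z eval_at_cong[OF invariants_polys[OF "0.prems"(1)], of x "shifted 0 r (\<lambda>_. 0)"] by simp
  then show ?case by (rule eval_at_eq_0_imp)
next
  case (Suc m)
  let ?n = "Suc m"
  show ?case
    using Suc.prems
  proof (induction d arbitrary: f rule: less_induct)
    case (less d)
    have "restrict_last m r f = 0"
    proof (rule Suc.IH[of _ d])
      show "restrict_last m r f \<in> invariants m" by (rule restrict_last_invariants[OF less.prems(1)])
      show "deg_le d (restrict_last m r f)" by (rule deg_le_restrict_last[OF less.prems(2)])
      fix \<mu> assume m: "\<mu> \<in> \<Lambda> m" "odd_size m \<mu> \<le> d"
      then have m': "\<mu> \<in> \<Lambda> ?n" "\<mu> ?n = 0" using Lambda_Suc_0[of \<mu> m] by auto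
      have "eval_at (shifted m r \<mu>) (restrict_last m r f) = eval_at (shifted ?n r \<mu>) f"
        unfolding eval_restrict_last
      proof (rule eval_at_cong[OF invariants_polys[OF less.prems(1)]])
        fix i assume "i \<in> {1..?n}"
        then have "i = ?n \<or> i \<in> {1..m}" by auto
        then show "(if i = ?n then 0 else shifted m r \<mu> i + r) = shifted ?n r \<mu> i"
          using m'(2) shifted_Suc[of i m r \<mu>] by (auto simp: shifted_def)
      qed
      also have "\<dots> = 0" using less.prems(3)[OF m'(1)] m(2) odd_size_Suc_0[of \<mu> m, OF m'(2)] by simp
      finally show "eval_at (shifted m r \<mu>) (restrict_last m r f) = 0" .
    qed
    then have "eval_at x f = 0" if "x ?n = 0" for x
    proof -
      assume z: "restrict_last m r f = 0"
      have "(\<lambda>i. if i = ?n then 0 else x i - r + r) = x" using that by auto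
      then show ?thesis using eval_restrict_last[of "\<lambda>i. x i - r" m r f] z by simp
    qed
    then obtain h where h: "f = class_prod ?n * h" using class_prod_dvd[OF less.prems(1)] by (metis dvdE)
    show ?case
    proof (rule ccontr)
      assume "f \<noteq> 0"
      then have h0: "h \<noteq> 0" using h by auto
      have hinv: "h \<in> invariants ?n" by (rule invariants_quot[OF less.prems(1) class_prod_invariants class_prod_nonzero h])
      let ?N = "card (last_class ?n)"
      have N: "?N \<le> d" "deg_le (d - ?N) h" "?N > 0"
        using deg_le_class_prod_quot[of d ?n h] h less.prems(2) h0 card_last_class_pos[of ?n] by auto
      \<comment> \<open>The translation by 1 moves the points with positive last entry back to all
        points \<rho> + \<mu>; \<open>class_prod\<close> is non-zero at the former and can be
        cancelled.\<close>
      have "subst (\<lambda>i. Var i + Const 1) h = 0"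
      proof (rule less.IH[of "d - ?N"])
        show "d - ?N < d" using N by simp
        show "subst (\<lambda>i. Var i + Const 1) h \<in> invariants ?n" by (rule invariants_shift[OF hinv])
        show "deg_le (d - ?N) (subst (\<lambda>i. Var i + Const 1) h)" by (rule deg_le_shift[OF N(2)])
        fix \<mu> assume m: "\<mu> \<in> \<Lambda> ?n" "odd_size ?n \<mu> \<le> d - ?N"
        have "eval_at (shifted ?n r (add_ones ?n \<mu>)) f = 0"
          using less.prems(3)[OF Lambda_add_ones[OF m(1)]] m(2) N by (simp add: odd_size_add_ones)
        then have "eval_at (shifted ?n r (add_ones ?n \<mu>)) h = 0"
          using eval_class_prod_add_ones_nonzero[of ?n \<mu>] by (simp add: h)
        moreover have "eval_at (shifted ?n r \<mu>) (subst (\<lambda>i. Var i + Const 1) h) = eval_at (shifted ?n r (add_ones ?n \<mu>)) h"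
          unfolding eval_at_subst
          by (rule eval_at_cong[OF invariants_polys[OF hinv]]) (simp add: shifted_add_ones)
        ultimately show "eval_at (shifted ?n r \<mu>) (subst (\<lambda>i. Var i + Const 1) h) = 0" by simp
      qed
      then have "eval_at x (subst (\<lambda>i. Var i + Const 1) h) = 0" for x by simp
      then have "eval_at (\<lambda>i. x i + 1) h = 0" for x by (simp add: eval_at_subst)
      from this[of "\<lambda>i. _ i - 1"] have "eval_at x h = 0" for x by simp
      then show False using h0 eval_at_eq_0_imp by blast
    qed
  qed
qed

end

section \<open>Explicit values and existence of the interpolation polynomials\<close>

definition odd_pairs :: "nat \<Rightarrow> (nat \<times> nat) set" where
  "odd_pairs n = {(i, j). 1 \<le> i \<and> i < j \<and> j \<le> n \<and> odd (j - i)}"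

definition even_pairs :: "nat \<Rightarrow> (nat \<times> nat) set" where
  "even_pairs n = {(i, j). 1 \<le> i \<and> i < j \<and> j \<le> n \<and> even (j - i)}"

lemma finite_pairs [simp]: "finite (odd_pairs n)" "finite (even_pairs n)"
  by (rule finite_subset[of _ "{1..n} \<times> {1..n}"]; auto simp: odd_pairs_def even_pairs_def)+

text \<open>The value of the interpolation polynomial of \<open>\<mu>\<close> at its own point \<open>\<rho> + \<mu>\<close>.\<close>

definition R_norm :: "nat \<Rightarrow> 'k::field_char_0 \<Rightarrow> (nat \<Rightarrow> nat) \<Rightarrow> 'k" where
  "R_norm n r \<mu> = (\<Prod>(p, q)\<in>odd_pairs n. pochhammer (of_nat (q - p - 1) * r + 1) (\<mu> p - \<mu> q)) *
     (\<Prod>p\<in>last_class n. pochhammer (of_nat (n - p) * r + 1) (\<mu> p)) /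
     (\<Prod>(p, q)\<in>even_pairs n. pochhammer (of_nat (q - p) * r + 1) (\<mu> p - \<mu> q))"

text \<open>Entry differences stay fixed, so only the factors of the last class change. The new
  factor is the one that multiplication by \<open>class_prod\<close> produces in
  \<open>interpolant_add_ones\<close>.\<close>

lemma R_norm_add_ones:
  "R_norm n r (add_ones n \<kappa>) = R_norm n r \<kappa> * eval_at (shifted n r (add_ones n \<kappa>)) (class_prod n)"
proof -
  have d: "add_ones n \<kappa> p - add_ones n \<kappa> q = \<kappa> p - \<kappa> q" if "p \<in> {1..n}" "q \<in> {1..n}" for p q
    using that by (simp add: add_ones_def)
  have 1: "(\<Prod>(p, q)\<in>odd_pairs n. pochhammer (of_nat (q - p - 1) * r + 1) (add_ones n \<kappa> p - add_ones n \<kappa> q))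
      = (\<Prod>(p, q)\<in>odd_pairs n. pochhammer (of_nat (q - p - 1) * r + 1) (\<kappa> p - \<kappa> q))"
    by (rule prod.cong) (auto simp: odd_pairs_def d)
  have 2: "(\<Prod>(p, q)\<in>even_pairs n. pochhammer (of_nat (q - p) * r + 1) (add_ones n \<kappa> p - add_ones n \<kappa> q))
      = (\<Prod>(p, q)\<in>even_pairs n. pochhammer (of_nat (q - p) * r + 1) (\<kappa> p - \<kappa> q))"
    by (rule prod.cong) (auto simp: even_pairs_def d)
  have 3: "(\<Prod>p\<in>last_class n. pochhammer (of_nat (n - p) * r + 1) (add_ones n \<kappa> p))
      = (\<Prod>p\<in>last_class n. pochhammer (of_nat (n - p) * r + 1) (\<kappa> p) * shifted n r (add_ones n \<kappa>) p)"
    by (rule prod.cong) (auto simp: last_class_def add_ones_def shifted_def pochhammer_Suc algebra_simps)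
  show ?thesis unfolding R_norm_def 1 2 3 by (simp add: prod.distrib eval_class_prod)
qed

context param
begin

lemma poch_nz: "pochhammer (of_nat a * r + 1) k \<noteq> 0"
proof
  assume "pochhammer (of_nat a * r + 1) k = 0"
  then obtain i where "of_nat a * r + 1 = - of_nat i" by (auto simp: pochhammer_eq_0_iff)
  then have "of_nat a * r + of_nat (Suc i) = 0" by (simp add: add_eq_0_iff2 algebra_simps)
  then show False using nz[of a "Suc i"] by simp
qed

lemma R_norm_nonzero: "R_norm n r \<mu> \<noteq> 0"
  by (auto simp: R_norm_def poch_nz)

text \<open>Since the new entry is 0, the new pairs of odd distance reproduce the single-index
  factors of m, while those of even distance cancel the single-index factors of m + 1.\<close>

lemma R_norm_Suc_0:
  assumes "\<mu> \<in> \<Lambda> m"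
  shows "R_norm (Suc m) r \<mu> = R_norm m r \<mu>"
proof -
  have z: "\<mu> (Suc m) = 0" using assms Lambda_Suc_0[of \<mu> m] by simp
  have O: "odd_pairs (Suc m) = odd_pairs m \<union> (\<lambda>p. (p, Suc m)) ` last_class m"
    by (auto simp: odd_pairs_def last_class_def le_Suc_eq)
  have E: "even_pairs (Suc m) = even_pairs m \<union> (\<lambda>p. (p, Suc m)) ` (last_class (Suc m) - {Suc m})"
    by (auto simp: even_pairs_def last_class_def le_Suc_eq)
  have inj: "inj_on (\<lambda>p. (p, Suc m)) A" for A by (auto simp: inj_on_def)
  have 1: "(\<Prod>(p, q)\<in>odd_pairs (Suc m). pochhammer (of_nat (q - p - 1) * r + 1) (\<mu> p - \<mu> q))
      = (\<Prod>(p, q)\<in>odd_pairs m. pochhammer (of_nat (q - p - 1) * r + 1) (\<mu> p - \<mu> q))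
        * (\<Prod>p\<in>last_class m. pochhammer (of_nat (m - p) * r + 1) (\<mu> p))"
    unfolding O by (subst prod.union_disjoint, simp, simp, force simp: odd_pairs_def) (simp add: prod.reindex[OF inj] z)
  have 2: "(\<Prod>(p, q)\<in>even_pairs (Suc m). pochhammer (of_nat (q - p) * r + 1) (\<mu> p - \<mu> q))
      = (\<Prod>(p, q)\<in>even_pairs m. pochhammer (of_nat (q - p) * r + 1) (\<mu> p - \<mu> q))
        * (\<Prod>p\<in>last_class (Suc m) - {Suc m}. pochhammer (of_nat (Suc m - p) * r + 1) (\<mu> p))"
    unfolding E by (subst prod.union_disjoint, simp, simp, force simp: even_pairs_def) (simp add: prod.reindex[OF inj] z)
  have 3: "(\<Prod>p\<in>last_class (Suc m). pochhammer (of_nat (Suc m - p) * r + 1) (\<mu> p))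
      = (\<Prod>p\<in>last_class (Suc m) - {Suc m}. pochhammer (of_nat (Suc m - p) * r + 1) (\<mu> p))"
    by (subst prod.remove[of _ "Suc m"]) (auto simp: last_class_def z)
  have "(\<Prod>p\<in>last_class (Suc m) - {Suc m}. pochhammer (of_nat (Suc m - p) * r + 1) (\<mu> p)) \<noteq> 0"
    by (simp add: poch_nz)
  then show ?thesis unfolding R_norm_def 1 2 3 by simp
qed

text \<open>Strengthens the vanishing and normalisation by the value at the own point. This makes
  the existence induction carry the explicit value along, and with it the non-vanishing needed for
  interpolation.\<close>

definition interpolant :: "nat \<Rightarrow> (nat \<Rightarrow> nat) \<Rightarrow> 'k mvpoly \<Rightarrow> bool" where
  "interpolant n \<mu> p \<longleftrightarrow> p \<in> invariants n \<and> deg_le (odd_size n \<mu>) p \<and>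
     (\<forall>\<kappa>\<in>\<Lambda> n. odd_size n \<kappa> \<le> odd_size n \<mu> \<and> \<kappa> \<noteq> \<mu> \<longrightarrow> eval_at (shifted n r \<kappa>) p = 0) \<and>
     lookup p (alt_mon n \<mu>) = 1 \<and> eval_at (shifted n r \<mu>) p = R_norm n r \<mu>"

text \<open>Newton interpolation, one size at a time: interpolants of size D vanish at all other
  points of size at most D, so correcting the values of size D leaves the smaller points
  untouched.\<close>

lemma interpolate:
  assumes "\<And>\<kappa>. \<kappa> \<in> \<Lambda> n \<Longrightarrow> odd_size n \<kappa> < D \<Longrightarrow> \<exists>p. interpolant n \<kappa> p"
  shows "\<exists>h. h \<in> invariants n \<and> deg_le (D - 1) h \<and>
    (\<forall>\<kappa>\<in>\<Lambda> n. odd_size n \<kappa> < D \<longrightarrow> eval_at (shifted n r \<kappa>) h = v \<kappa>)"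
  using assms
proof (induction D)
  case 0
  show ?case using invariants_Const[of 0 n] deg_le_Const[of 0 0] by (intro exI[of _ 0]) auto
next
  case (Suc D)
  then obtain h where h: "h \<in> invariants n" "deg_le (D - 1) h"
    "\<And>\<kappa>. \<kappa> \<in> \<Lambda> n \<Longrightarrow> odd_size n \<kappa> < D \<Longrightarrow> eval_at (shifted n r \<kappa>) h = v \<kappa>"
    by (meson less_SucI)
  define S where "S = {\<kappa> \<in> \<Lambda> n. odd_size n \<kappa> = D}"
  have fS: "finite S" by (rule finite_subset[OF _ finite_Lambda[of n D]]) (auto simp: S_def)
  have "\<forall>\<kappa>\<in>S. \<exists>p. interpolant n \<kappa> p" using Suc.prems by (auto simp: S_def)
  then obtain P where P: "\<And>\<kappa>. \<kappa> \<in> S \<Longrightarrow> interpolant n \<kappa> (P \<kappa>)" by metis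
  define c where "c \<kappa> = (v \<kappa> - eval_at (shifted n r \<kappa>) h) / R_norm n r \<kappa>" for \<kappa>
  define h' where "h' = h + (\<Sum>\<kappa>\<in>S. Const (c \<kappa>) * P \<kappa>)"
  have "h' \<in> invariants n"
    unfolding h'_def using h(1) P
    by (intro invariants_add invariants_sum invariants_mult invariants_Const) (auto simp: interpolant_def)
  moreover have "deg_le (Suc D - 1) h'"
    unfolding h'_def
  proof (intro deg_le_add deg_le_sum)
    show "deg_le (Suc D - 1) h" using h(2) by (rule deg_le_mono) simp
    fix \<kappa> assume "\<kappa> \<in> S"
    then have "deg_le D (P \<kappa>)" using P by (auto simp: interpolant_def S_def)
    from deg_le_mult[OF deg_le_Const[of 0] this]
    show "deg_le (Suc D - 1) (Const (c \<kappa>) * P \<kappa>)" by simp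
  qed
  moreover have "eval_at (shifted n r \<kappa>) h' = v \<kappa>" if k: "\<kappa> \<in> \<Lambda> n" "odd_size n \<kappa> < Suc D" for \<kappa>
  proof -
    have "eval_at (shifted n r \<kappa>) (P \<kappa>') = (if \<kappa>' = \<kappa> then R_norm n r \<kappa> else 0)" if "\<kappa>' \<in> S" for \<kappa>'
      using P[OF that] k that by (auto simp: interpolant_def S_def)
    then have "eval_at (shifted n r \<kappa>) h' = eval_at (shifted n r \<kappa>) h + (\<Sum>\<kappa>'\<in>S. if \<kappa>' = \<kappa> then c \<kappa> * R_norm n r \<kappa> else 0)"
      unfolding h'_def by (simp, intro sum.cong) auto
    also have "\<dots> = v \<kappa>"
    proof (cases "odd_size n \<kappa> = D")
      case True
      then show ?thesis using k fS R_norm_nonzero[of n \<kappa>] by (simp add: S_def c_def)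
    next
      case False
      then show ?thesis using k fS h(3)[of \<kappa>] by (simp add: S_def)
    qed
    finally show ?thesis .
  qed
  ultimately show ?case by blast
qed

text \<open>The factor \<open>class_prod\<close> handles points with last entry 0; at all others the
  translation by -1 leads back to the conditions on p.\<close>

lemma interpolant_add_ones:
  assumes k: "\<kappa> \<in> \<Lambda> n" and n: "n \<ge> 1" and p: "interpolant n \<kappa> p"
  shows "interpolant n (add_ones n \<kappa>) (class_prod n * subst (\<lambda>i. Var i + Const (- 1)) p)"
  unfolding interpolant_def
proof (intro conjI ballI impI)
  have pi: "p \<in> invariants n" and pd: "deg_le (odd_size n \<kappa>) p" and pl: "lookup p (alt_mon n \<kappa>) = 1"
    and pv: "\<And>\<mu>. \<mu> \<in> \<Lambda> n \<Longrightarrow> odd_size n \<mu> \<le> odd_size n \<kappa> \<Longrightarrow> \<mu> \<noteq> \<kappa> \<Longrightarrow> eval_at (shifted n r \<mu>) p = 0"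
    and pe: "eval_at (shifted n r \<kappa>) p = R_norm n r \<kappa>"
    using p by (auto simp: interpolant_def)
  have shback: "eval_at (shifted n r (add_ones n \<kappa>')) (subst (\<lambda>i. Var i + Const (- 1)) p) = eval_at (shifted n r \<kappa>') p" for \<kappa>'
    by (rule eval_shift_back[OF invariants_polys[OF pi]])
  let ?q = "subst (\<lambda>i. Var i + Const (- 1)) p"
  show "class_prod n * ?q \<in> invariants n" by (intro invariants_mult class_prod_invariants invariants_shift pi)
  show "deg_le (odd_size n (add_ones n \<kappa>)) (class_prod n * ?q)"
    unfolding odd_size_add_ones add.commute[of "odd_size n \<kappa>"]
    by (rule deg_le_mult[OF deg_le_class_prod deg_le_shift[OF pd]])
  show "lookup (class_prod n * ?q) (alt_mon n (add_ones n \<kappa>)) = 1"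
    unfolding alt_mon_add_ones[OF k] class_prod_single lookup_single_mult
    using lookup_shift_top[OF pd] alt_props[OF k] pl by simp
  show "eval_at (shifted n r (add_ones n \<kappa>)) (class_prod n * ?q) = R_norm n r (add_ones n \<kappa>)"
    by (simp only: eval_at_simps R_norm_add_ones shback pe mult.commute)
  fix \<mu> assume m: "\<mu> \<in> \<Lambda> n" "odd_size n \<mu> \<le> odd_size n (add_ones n \<kappa>) \<and> \<mu> \<noteq> add_ones n \<kappa>"
  show "eval_at (shifted n r \<mu>) (class_prod n * ?q) = 0"
  proof (cases "\<mu> n = 0")
    case True
    then have "eval_at (shifted n r \<mu>) (class_prod n) = 0"
      using n by (auto simp: eval_class_prod shifted_def last_class_def intro!: bexI[of _ n])
    then show ?thesis by simp
  next
    case False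
    then obtain \<mu>' where m': "\<mu>' \<in> \<Lambda> n" "\<mu> = add_ones n \<mu>'" using Lambda_dec[OF m(1)] by auto
    then have "eval_at (shifted n r \<mu>') p = 0" using m(2) by (intro pv) (auto simp: odd_size_add_ones)
    then show ?thesis by (simp add: m'(2) shback)
  qed
qed

lemma lookup_mult_single_0:
  fixes q :: "'k mvpoly"
  assumes "lookup a i > 0" "lookup m i = 0"
  shows "lookup (single a 1 * q) m = 0"
proof (rule ccontr)
  assume "lookup (single a 1 * q) m \<noteq> 0"
  then have "m \<in> keys (single a 1 * q)" by (simp add: in_keys_iff)
  then obtain u v where "m = u + v" "u \<in> keys (single a (1::'k))" using keys_mult[of "single a 1" q] by blast
  then show False using assms by (auto simp: lookup_add)
qed

text \<open>A positive last entry is removed by \<open>interpolant_add_ones\<close>. For last entry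
  0, the interpolant in m variables is translated and lifted to g. This is right at points ending in
  0, and a multiple q of \<open>class_prod\<close> corrects it elsewhere without affecting those
  points.\<close>

lemma interpolant_exists: "\<mu> \<in> \<Lambda> n \<Longrightarrow> \<exists>p. interpolant n \<mu> p"
proof (induction n arbitrary: \<mu>)
  case 0
  have "\<mu> = (\<lambda>_. 0)" using "0.prems" by (auto simp: \<Lambda>_def)
  moreover have "alt_mon 0 (\<lambda>_. 0) = 0" by (simp add: alt_mon_def)
  moreover have "R_norm 0 r (\<lambda>_. 0) = 1" by (simp add: R_norm_def odd_pairs_def even_pairs_def last_class_def)
  moreover have "\<kappa> = (\<lambda>_. 0)" if "\<kappa> \<in> \<Lambda> 0" for \<kappa> using that by (auto simp: \<Lambda>_def)
  ultimately have "interpolant 0 \<mu> 1"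
    using invariants_Const[of 1 0] deg_le_Const[of "odd_size 0 (\<lambda>_. 0)" "1 :: 'k"] by (auto simp: interpolant_def)
  then show ?case by blast
next
  case (Suc m)
  let ?n = "Suc m"
  show ?case
    using Suc.prems
  proof (induction "odd_size ?n \<mu>" arbitrary: \<mu> rule: less_induct)
    case less
    show ?case
    proof (cases "\<mu> ?n = 0")
      case False
      then obtain \<kappa> where k: "\<kappa> \<in> \<Lambda> ?n" "\<mu> = add_ones ?n \<kappa>" using Lambda_dec[OF less.prems] by auto
      have "odd_size ?n \<kappa> < odd_size ?n \<mu>" using card_last_class_pos[of ?n] by (simp add: k odd_size_add_ones)
      then obtain p where "interpolant ?n \<kappa> p" using less.hyps k by blast
      then have "interpolant ?n (add_ones ?n \<kappa>) (class_prod ?n * subst (\<lambda>i. Var i + Const (- 1)) p)"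
        by (intro interpolant_add_ones k(1)) simp_all
      then show ?thesis unfolding k(2) by blast
    next
      case z: True
      have mm: "\<mu> \<in> \<Lambda> m" using less.prems z Lambda_Suc_0[of \<mu> m] by simp
      obtain p where p: "interpolant m \<mu> p" using Suc.IH[OF mm] by blast
      have pi: "p \<in> invariants m" and pd: "deg_le (odd_size m \<mu>) p" and pl: "lookup p (alt_mon m \<mu>) = 1"
        and pv: "\<And>\<kappa>. \<kappa> \<in> \<Lambda> m \<Longrightarrow> odd_size m \<kappa> \<le> odd_size m \<mu> \<Longrightarrow> \<kappa> \<noteq> \<mu> \<Longrightarrow> eval_at (shifted m r \<kappa>) p = 0"
        and pe: "eval_at (shifted m r \<mu>) p = R_norm m r \<mu>"
        using p by (auto simp: interpolant_def)
      let ?d = "odd_size m \<mu>" and ?N = "card (last_class ?n)"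
      define f where "f = subst (\<lambda>i. Var i + Const (- r)) p"
      have f: "f \<in> invariants m" "deg_le ?d f" unfolding f_def by (rule invariants_shift[OF pi], rule deg_le_shift[OF pd])
      have fl: "lookup f (alt_mon m \<mu>) = 1"
        using lookup_shift_top[OF pd] alt_props[OF mm] pl by (simp add: f_def)
      have fe: "eval_at (shifted ?n r \<kappa>) f = eval_at (shifted m r \<kappa>) p" for \<kappa>
        unfolding f_def eval_at_subst
        by (rule eval_at_cong[OF invariants_polys[OF pi]]) (simp add: shifted_Suc)
      obtain g where g: "g \<in> invariants ?n" "deg_le ?d g" "\<And>k. lookup k ?n = 0 \<Longrightarrow> lookup g k = lookup f k"
        "\<And>x. x ?n = 0 \<Longrightarrow> eval_at x g = eval_at x f"
        using lift_invariant[OF f] by blast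
      have ge: "eval_at (shifted ?n r \<kappa>) g = eval_at (shifted m r \<kappa>) p" if "\<kappa> ?n = 0" for \<kappa>
        using g(4)[of "shifted ?n r \<kappa>"] that fe by (simp add: shifted_def)
      have os: "odd_size ?n \<mu> = ?d" by (rule odd_size_Suc_0[of \<mu> m, OF z])
      \<comment> \<open>Sizes below \<open>D\<close> are those for which adding ones stays within
        size d; the difference truncates to 0 if there are none.\<close>
      define D where "D = Suc ?d - ?N"
      \<comment> \<open>The values forcing \<open>class_prod\<close> times the translate of h to
        agree with g at points with positive last entry.\<close>
      define v where "v \<kappa> = eval_at (shifted ?n r (add_ones ?n \<kappa>)) g / eval_at (shifted ?n r (add_ones ?n \<kappa>)) (class_prod ?n)" for \<kappa>
      have N: "?N > 0" using card_last_class_pos[of ?n] by simp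
      have "\<exists>h. h \<in> invariants ?n \<and> deg_le (D - 1) h \<and>
          (\<forall>\<kappa>\<in>\<Lambda> ?n. odd_size ?n \<kappa> < D \<longrightarrow> eval_at (shifted ?n r \<kappa>) h = v \<kappa>)"
      proof (rule interpolate)
        fix \<kappa> assume "\<kappa> \<in> \<Lambda> ?n" "odd_size ?n \<kappa> < D"
        then show "\<exists>p. interpolant ?n \<kappa> p" using N os by (intro less.hyps) (auto simp: D_def)
      qed
      then obtain h where h: "h \<in> invariants ?n" "deg_le (D - 1) h"
        "\<And>\<kappa>. \<kappa> \<in> \<Lambda> ?n \<Longrightarrow> odd_size ?n \<kappa> < D \<Longrightarrow> eval_at (shifted ?n r \<kappa>) h = v \<kappa>" by blast
      \<comment> \<open>If \<open>?N\<close> exceeds d, the product would break the degree bound,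
        but then no point with positive last entry needs correction.\<close>
      define q where "q = (if ?N \<le> ?d then class_prod ?n * subst (\<lambda>i. Var i + Const (- 1)) h else 0)"
      have q: "q \<in> invariants ?n" "deg_le ?d q"
      proof -
        show "q \<in> invariants ?n"
          using invariants_Const[of "0 :: 'k" ?n] by (simp add: q_def invariants_mult class_prod_invariants invariants_shift h(1))
        show "deg_le ?d q"
        proof (cases "?N \<le> ?d")
          case True
          then show ?thesis
            using deg_le_mult[OF deg_le_class_prod[of ?n] deg_le_shift[OF h(2), of "- 1"]] by (simp add: q_def D_def)
        qed (use deg_le_Const[of ?d "0 :: 'k"] in \<open>simp add: q_def\<close>)
      qed
      have q0: "eval_at (shifted ?n r \<kappa>) q = 0" if "\<kappa> ?n = 0" for \<kappa>
      proof -
        have "eval_at (shifted ?n r \<kappa>) (class_prod ?n) = 0"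
          using that by (auto simp: eval_class_prod shifted_def last_class_def intro!: bexI[of _ ?n])
        then show ?thesis by (simp add: q_def)
      qed
      have qi: "eval_at (shifted ?n r (add_ones ?n \<kappa>)) q = eval_at (shifted ?n r (add_ones ?n \<kappa>)) g"
        if k: "\<kappa> \<in> \<Lambda> ?n" "odd_size ?n (add_ones ?n \<kappa>) \<le> ?d" for \<kappa>
      proof -
        have "?N \<le> ?d" "odd_size ?n \<kappa> < D" using k(2) by (auto simp: odd_size_add_ones D_def)
        then show ?thesis
          using h(3)[OF k(1)] eval_class_prod_add_ones_nonzero[of ?n \<kappa>] eval_shift_back[OF invariants_polys[OF h(1)], of r \<kappa>]
          by (simp add: q_def v_def)
      qed
      \<comment> \<open>Every monomial of q contains the last variable, whereas its exponent in the
        normalising monomial is the last entry of \<mu>, which is 0.\<close>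
      have ql: "lookup q (alt_mon ?n \<mu>) = 0"
      proof -
        have "lookup (alt_mon ?n \<mu>) ?n = 0" using z by (simp add: lookup_alt_mon alt_def)
        moreover have "lookup (\<Sum>j\<in>last_class ?n. single j 1) ?n > (0 :: nat)"
          by (simp add: lookup_sum lookup_single when_def) (simp add: last_class_def)
        ultimately show ?thesis unfolding q_def class_prod_single by (simp add: lookup_mult_single_0)
      qed
      have al: "lookup (alt_mon m \<mu>) ?n = 0" by (simp add: lookup_alt_mon)
      have "interpolant ?n \<mu> (g - q)"
        unfolding interpolant_def os
      proof (intro conjI ballI impI)
        show "g - q \<in> invariants ?n" by (rule invariants_minus[OF g(1) q(1)])
        show "deg_le ?d (g - q)" by (rule deg_le_minus[OF g(2) q(2)])
        show "lookup (g - q) (alt_mon ?n \<mu>) = 1"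
          using ql fl g(3)[OF al] by (simp add: lookup_minus alt_mon_Suc_0[of \<mu> m, OF z])
        show "eval_at (shifted ?n r \<mu>) (g - q) = R_norm ?n r \<mu>"
          using ge[of \<mu>, OF z] q0[of \<mu>, OF z] pe R_norm_Suc_0[OF mm] by simp
        fix \<kappa> assume k: "\<kappa> \<in> \<Lambda> ?n" "odd_size ?n \<kappa> \<le> ?d \<and> \<kappa> \<noteq> \<mu>"
        show "eval_at (shifted ?n r \<kappa>) (g - q) = 0"
        proof (cases "\<kappa> ?n = 0")
          case True
          then have "\<kappa> \<in> \<Lambda> m" using k Lambda_Suc_0[of \<kappa> m] by simp
          then have "eval_at (shifted m r \<kappa>) p = 0"
            using k odd_size_Suc_0[of \<kappa> m, OF True] by (intro pv) auto
          then show ?thesis using ge[of \<kappa>, OF True] q0[of \<kappa>, OF True] by simp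
        next
          case False
          then obtain \<kappa>' where "\<kappa>' \<in> \<Lambda> ?n" "\<kappa> = add_ones ?n \<kappa>'" using Lambda_dec[OF k(1)] by auto
          then show ?thesis using qi[of \<kappa>'] k by simp
        qed
      qed
      then show ?thesis by blast
    qed
  qed
qed

text \<open>By \<open>interpolation_unique\<close> any candidate is a scalar multiple of the
  constructed interpolant, and the normalised coefficient makes the scalar 1.\<close>

lemma interpolant_R:
  assumes m: "\<mu> \<in> \<Lambda> n"
  shows "interpolant n \<mu> (R n r \<mu>)"
proof -
  obtain p where p: "interpolant n \<mu> p" using interpolant_exists[OF m] by blast
  have isR: "is_R n r \<mu> p"
    unfolding is_R_def
  proof (intro conjI)
    have "alt_mon n \<mu> \<in> keys p" using p by (simp add: interpolant_def in_keys_iff)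
    then have "mon_degree (alt_mon n \<mu>) \<le> total_degree p"
      unfolding total_degree_def by (intro Max_ge) auto
    then show "total_degree p = odd_size n \<mu>"
      using p alt_props[OF m] by (auto simp: interpolant_def total_degree_le_iff[symmetric])
  qed (use p in \<open>auto simp: interpolant_def\<close>)
  have "p' = p" if "is_R n r \<mu> p'" for p'
  proof -
    define c where "c = eval_at (shifted n r \<mu>) p' / R_norm n r \<mu>"
    have "p' - Const c * p = 0"
    proof (rule interpolation_unique[of _ n "odd_size n \<mu>"])
      show "p' - Const c * p \<in> invariants n"
        using that p by (intro invariants_minus invariants_mult invariants_Const) (auto simp: is_R_def interpolant_def)
      have "deg_le (odd_size n \<mu>) p'" using that by (simp add: is_R_def total_degree_le_iff[symmetric])
      moreover have "deg_le (odd_size n \<mu>) (Const c * p)"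
        using deg_le_mult[OF deg_le_Const[of 0 c], of "odd_size n \<mu>" p] p by (simp add: interpolant_def)
      ultimately show "deg_le (odd_size n \<mu>) (p' - Const c * p)" by (rule deg_le_minus)
      fix \<kappa> assume "\<kappa> \<in> \<Lambda> n" "odd_size n \<kappa> \<le> odd_size n \<mu>"
      then show "eval_at (shifted n r \<kappa>) (p' - Const c * p) = 0"
        using that p R_norm_nonzero[of n \<mu>] by (cases "\<kappa> = \<mu>") (auto simp: is_R_def interpolant_def c_def)
    qed
    then have e: "p' = Const c * p" by simp
    have "lookup (Const c * p) (0 + alt_mon n \<mu>) = c * lookup p (alt_mon n \<mu>)"
    proof -
      have "Const c * p = (\<Sum>m\<in>keys p. single m (c * lookup p m))"
        by (subst poly_mapping_sum_single[of p]) (simp add: sum_distrib_left mult_single Const_def)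
      then show ?thesis by (simp add: lookup_sum lookup_single when_def in_keys_iff)
    qed
    then have "c = 1" using that p by (simp add: is_R_def interpolant_def e)
    then show ?thesis using e by simp
  qed
  then have "R n r \<mu> = p" unfolding R_def by (rule the_equality[of "is_R n r \<mu>", OF isR])
  then show ?thesis using p by simp
qed

end

section \<open>Lowering and raising operators\<close>

text \<open>The moved variable in the class of n. It vanishes when a step would lower a last entry
  equal to 0, a case no difference of neighbours can detect.\<close>

definition step_weight :: "nat \<Rightarrow> nat \<times> nat \<Rightarrow> 'k::field_char_0 mvpoly" where
  "step_weight n s = (if odd n then Var (fst s) else Var (snd s))"

definition lower :: "nat \<Rightarrow> (nat \<Rightarrow> nat) \<Rightarrow> nat \<times> nat \<Rightarrow> nat \<Rightarrow> nat" where
  "lower n \<mu> s p = \<mu> p - step_vec n s p"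

definition down_steps :: "nat \<Rightarrow> (nat \<Rightarrow> nat) \<Rightarrow> (nat \<times> nat) set" where
  "down_steps n \<mu> = {s \<in> steps n. (\<forall>p. step_vec n s p \<le> \<mu> p) \<and> lower n \<mu> s \<in> \<Lambda> n}"

lemma finite_down_steps [simp]: "finite (down_steps n \<mu>)"
  by (rule finite_subset[of _ "steps n"]) (auto simp: down_steps_def)

lemma step_weight_polys: "s \<in> steps n \<Longrightarrow> step_weight n s \<in> polys n"
proof -
  assume s: "s \<in> steps n"
  show ?thesis
  proof (cases "odd n")
    case True
    then show ?thesis using s by (auto simp: step_weight_def odd_idx_def intro!: polys_Var)
  next
    case False
    then have "snd s \<in> {1..n}" using s by (auto simp: even_idx_def le_Suc_eq)
    then show ?thesis using False polys_Var by (auto simp: step_weight_def)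
  qed
qed

lemma step_vec_cases:
  assumes "s \<in> steps n"
  shows "step_vec n s p = (if p = fst s \<or> p = snd s \<and> p \<le> n then 1 else 0)"
  using assms by (auto simp: step_vec_def odd_idx_def even_idx_def)

lemma step_vec_range:
  assumes "s \<in> steps n" "step_vec n s p = 1"
  shows "1 \<le> p" "p \<le> n"
proof -
  have "fst s \<in> {1..n}" "1 \<le> snd s" using assms(1) by (auto simp: odd_idx_def even_idx_def)
  moreover have "p = fst s \<or> p = snd s \<and> p \<le> n"
    using assms(2) unfolding step_vec_cases[OF assms(1)] by (simp split: if_splits)
  ultimately show "1 \<le> p" "p \<le> n" by auto
qed

lemma step_vec_le_1: "s \<in> steps n \<Longrightarrow> step_vec n s p \<le> 1"
  by (simp add: step_vec_cases)

lemma step_vec_three: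
  assumes "s \<in> steps n" "step_vec n s p = 1" "step_vec n s (Suc p) = 1"
  shows "step_vec n s (Suc (Suc p)) = 0"
proof -
  have *: "step_vec n s q = 1 \<Longrightarrow> q = fst s \<or> q = snd s" for q
    unfolding step_vec_cases[OF assms(1)] by (auto split: if_splits)
  then have "step_vec n s (Suc (Suc p)) \<noteq> 1"
    using *[OF assms(2)] *[OF assms(3)] *[of "Suc (Suc p)"] by linarith
  then show ?thesis using step_vec_le_1[OF assms(1), of "Suc (Suc p)"] by simp
qed

lemma Lambda_adjacent:
  assumes "\<And>p. 1 \<le> p \<Longrightarrow> p < n \<Longrightarrow> \<nu> (Suc p) \<le> \<nu> p" "\<And>p. p \<notin> {1..n} \<Longrightarrow> \<nu> p = 0"
  shows "\<nu> \<in> \<Lambda> n"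
proof -
  have "\<nu> j \<le> \<nu> i" if "1 \<le> i" "i \<le> j" "j \<le> n" for i j
    using that(2,1,3)
  proof (induction j rule: dec_induct)
    case (step j)
    then have "\<nu> (Suc j) \<le> \<nu> j" by (intro assms(1)) auto
    then show ?case using step by auto
  qed simp
  then show ?thesis using assms(2) by (auto simp: \<Lambda>_def)
qed

lemma Lambda_Suc_le: "\<mu> \<in> \<Lambda> n \<Longrightarrow> 1 \<le> p \<Longrightarrow> \<mu> (Suc p) \<le> \<mu> p"
  by (cases "Suc p \<le> n") (auto simp: \<Lambda>_def)

text \<open>Moved indices form adjacent blocks of length at most two. If neither obstruction occurs,
  positivity propagates from the right end of each block, and equal neighbours are only lowered
  together or at the second one.\<close>

lemma not_down_steps:
  assumes m: "\<mu> \<in> \<Lambda> n" and s: "s \<in> steps n" and nd: "s \<notin> down_steps n \<mu>"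
  shows "step_vec n s n = 1 \<and> \<mu> n = 0
    \<or> (\<exists>p. step_vec n s p = 1 \<and> p < n \<and> step_vec n s (Suc p) = 0 \<and> \<mu> p = \<mu> (Suc p))"
proof (rule ccontr)
  assume neg: "\<not> ?thesis"
  note le1 = step_vec_le_1[OF s] and rng = step_vec_range[OF s] and three = step_vec_three[OF s]
    have A: "\<mu> n > 0" if "step_vec n s n = 1" using neg that by auto
    have Bp: "\<mu> (Suc p) < \<mu> p" if "step_vec n s p = 1" "p < n" "step_vec n s (Suc p) = 0" for p
    proof -
      have "\<mu> p \<noteq> \<mu> (Suc p)" using neg that by blast
      then show ?thesis using Lambda_Suc_le[OF m rng(1)[OF that(1)]] by simp
    qed
    have C: "\<mu> p > 0" if "step_vec n s p = 1" "step_vec n s (Suc p) = 0" for p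
    proof (cases "p < n")
      case True
      then show ?thesis using Bp[OF that(1) True that(2)] by simp
    next
      case False
      then have "p = n" using rng[OF that(1)] by simp
      then show ?thesis using A that by simp
    qed
    have pos: "\<mu> p > 0" if "step_vec n s p = 1" for p
    proof (cases "step_vec n s (Suc p) = 0")
      case False
      then have 1: "step_vec n s (Suc p) = 1" using le1[of "Suc p"] by simp
      have "\<mu> (Suc p) > 0" using C[OF 1 three[OF that 1]] .
      then show ?thesis using Lambda_Suc_le[OF m rng(1)[OF that]] by simp
    qed (use C that in auto)
    have le: "step_vec n s p \<le> \<mu> p" for p
      using pos[of p] le1[of p] by (cases "step_vec n s p = 1") auto
    have "lower n \<mu> s \<in> \<Lambda> n"
    proof (rule Lambda_adjacent)
      fix p assume p: "1 \<le> p" "p < n"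
      show "lower n \<mu> s (Suc p) \<le> lower n \<mu> s p"
        using Bp[of p] Lambda_Suc_le[OF m p(1)] le1[of p] le1[of "Suc p"] p
        by (cases "step_vec n s p = 1"; cases "step_vec n s (Suc p) = 1") (auto simp: lower_def)
    qed (use m in \<open>auto simp: lower_def \<Lambda>_def\<close>)
    then show False using nd s le by (simp add: down_steps_def)
qed

text \<open>Increasing entries can violate only the order, never positivity; hence raising needs no
  weight.\<close>

lemma not_up:
  assumes k: "\<kappa> \<in> \<Lambda> n" and s: "s \<in> steps n" and nd: "(\<lambda>p. \<kappa> p + step_vec n s p) \<notin> \<Lambda> n"
  shows "\<exists>p. 1 \<le> p \<and> step_vec n s (Suc p) = 1 \<and> step_vec n s p = 0 \<and> \<kappa> p = \<kappa> (Suc p)"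
proof (rule ccontr)
  assume neg: "\<not> ?thesis"
  note le1 = step_vec_le_1[OF s] and rng = step_vec_range[OF s]
    have "(\<lambda>p. \<kappa> p + step_vec n s p) \<in> \<Lambda> n"
    proof (rule Lambda_adjacent)
      fix p assume p: "1 \<le> p" "p < n"
      show "\<kappa> (Suc p) + step_vec n s (Suc p) \<le> \<kappa> p + step_vec n s p"
      proof (cases "step_vec n s (Suc p) = 1 \<and> step_vec n s p = 0")
        case True
        then have "\<kappa> p \<noteq> \<kappa> (Suc p)" using neg p by blast
        then show ?thesis using True Lambda_Suc_le[OF k p(1)] by simp
      next
        case False
        then show ?thesis using Lambda_Suc_le[OF k p(1)] le1[of p] le1[of "Suc p"] by (cases "step_vec n s p") auto
      qed
    next
      fix p assume p: "p \<notin> {1..n}"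
      have "step_vec n s p = 0" using rng[of p] le1[of p] p by (cases "step_vec n s p = 1") auto
      then show "\<kappa> p + step_vec n s p = 0" using k p by (auto simp: \<Lambda>_def)
    qed
    then show False using nd by simp
qed

lemma sum_step_vec_odd_idx: "s \<in> steps n \<Longrightarrow> (\<Sum>p\<in>odd_idx n. step_vec n s p) = 1"
proof -
  assume s: "s \<in> steps n"
  have "(\<Sum>p\<in>odd_idx n. step_vec n s p) = (\<Sum>p\<in>odd_idx n. if p = fst s then 1 else 0)"
    by (rule sum.cong) (use s in \<open>auto simp: step_vec_cases[OF s] odd_idx_def even_idx_def\<close>)
  also have "\<dots> = 1" using s by auto
  finally show ?thesis .
qed

lemma sum_step_vec_last_class: "s \<in> steps n \<Longrightarrow> (\<Sum>p\<in>last_class n. step_vec n s p) = 1"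
proof -
  assume s: "s \<in> steps n"
  show ?thesis
  proof (cases "odd n")
    case True
    then have "last_class n = odd_idx n" by (auto simp: last_class_def odd_idx_def)
    then show ?thesis using sum_step_vec_odd_idx[OF s] by simp
  next
    case False
    have "snd s \<in> last_class n" using s False by (auto simp: even_idx_def last_class_def le_Suc_eq)
    moreover have "(\<Sum>p\<in>last_class n. step_vec n s p) = (\<Sum>p\<in>last_class n. if p = snd s then 1 else 0)"
      by (rule sum.cong) (use s False in \<open>auto simp: step_vec_cases[OF s] odd_idx_def even_idx_def last_class_def\<close>)
    ultimately show ?thesis by simp
  qed
qed

lemma odd_size_lower: "s \<in> down_steps n \<mu> \<Longrightarrow> odd_size n \<mu> = Suc (odd_size n (lower n \<mu> s))"
proof -
  assume s: "s \<in> down_steps n \<mu>"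
  then have "(\<Sum>p\<in>odd_idx n. \<mu> p) = (\<Sum>p\<in>odd_idx n. lower n \<mu> s p + step_vec n s p)"
    by (intro sum.cong) (auto simp: down_steps_def lower_def)
  then show ?thesis using sum_step_vec_odd_idx[of s n] s by (simp add: odd_size_odd_idx sum.distrib down_steps_def)
qed

lemma shifted_lower: "s \<in> down_steps n \<mu> \<Longrightarrow> shifted n r (lower n \<mu> s) p = shifted n r \<mu> p + (- 1) * of_nat (step_vec n s p)"
  for r :: "'k::field_char_0"
  by (auto simp: down_steps_def lower_def shifted_def of_nat_diff)

lemma lower_eq_iff:
  "\<kappa> \<in> \<Lambda> n \<Longrightarrow> s \<in> down_steps n \<mu> \<and> lower n \<mu> s = \<kappa> \<longleftrightarrow> s \<in> steps n \<and> (\<lambda>p. \<kappa> p + step_vec n s p) = \<mu>"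
proof (intro iffI conjI)
  assume k: "\<kappa> \<in> \<Lambda> n" and a: "s \<in> down_steps n \<mu> \<and> lower n \<mu> s = \<kappa>"
  then show "s \<in> steps n" by (simp add: down_steps_def)
  show "(\<lambda>p. \<kappa> p + step_vec n s p) = \<mu>"
  proof
    fix p
    have "step_vec n s p \<le> \<mu> p" "\<kappa> p = \<mu> p - step_vec n s p" using a by (auto simp: down_steps_def lower_def)
    then show "\<kappa> p + step_vec n s p = \<mu> p" by simp
  qed
next
  assume k: "\<kappa> \<in> \<Lambda> n" and a: "s \<in> steps n \<and> (\<lambda>p. \<kappa> p + step_vec n s p) = \<mu>"
  have m: "\<mu> p = \<kappa> p + step_vec n s p" for p using a by auto
  show l: "lower n \<mu> s = \<kappa>" by (rule ext) (simp add: lower_def m)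
  show "s \<in> down_steps n \<mu>" using a k by (simp add: down_steps_def l m)
qed

section \<open>Sums of the step coefficients\<close>

lemma step_weight_W:
  assumes "\<pi> \<in> W n" "(i, j) \<in> steps n"
  shows "eval_at (\<lambda>i. x (\<pi> i)) (step_weight n (i, j)) = eval_at x (step_weight n (\<pi> i, \<pi> j))"
  by (simp add: step_weight_def)

text \<open>The steps, weighted by the coefficients for a = 0, add up to the direction (1,...,1).
  This identifies the leading part of the raising operator.\<close>

lemma sum_step_coeff_step_vec:
  fixes y :: "nat \<Rightarrow> 'k::field_char_0"
  assumes y: "generic n y" and p: "p \<in> {1..n}"
  shows "(\<Sum>s\<in>steps n. step_coeff n 0 y s * of_nat (step_vec n s p)) = 1"
proof -
  have "(\<Sum>s\<in>steps n. step_coeff n 0 y s * of_nat (step_vec n s p))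
      = (\<Sum>i\<in>odd_idx n. \<Sum>j\<in>even_idx n. step_coeff n 0 y (i, j) * of_nat (step_vec n (i, j) p))"
    by (simp add: sum.cartesian_product case_prod_beta)
  also have "\<dots> = 1"
  proof (cases "odd p")
    case True
    then have pO: "p \<in> odd_idx n" using p by (simp add: odd_idx_def)
    have "(\<Sum>i\<in>odd_idx n. \<Sum>j\<in>even_idx n. step_coeff n 0 y (i, j) * of_nat (step_vec n (i, j) p))
        = (\<Sum>i\<in>odd_idx n. if i = p then (\<Sum>j\<in>even_idx n. step_coeff n 0 y (i, j)) else 0)"
    proof (rule sum.cong[OF refl])
      fix i assume i: "i \<in> odd_idx n"
      have "step_vec n (i, j) p = (if i = p then 1 else 0)" if "j \<in> even_idx n" for j
        using that True by (auto simp: step_vec_def even_idx_def)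
      then show "(\<Sum>j\<in>even_idx n. step_coeff n 0 y (i, j) * of_nat (step_vec n (i, j) p)) = (if i = p then (\<Sum>j\<in>even_idx n. step_coeff n 0 y (i, j)) else 0)"
        by (auto intro!: sum.cong)
    qed
    then show ?thesis using pO sum_step_coeff_even_idx[OF y pO] by simp
  next
    case False
    then have pE: "p \<in> even_idx n" "p \<le> n" using p by (auto simp: even_idx_def)
    have "(\<Sum>i\<in>odd_idx n. \<Sum>j\<in>even_idx n. step_coeff n 0 y (i, j) * of_nat (step_vec n (i, j) p))
        = (\<Sum>i\<in>odd_idx n. \<Sum>j\<in>even_idx n. if j = p then step_coeff n 0 y (i, j) else 0)"
      by (intro sum.cong refl) (use False pE in \<open>auto simp: step_vec_def odd_idx_def\<close>)
    also have "\<dots> = (\<Sum>i\<in>odd_idx n. step_coeff n 0 y (i, p))"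
      using pE by (intro sum.cong) auto
    finally show ?thesis using sum_step_coeff_odd_idx[OF y pE] by simp
  qed
  finally show ?thesis .
qed

lemma sum_step_weight_step_coeff:
  fixes y :: "nat \<Rightarrow> 'k::field_char_0"
  assumes y: "generic n y"
  shows "(\<Sum>s\<in>steps n. eval_at y (step_weight n s) * step_coeff n 0 y s) = (\<Sum>p\<in>last_class n. y p)"
proof -
  have "(\<Sum>p\<in>last_class n. y p) = (\<Sum>p\<in>last_class n. y p * (\<Sum>s\<in>steps n. step_coeff n 0 y s * of_nat (step_vec n s p)))"
    by (rule sum.cong[OF refl], subst sum_step_coeff_step_vec[OF y]) (auto simp: last_class_def)
  also have "\<dots> = (\<Sum>s\<in>steps n. step_coeff n 0 y s * (\<Sum>p\<in>last_class n. y p * of_nat (step_vec n s p)))"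
    unfolding sum_distrib_left by (subst sum.swap) (simp add: ac_simps)
  also have "\<dots> = (\<Sum>s\<in>steps n. eval_at y (step_weight n s) * step_coeff n 0 y s)"
  proof (rule sum.cong[OF refl])
    fix s assume s: "s \<in> steps n"
    let ?c = "if odd n then fst s else snd s"
    have c: "?c \<in> last_class n" using s by (auto simp: last_class_def odd_idx_def even_idx_def le_Suc_eq)
    have "(\<Sum>p\<in>last_class n. y p * of_nat (step_vec n s p)) = (\<Sum>p\<in>last_class n. if p = ?c then y p else 0)"
      by (rule sum.cong) (use s in \<open>auto simp: step_vec_cases[OF s] last_class_def odd_idx_def even_idx_def\<close>)
    also have "\<dots> = y ?c" using c by simp
    finally show "step_coeff n 0 y s * (\<Sum>p\<in>last_class n. y p * of_nat (step_vec n s p)) = eval_at y (step_weight n s) * step_coeff n 0 y s"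
      by (simp add: step_weight_def)
  qed
  finally show ?thesis by simp
qed

text \<open>Up to sign and an additive constant, the eigenvalue of the lowering operator on
  \<open>R n r \<mu>\<close>.\<close>

definition class_size :: "nat \<Rightarrow> (nat \<Rightarrow> nat) \<Rightarrow> nat" where "class_size n \<mu> = (\<Sum>p\<in>last_class n. \<mu> p)"

definition down_coeff :: "nat \<Rightarrow> 'k::field_char_0 \<Rightarrow> (nat \<Rightarrow> nat) \<Rightarrow> nat \<times> nat \<Rightarrow> 'k" where
  "down_coeff n r \<mu> s = eval_at (shifted n r \<mu>) (step_weight n s) * step_coeff n r (shifted n r \<mu>) s"

lemma step_weight_scale: "eval_at (\<lambda>i. t * y i) (step_weight n s) = t ^ 1 * eval_at y (step_weight n s)"
  by (simp add: step_weight_def)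

text \<open>Each step lowers the linear invariant f by exactly 1, so the sum is minus the lowering
  operator applied to f. It is therefore a polynomial of degree at most 1, whose linear part comes
  from a = 0. The constant is left undetermined, as only differences of eigenvalues matter.\<close>

lemma sum_step_weight_step_coeff_affine:
  fixes r :: "'k::field_char_0"
  obtains c where "\<And>x. generic n x \<Longrightarrow> (\<Sum>s\<in>steps n. eval_at x (step_weight n s) * step_coeff n r x s) = (\<Sum>p\<in>last_class n. x p) + c"
proof -
  define f where "f = (\<Sum>p\<in>last_class n. Var p :: 'k mvpoly)"
  have lf: "line f x v = [:\<Sum>p\<in>last_class n. x p, \<Sum>p\<in>last_class n. v p:]" for x v
  proof -
    have "(\<Sum>p\<in>A. [:x p, v p:]) = [:\<Sum>p\<in>A. x p, \<Sum>p\<in>A. v p:]" if "finite A" for A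
      using that by (induction A) auto
    then show ?thesis by (simp add: f_def)
  qed
  have finv: "f \<in> invariants n"
    unfolding invariants_iff
  proof (intro conjI ballI allI)
    show "f \<in> polys n" unfolding f_def by (rule polys_sum, rule polys_Var) (auto simp: last_class_def)
    fix \<pi> and x :: "nat \<Rightarrow> 'k" assume pi: "\<pi> \<in> W n"
    have "\<pi> p \<in> last_class n \<longleftrightarrow> p \<in> last_class n" for p
      unfolding last_class_def mem_Collect_eq using pi_mem[OF pi, of p] pi_even[OF pi, of p] by blast
    then have "\<pi> ` last_class n = last_class n" by (rule image_pi[OF pi])
    then have "(\<Sum>j\<in>last_class n. x (\<pi> j)) = (\<Sum>j\<in>last_class n. x j)"
      using sum.reindex[OF inj_on_subset[OF pi_inj[OF pi] subset_UNIV], of x "last_class n"] by simp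
    then show "eval_at (\<lambda>i. x (\<pi> i)) f = eval_at x f" by (simp add: f_def)
  qed
  have fd: "deg_le (Suc 0) f" unfolding deg_le_iff lf by simp
  have fh: "hom_component (Suc 0) f = f"
    by (rule mvpoly_eqI, unfold coeff_line_0[symmetric] lf) (simp add: f_def)
  obtain H where H: "H \<in> invariants n" "\<And>x. generic n x \<Longrightarrow> eval_at x H = step_op n r (- 1) (step_weight n) f x"
    using step_op_polynomial[OF finv step_weight_polys step_weight_W, of r "- 1"] by blast
  have st: "(\<Sum>p\<in>last_class n. of_nat (step_vec n s p)) = (1 :: 'k)" if "s \<in> steps n" for s
    using arg_cong[OF sum_step_vec_last_class[OF that], of "of_nat :: nat \<Rightarrow> 'k"] by simp
  have L: "step_op n r (- 1) (step_weight n) f x = - (\<Sum>s\<in>steps n. eval_at x (step_weight n s) * step_coeff n r x s)" for x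
    unfolding step_op_def sum_negf[symmetric]
    by (rule sum.cong[OF refl]) (simp add: f_def sum_subtractf st)
  have d: "deg_le 1 H" using step_op_top(1)[OF H(2) fd step_weight_scale] by simp
  have "hom_component 1 H = - f"
  proof (rule eqI_generic[of n])
    fix y :: "nat \<Rightarrow> 'k" assume y: "generic n y"
    have "eval_at y (hom_component (0 + 1) H) =
      (\<Sum>s\<in>steps n. eval_at y (step_weight n s) * step_coeff n 0 y s *
         (- 1 * coeff (line (hom_component (Suc 0) f) y (\<lambda>p. of_nat (step_vec n s p))) 1))"
      by (rule step_op_top(2)[OF H(2) fd step_weight_scale y])
    also have "\<dots> = - (\<Sum>s\<in>steps n. eval_at y (step_weight n s) * step_coeff n 0 y s)"
      unfolding fh lf sum_negf[symmetric] by (rule sum.cong[OF refl]) (simp add: st)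
    also have "\<dots> = eval_at y (- f)" by (simp add: sum_step_weight_step_coeff[OF y] f_def)
    finally show "eval_at y (hom_component 1 H) = eval_at y (- f)" by simp
  qed
  moreover have "H = hom_component 0 H + hom_component 1 H"
    using hom_component_sum_eq[OF d] by (simp add: numeral_eq_Suc)
  ultimately have "H = hom_component 0 H - f" by simp
  from arg_cong[OF this, of "eval_at _"]
  have e: "eval_at x H = eval_at x (hom_component 0 H) - (\<Sum>p\<in>last_class n. x p)" for x
    by (simp only: eval_at_minus) (simp add: f_def)
  have h0: "eval_at x (hom_component 0 H) = eval_at (\<lambda>_. 0) (hom_component 0 H)" for x
    using eval_at_hom_scale[of 0 x 0 H] by simp
  have "(\<Sum>s\<in>steps n. eval_at x (step_weight n s) * step_coeff n r x s) = (\<Sum>p\<in>last_class n. x p) + (- eval_at (\<lambda>_. 0) (hom_component 0 H))"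
    if "generic n x" for x
    using H(2)[OF that] e[of x] unfolding L h0[of x] by (simp add: algebra_simps)
  then show ?thesis by (rule that)
qed

section \<open>Vanishing coefficients and the action on interpolation polynomials\<close>

context param
begin

lemma generic_shifted:
  assumes "\<mu> \<in> \<Lambda> n"
  shows "generic n (shifted n r \<mu>)"
proof -
  have "shifted n r \<mu> p \<noteq> shifted n r \<mu> q" if "1 \<le> p" "p < q" "q \<le> n" for p q
  proof
    assume e: "shifted n r \<mu> p = shifted n r \<mu> q"
    have le: "\<mu> q \<le> \<mu> p" using assms that by (auto simp: \<Lambda>_def)
    have "of_nat (q - p) * r + of_nat (\<mu> p - \<mu> q) = shifted n r \<mu> p - shifted n r \<mu> q"
      using that le by (simp add: shifted_def of_nat_diff algebra_simps)
    then show False using nz[of "q - p" "\<mu> p - \<mu> q"] e that by simp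
  qed
  then have "shifted n r \<mu> p \<noteq> shifted n r \<mu> q" if "(p, q) \<in> parity_pairs n" for p q
    using that by (cases p q rule: linorder_cases) (force simp: parity_pairs_def)+
  then show ?thesis unfolding generic_def by blast
qed

text \<open>The two obstructions of \<open>not_down_steps\<close> are killed by the weight and by
  the numerator factor z_p - z_(p+1) - r, respectively.\<close>

lemma down_coeff_eq_0:
  assumes m: "\<mu> \<in> \<Lambda> n" and s: "s \<in> steps n" and nd: "s \<notin> down_steps n \<mu>"
  shows "down_coeff n r \<mu> s = 0"
  using not_down_steps[OF m s nd]
proof (elim disjE exE conjE)
  assume 1: "step_vec n s n = 1" "\<mu> n = 0"
  have "odd (fst s)" "even (snd s)" using s by (auto simp: odd_idx_def even_idx_def)
  then have "n = (if odd n then fst s else snd s)"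
    using 1(1) unfolding step_vec_cases[OF s] by (auto split: if_splits)
  then have "step_weight n s = (Var n :: 'k mvpoly)" by (auto simp: step_weight_def split: if_splits)
  then have "eval_at (shifted n r \<mu>) (step_weight n s) = 0" using 1(2) by (simp add: shifted_def)
  then show ?thesis by (simp add: down_coeff_def)
next
  fix p assume 2: "step_vec n s p = 1" "p < n" "step_vec n s (Suc p) = 0" "\<mu> p = \<mu> (Suc p)"
  have ne: "Suc p \<noteq> fst s" "Suc p \<noteq> snd s" using 2(2,3) unfolding step_vec_cases[OF s] by (auto split: if_splits)
  have par: "odd (fst s)" "even (snd s)" using s by (auto simp: odd_idx_def even_idx_def)
  have d: "node_diff n r (shifted n r \<mu>) p (Suc p) = 0"
    using 2(2,4) by (auto simp: node_diff_def shifted_def Suc_diff_Suc of_nat_diff algebra_simps)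
  have "step_num n r (shifted n r \<mu>) s = 0"
  proof (cases "p = fst s")
    case True
    then have "Suc p \<in> even_idx n - {snd s}" using 2(2) ne par(1) by (simp add: even_idx_def)
    then show ?thesis using d True by (auto simp: step_num_def)
  next
    case False
    then have p: "p = snd s" using 2(1) unfolding step_vec_cases[OF s] by (auto split: if_splits)
    then have "Suc p \<in> odd_idx n - {fst s}" using 2(2) ne par(2) by (simp add: odd_idx_def)
    then show ?thesis using d p by (auto simp: step_num_def)
  qed
  then show ?thesis by (simp add: down_coeff_def step_coeff_def)
qed

text \<open>With -r in place of r the factor z_(p+1) - z_p + r vanishes at \<rho> + \<kappa> when
  the entries at p and p + 1 are equal.\<close>

lemma step_coeff_up_eq_0:
  assumes k: "\<kappa> \<in> \<Lambda> n" and s: "s \<in> steps n" and nd: "(\<lambda>p. \<kappa> p + step_vec n s p) \<notin> \<Lambda> n"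
  shows "step_coeff n (- r) (shifted n r \<kappa>) s = 0"
proof -
  obtain p where p: "1 \<le> p" "step_vec n s (Suc p) = 1" "step_vec n s p = 0" "\<kappa> p = \<kappa> (Suc p)"
    using not_up[OF k s nd] by (elim exE conjE)
  have pn: "Suc p \<le> n" by (rule step_vec_range(2)[OF s p(2)])
  have ne: "p \<noteq> fst s" "p \<noteq> snd s" using p(3) pn unfolding step_vec_cases[OF s] by (auto split: if_splits)
  have par: "odd (fst s)" "even (snd s)" using s by (auto simp: odd_idx_def even_idx_def)
  have d: "node_diff n (- r) (shifted n r \<kappa>) (Suc p) p = 0"
    using p pn by (auto simp: node_diff_def shifted_def of_nat_diff algebra_simps)
  have "step_num n (- r) (shifted n r \<kappa>) s = 0"
  proof (cases "Suc p = fst s")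
    case True
    then have "even p" using par(1) by (metis even_Suc)
    then have "p \<in> even_idx n - {snd s}" using p(1) pn ne by (simp add: even_idx_def)
    then show ?thesis using d True by (auto simp: step_num_def)
  next
    case False
    then have q: "Suc p = snd s" using p(2) unfolding step_vec_cases[OF s] by (auto split: if_splits)
    then have "odd p" using par(2) by (metis even_Suc)
    then have "p \<in> odd_idx n - {fst s}" using p(1) pn ne by (simp add: odd_idx_def)
    then show ?thesis using d q by (auto simp: step_num_def)
  qed
  then show ?thesis by (simp add: step_coeff_def)
qed

lemma R_facts:
  assumes "\<mu> \<in> \<Lambda> n"
  shows "R n r \<mu> \<in> invariants n" "deg_le (odd_size n \<mu>) (R n r \<mu>)"
    "\<And>\<kappa>. \<kappa> \<in> \<Lambda> n \<Longrightarrow> odd_size n \<kappa> \<le> odd_size n \<mu> \<Longrightarrow> \<kappa> \<noteq> \<mu> \<Longrightarrow> eval_at (shifted n r \<kappa>) (R n r \<mu>) = 0"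
    "eval_at (shifted n r \<mu>) (R n r \<mu>) = R_norm n r \<mu>"
  using interpolant_R[OF assms] by (auto simp: interpolant_def)

text \<open>The eigenvalue equation of \<open>R\<^sub>\<mu>\<close> under the lowering operator, evaluated at \<open>\<rho> + lam\<close>.\<close>

lemma R_recursion:
  assumes m: "\<mu> \<in> \<Lambda> n" and l: "lam \<in> \<Lambda> n"
  shows "(of_nat (class_size n lam) - of_nat (class_size n \<mu>)) * eval_at (shifted n r lam) (R n r \<mu>)
    = (\<Sum>s\<in>down_steps n lam. down_coeff n r lam s * eval_at (shifted n r (lower n lam s)) (R n r \<mu>))"
proof -
  note Rm = R_facts[OF m]
  let ?R = "R n r \<mu>"
  obtain H where H: "H \<in> invariants n" "\<And>x. generic n x \<Longrightarrow> eval_at x H = step_op n r (- 1) (step_weight n) ?R x"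
    using step_op_polynomial[OF Rm(1) step_weight_polys step_weight_W, of r "- 1"] by blast
  have Hd: "deg_le (odd_size n \<mu>) H"
  \<comment> \<open>\<open>step_op_top\<close> requires positive degree; in size 0 the polynomial is
    constant and all differences vanish. Otherwise the linear weight restores the lost
    degree.\<close>
  proof (cases "odd_size n \<mu>")
    case 0
    then have d0: "deg_le 0 ?R" using Rm(2) by simp
    have "?R = hom_component 0 ?R" using hom_component_sum_eq[OF d0] by simp
    then have e: "eval_at x ?R = eval_at (\<lambda>_. 0) ?R" for x
      using eval_at_hom_scale[of 0 x 0 ?R] by simp
    have "H = 0"
    proof (rule eqI_generic[of n])
      fix x :: "nat \<Rightarrow> 'k" assume x: "generic n x"
      have "eval_at y ?R - eval_at x ?R = 0" for y unfolding e[of y] e[of x] by (rule diff_self)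
      then have "step_op n r (- 1) (step_weight n) ?R x = 0" unfolding step_op_def by (simp only: mult_zero_right sum.neutral_const)
      then show "eval_at x H = eval_at x 0" by (simp add: H(2)[OF x])
    qed
    then show ?thesis using deg_le_Const[of "odd_size n \<mu>" "0 :: 'k"] by simp
  next
    case (Suc d)
    then show ?thesis using step_op_top(1)[OF H(2) _ step_weight_scale, of d] Rm(2) by simp
  qed
  define S where "S \<kappa> = (\<Sum>s\<in>steps n. down_coeff n r \<kappa> s)" for \<kappa>
  have ev: "eval_at (shifted n r \<kappa>) H =
      (\<Sum>s\<in>down_steps n \<kappa>. down_coeff n r \<kappa> s * eval_at (shifted n r (lower n \<kappa> s)) ?R) - S \<kappa> * eval_at (shifted n r \<kappa>) ?R"
    if k: "\<kappa> \<in> \<Lambda> n" for \<kappa>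
  proof -
    have "eval_at (shifted n r \<kappa>) H = (\<Sum>s\<in>steps n. down_coeff n r \<kappa> s *
       (eval_at (\<lambda>p. shifted n r \<kappa> p + (- 1) * of_nat (step_vec n s p)) ?R - eval_at (shifted n r \<kappa>) ?R))"
      unfolding H(2)[OF generic_shifted[OF k]] step_op_def down_coeff_def ..
    also have "\<dots> = (\<Sum>s\<in>steps n. down_coeff n r \<kappa> s *
       eval_at (\<lambda>p. shifted n r \<kappa> p + (- 1) * of_nat (step_vec n s p)) ?R) - S \<kappa> * eval_at (shifted n r \<kappa>) ?R"
      by (simp add: S_def right_diff_distrib sum_subtractf sum_distrib_right)
    also have "(\<Sum>s\<in>steps n. down_coeff n r \<kappa> s * eval_at (\<lambda>p. shifted n r \<kappa> p + (- 1) * of_nat (step_vec n s p)) ?R)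
        = (\<Sum>s\<in>down_steps n \<kappa>. down_coeff n r \<kappa> s * eval_at (\<lambda>p. shifted n r \<kappa> p + (- 1) * of_nat (step_vec n s p)) ?R)"
      by (rule sum.mono_neutral_right) (use down_coeff_eq_0[OF k] in \<open>auto simp: down_steps_def\<close>)
    also have "\<dots> = (\<Sum>s\<in>down_steps n \<kappa>. down_coeff n r \<kappa> s * eval_at (shifted n r (lower n \<kappa> s)) ?R)"
    proof (rule sum.cong[OF refl])
      fix s assume s: "s \<in> down_steps n \<kappa>"
      show "down_coeff n r \<kappa> s * eval_at (\<lambda>p. shifted n r \<kappa> p + (- 1) * of_nat (step_vec n s p)) ?R
          = down_coeff n r \<kappa> s * eval_at (shifted n r (lower n \<kappa> s)) ?R"
        unfolding shifted_lower[OF s, symmetric] ..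
    qed
    finally show ?thesis .
  qed
  \<comment> \<open>At a point of size at most that of \<mu>, every lowered point is strictly
    smaller, so \<open>R n r \<mu>\<close> vanishes there and only the diagonal term remains. It is
    non-zero at most at \<mu>.\<close>
  have "H + Const (S \<mu>) * ?R = 0"
  proof (rule interpolation_unique[of _ n "odd_size n \<mu>"])
    show "H + Const (S \<mu>) * ?R \<in> invariants n"
      by (intro invariants_add invariants_mult invariants_Const H(1) Rm(1))
    show "deg_le (odd_size n \<mu>) (H + Const (S \<mu>) * ?R)"
      using deg_le_mult[OF deg_le_Const[of 0 "S \<mu>"] Rm(2)] by (intro deg_le_add Hd) simp
    fix \<kappa> assume k: "\<kappa> \<in> \<Lambda> n" "odd_size n \<kappa> \<le> odd_size n \<mu>"
    have "eval_at (shifted n r (lower n \<kappa> s)) ?R = 0" if s: "s \<in> down_steps n \<kappa>" for s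
    proof (rule Rm(3))
      show "lower n \<kappa> s \<in> \<Lambda> n" using s by (simp add: down_steps_def)
      show "odd_size n (lower n \<kappa> s) \<le> odd_size n \<mu>" "lower n \<kappa> s \<noteq> \<mu>"
        using odd_size_lower[OF s] k by auto
    qed
    then have "eval_at (shifted n r \<kappa>) H = - (S \<kappa> * eval_at (shifted n r \<kappa>) ?R)" using ev[OF k(1)] by simp
    then show "eval_at (shifted n r \<kappa>) (H + Const (S \<mu>) * ?R) = 0"
      using Rm(3)[OF k] by (cases "\<kappa> = \<mu>") auto
  qed
  then have "eval_at (shifted n r lam) (H + Const (S \<mu>) * ?R) = 0" by simp
  then have main: "(S lam - S \<mu>) * eval_at (shifted n r lam) ?R
      = (\<Sum>s\<in>down_steps n lam. down_coeff n r lam s * eval_at (shifted n r (lower n lam s)) ?R)"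
    using ev[OF l] by (simp add: algebra_simps)
  obtain c where c: "\<And>x. generic n x \<Longrightarrow> (\<Sum>s\<in>steps n. eval_at x (step_weight n s) * step_coeff n r x s) = (\<Sum>p\<in>last_class n. x p) + c"
    using sum_step_weight_step_coeff_affine by blast
  \<comment> \<open>The unknown constant and the contribution of \<rho> do not depend on \<kappa>
    and cancel in the difference.\<close>
  have "S \<kappa> = of_nat (class_size n \<kappa>) + ((\<Sum>p\<in>last_class n. of_nat (n - p) * r) + c)" if "\<kappa> \<in> \<Lambda> n" for \<kappa>
    unfolding S_def down_coeff_def c[OF generic_shifted[OF that]] by (simp add: shifted_def sum.distrib class_size_def)
  then have "S lam - S \<mu> = of_nat (class_size n lam) - of_nat (class_size n \<mu>)" using m l by simp
  then show ?thesis using main by simp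
qed

lemma R_top_derivative:
  fixes y :: "nat \<Rightarrow> 'k"
  assumes l: "lam \<in> \<Lambda> n" and y: "generic n y"
  shows "coeff (line (R_top n r lam) y (\<lambda>_. 1)) 1 =
    (\<Sum>s\<in>down_steps n lam. step_coeff n (- r) (shifted n r (lower n lam s)) s * (R_norm n r lam / R_norm n r (lower n lam s))
       * eval_at y (R_top n r (lower n lam s)))"
proof (cases "odd_size n lam")
  case 0
  then have "down_steps n lam = {}" using odd_size_lower by fastforce
  moreover have "degree (line (R_top n r lam) y (\<lambda>_. 1)) < 1"
    using degree_line_le'[OF deg_le_hom[of 0 "R n r lam"], of y "\<lambda>_. 1"] by (simp add: R_top_def 0)
  then have "coeff (line (R_top n r lam) y (\<lambda>_. 1)) 1 = 0" by (rule coeff_eq_0)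
  ultimately show ?thesis by simp
next
  case (Suc d)
  note Rl = R_facts[OF l]
  let ?R = "R n r lam" and ?w = "\<lambda>_ :: nat \<times> nat. 1 :: 'k mvpoly"
  obtain H where H: "H \<in> invariants n" "\<And>x. generic n x \<Longrightarrow> eval_at x H = step_op n (- r) 1 ?w ?R x"
    using step_op_polynomial[OF Rl(1), of ?w "- r" 1] by auto
  have ws: "eval_at (\<lambda>i. t * y i) (?w s) = t ^ 0 * eval_at y (?w s)" for t y s by simp
  have Rd: "deg_le (Suc d) ?R" using Rl(2) Suc by simp
  have Hd: "deg_le d H" using step_op_top(1)[OF H(2) Rd ws] by simp
  \<comment> \<open>The contribution of s to the value of \<open>H\<close> at the lowered point,
    divided by the value there of the polynomial attached to that point.\<close>
  define a where "a s = step_coeff n (- r) (shifted n r (lower n lam s)) s * (R_norm n r lam / R_norm n r (lower n lam s))" for s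
  have low: "lower n lam s \<in> \<Lambda> n" "odd_size n (lower n lam s) = d" if "s \<in> down_steps n lam" for s
    using that odd_size_lower[OF that] Suc by (auto simp: down_steps_def)
  have "H - (\<Sum>s\<in>down_steps n lam. Const (a s) * R n r (lower n lam s)) = 0"
  proof (rule interpolation_unique[of _ n d])
    show "H - (\<Sum>s\<in>down_steps n lam. Const (a s) * R n r (lower n lam s)) \<in> invariants n"
      by (intro invariants_minus H(1) invariants_sum invariants_mult invariants_Const R_facts(1) low)
    show "deg_le d (H - (\<Sum>s\<in>down_steps n lam. Const (a s) * R n r (lower n lam s)))"
    proof (intro deg_le_minus Hd deg_le_sum)
      fix s assume s: "s \<in> down_steps n lam"
      show "deg_le d (Const (a s) * R n r (lower n lam s))"
        using deg_le_mult[OF deg_le_Const[of 0 "a s"] R_facts(2)[OF low(1)[OF s]]] low(2)[OF s] by simp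
    qed
    fix \<kappa> assume k: "\<kappa> \<in> \<Lambda> n" "odd_size n \<kappa> \<le> d"
    have Rk: "eval_at (shifted n r \<kappa>) ?R = 0" using k Suc by (intro Rl(3)) auto
    \<comment> \<open>From size at most d one upward step reaches at most the size of lam, where
      \<open>R n r lam\<close> vanishes except at its own point.\<close>
    have up: "step_coeff n (- r) (shifted n r \<kappa>) s * eval_at (\<lambda>p. shifted n r \<kappa> p + 1 * of_nat (step_vec n s p)) ?R
        = (if (\<lambda>p. \<kappa> p + step_vec n s p) = lam then step_coeff n (- r) (shifted n r \<kappa>) s * R_norm n r lam else 0)"
      if s: "s \<in> steps n" for s
    proof (cases "(\<lambda>p. \<kappa> p + step_vec n s p) \<in> \<Lambda> n")
      case False
      then show ?thesis using step_coeff_up_eq_0[OF k(1) s False] by simp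
    next
      case True
      have e: "(\<lambda>p. shifted n r \<kappa> p + 1 * of_nat (step_vec n s p)) = shifted n r (\<lambda>p. \<kappa> p + step_vec n s p)"
        by (auto simp: shifted_def)
      have "odd_size n (\<lambda>p. \<kappa> p + step_vec n s p) \<le> odd_size n lam"
        using sum_step_vec_odd_idx[OF s] k(2) Suc by (simp add: odd_size_odd_idx sum.distrib)
      then show ?thesis unfolding e using Rl(3)[OF True] Rl(4) by auto
    qed
    have "eval_at (shifted n r \<kappa>) H = (\<Sum>s\<in>steps n. step_coeff n (- r) (shifted n r \<kappa>) s * eval_at (\<lambda>p. shifted n r \<kappa> p + 1 * of_nat (step_vec n s p)) ?R)"
      unfolding H(2)[OF generic_shifted[OF k(1)]] step_op_def Rk by simp
    also have "\<dots> = (\<Sum>s\<in>steps n. if (\<lambda>p. \<kappa> p + step_vec n s p) = lam then step_coeff n (- r) (shifted n r \<kappa>) s * R_norm n r lam else 0)"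
      by (rule sum.cong[OF refl up])
    also have "\<dots> = (\<Sum>s\<in>{s \<in> steps n. (\<lambda>p. \<kappa> p + step_vec n s p) = lam}. step_coeff n (- r) (shifted n r \<kappa>) s * R_norm n r lam)"
      by (rule sum.mono_neutral_cong_right) auto
    \<comment> \<open>Upward steps from \<kappa> to lam are the downward steps from lam to
      \<kappa>.\<close>
    also have "{s \<in> steps n. (\<lambda>p. \<kappa> p + step_vec n s p) = lam} = {s \<in> down_steps n lam. lower n lam s = \<kappa>}"
      using lower_eq_iff[OF k(1), of _ lam] by blast
    also have "(\<Sum>s\<in>{s \<in> down_steps n lam. lower n lam s = \<kappa>}. step_coeff n (- r) (shifted n r \<kappa>) s * R_norm n r lam)
        = (\<Sum>s\<in>down_steps n lam. a s * eval_at (shifted n r \<kappa>) (R n r (lower n lam s)))"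
    proof (rule sum.mono_neutral_cong_left)
      show "\<forall>s\<in>down_steps n lam - {s \<in> down_steps n lam. lower n lam s = \<kappa>}. a s * eval_at (shifted n r \<kappa>) (R n r (lower n lam s)) = 0"
        using R_facts(3)[OF low(1) k(1)] low(2) k(2) by auto
      fix s assume "s \<in> {s \<in> down_steps n lam. lower n lam s = \<kappa>}"
      then show "step_coeff n (- r) (shifted n r \<kappa>) s * R_norm n r lam = a s * eval_at (shifted n r \<kappa>) (R n r (lower n lam s))"
        using R_facts(4)[OF k(1)] R_norm_nonzero[of n \<kappa>] by (auto simp: a_def)
    qed auto
    finally show "eval_at (shifted n r \<kappa>) (H - (\<Sum>s\<in>down_steps n lam. Const (a s) * R n r (lower n lam s))) = 0"
      by simp
  qed
  then have Heq: "H = (\<Sum>s\<in>down_steps n lam. Const (a s) * R n r (lower n lam s))" by simp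
  have "coeff (line H (\<lambda>_. 0) y) d = (\<Sum>s\<in>down_steps n lam. a s * coeff (line (R n r (lower n lam s)) (\<lambda>_. 0) y) d)"
    unfolding Heq by (simp add: coeff_sum)
  then have 1: "eval_at y (hom_component d H) = (\<Sum>s\<in>down_steps n lam. a s * eval_at y (R_top n r (lower n lam s)))"
    using low(2) by (simp add: coeff_line_0 R_top_def)
  \<comment> \<open>Second computation of the leading part, now from the operator itself instead of
    the interpolation.\<close>
  have "eval_at y (hom_component (d + 0) H) = (\<Sum>s\<in>steps n. eval_at y (?w s) * step_coeff n 0 y s *
         (1 * coeff (line (hom_component (Suc d) ?R) y (\<lambda>p. of_nat (step_vec n s p))) 1))"
    by (rule step_op_top(2)[OF H(2) Rd ws y])
  also have "\<dots> = (\<Sum>s\<in>steps n. step_coeff n 0 y s * coeff (line (R_top n r lam) y (\<lambda>p. of_nat (step_vec n s p))) 1)"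
    by (simp add: R_top_def Suc)
  also have "\<dots> = coeff (line (R_top n r lam) y (\<lambda>p. \<Sum>s\<in>steps n. step_coeff n 0 y s * of_nat (step_vec n s p))) 1"
    by (rule coeff_line_linear[symmetric])
  also have "line (R_top n r lam) y (\<lambda>p. \<Sum>s\<in>steps n. step_coeff n 0 y s * of_nat (step_vec n s p)) = line (R_top n r lam) y (\<lambda>_. 1)"
    by (rule line_cong[of _ n]) (auto simp: R_top_def sum_step_coeff_step_vec[OF y] intro!: polys_hom_component[OF invariants_polys[OF Rl(1)]])
  finally show ?thesis using 1 by (simp add: a_def)
qed

end

section \<open>The normalisation\<close>

text \<open>The moved index comes first. Together with \<open>cross_even\<close> these are exactly
  the pairs whose difference of entries changes under the step.\<close>

definition cross_odd :: "nat \<Rightarrow> nat \<times> nat \<Rightarrow> (nat \<times> nat) set" where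
  "cross_odd n s = {(u, v). u \<in> {1..n} \<and> v \<in> {1..n} \<and> step_vec n s u = 1 \<and> step_vec n s v = 0 \<and> even u \<noteq> even v}"

definition cross_even :: "nat \<Rightarrow> nat \<times> nat \<Rightarrow> (nat \<times> nat) set" where
  "cross_even n s = {(u, v). u \<in> {1..n} \<and> v \<in> {1..n} \<and> step_vec n s u = 1 \<and> step_vec n s v = 0 \<and> even u = even v}"

lemma finite_X [simp]: "finite (cross_odd n s)" "finite (cross_even n s)"
  by (rule finite_subset[of _ "{1..n} \<times> {1..n}"]; auto simp: cross_odd_def cross_even_def)+

lemma step_vec_eq_iff:
  assumes "s \<in> steps n"
  shows "step_vec n s p = Suc 0 \<longleftrightarrow> p = fst s \<or> p = snd s \<and> p \<le> n"
    and "step_vec n s p = 0 \<longleftrightarrow> p \<noteq> fst s \<and> (p \<noteq> snd s \<or> n < p)"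
  unfolding step_vec_cases[OF assms] by auto

text \<open>Factors at n + 1 equal 1, so the auxiliary index disappears and the formula becomes
  uniform in the parity of n.\<close>

lemma step_num_eq:
  fixes x :: "nat \<Rightarrow> 'k::field"
  assumes s: "s \<in> steps n"
  shows "step_num n a x s = (\<Prod>(u, v)\<in>cross_odd n s. x u - x v - a)"
proof -
  obtain i j where ij: "s = (i, j)" "i \<in> odd_idx n" "j \<in> even_idx n" using s by auto
  have i: "odd i" "1 \<le> i" "i \<le> n" and j: "even j" "1 \<le> j" using ij by (auto simp: odd_idx_def even_idx_def)
  note st = step_vec_eq_iff[OF s, unfolded ij fst_conv snd_conv]
  let ?h = "\<lambda>(u, v). x u - x v - a"
  have 1: "(\<Prod>q\<in>even_idx n - {j}. node_diff n a x i q) = (\<Prod>t\<in>{t \<in> cross_odd n s. fst t = i}. ?h t)"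
  proof -
    have "(\<Prod>q\<in>even_idx n - {j}. node_diff n a x i q) = (\<Prod>q\<in>{q \<in> even_idx n - {j}. q \<noteq> Suc n}. node_diff n a x i q)"
      by (rule prod.mono_neutral_right) (auto simp: node_diff_def)
    also have "\<dots> = (\<Prod>t\<in>{t \<in> cross_odd n s. fst t = i}. ?h t)"
      by (rule prod.reindex_bij_witness[of _ snd "\<lambda>q. (i, q)"])
         (use i j in \<open>auto simp: node_diff_def even_idx_def cross_odd_def ij st\<close>)
    finally show ?thesis .
  qed
  have 2: "(\<Prod>q\<in>odd_idx n - {i}. node_diff n a x j q) = (\<Prod>t\<in>{t \<in> cross_odd n s. fst t = j}. ?h t)"
  proof -
    have "(\<Prod>q\<in>odd_idx n - {i}. node_diff n a x j q) = (\<Prod>q\<in>{q \<in> odd_idx n - {i}. j \<noteq> Suc n}. node_diff n a x j q)"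
      by (rule prod.mono_neutral_right) (auto simp: node_diff_def)
    also have "\<dots> = (\<Prod>t\<in>{t \<in> cross_odd n s. fst t = j}. ?h t)"
      by (rule prod.reindex_bij_witness[of _ snd "\<lambda>q. (j, q)"])
         (use i j ij in \<open>auto simp: node_diff_def odd_idx_def even_idx_def cross_odd_def st\<close>)
    finally show ?thesis .
  qed
  have "cross_odd n s = {t \<in> cross_odd n s. fst t = i} \<union> {t \<in> cross_odd n s. fst t = j}"
    by (auto simp: cross_odd_def ij st)
  moreover have "{t \<in> cross_odd n s. fst t = i} \<inter> {t \<in> cross_odd n s. fst t = j} = {}" using i j by auto
  moreover have "finite {t \<in> cross_odd n s. fst t = i}" "finite {t \<in> cross_odd n s. fst t = j}" by simp_all
  ultimately have "(\<Prod>t\<in>cross_odd n s. ?h t) = (\<Prod>t\<in>{t \<in> cross_odd n s. fst t = i}. ?h t) * (\<Prod>t\<in>{t \<in> cross_odd n s. fst t = j}. ?h t)"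
    by (metis (no_types, lifting) prod.union_disjoint)
  then show ?thesis by (simp only: step_num_def ij fst_conv snd_conv 1[unfolded ij] 2[unfolded ij])
qed

lemma step_den_eq_cross_even:
  fixes x :: "nat \<Rightarrow> 'k::field"
  assumes s: "s \<in> steps n"
  shows "step_den n x s = (\<Prod>(u, v)\<in>cross_even n s. x u - x v)"
proof -
  have par: "odd (fst s)" "even (snd s)" using s by (auto simp: odd_idx_def even_idx_def)
  have "{t \<in> parity_pairs n. fst t \<in> {fst s, snd s}} = cross_even n s"
    using par by (auto simp: parity_pairs_def cross_even_def step_vec_eq_iff[OF s])
  then show ?thesis unfolding step_den_eq[OF s] by simp
qed

text \<open>Only pairs with exactly one moved index contribute. Reorienting each of them so that the
  moved index comes first turns a product over p < q into one matching
  \<open>step_num_eq\<close>.\<close>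

lemma prod_pairs_mixed:
  fixes f k :: "nat \<Rightarrow> nat \<Rightarrow> 'k::field"
  assumes "finite P" and P: "\<And>p q. (p, q) \<in> P \<Longrightarrow> p < q"
    and X: "\<And>u v. (u, v) \<in> X \<longleftrightarrow> ((u, v) \<in> P \<or> (v, u) \<in> P) \<and> t u = 1 \<and> t v = 0"
    and t: "\<And>p. t p \<le> (1::nat)"
    and f1: "\<And>p q. (p, q) \<in> P \<Longrightarrow> t p = t q \<Longrightarrow> f p q = 1"
    and f2: "\<And>p q. (p, q) \<in> P \<Longrightarrow> t p = 1 \<Longrightarrow> t q = 0 \<Longrightarrow> f p q = k p q"
    and f3: "\<And>p q. (p, q) \<in> P \<Longrightarrow> t p = 0 \<Longrightarrow> t q = 1 \<Longrightarrow> f p q = k q p"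
  shows "(\<Prod>(p, q)\<in>P. f p q) = (\<Prod>(u, v)\<in>X. k u v)"
proof -
  have "(\<Prod>(p, q)\<in>P. f p q) = (\<Prod>(p, q)\<in>{s \<in> P. t (fst s) \<noteq> t (snd s)}. f p q)"
    using assms(1) by (intro prod.mono_neutral_right) (auto simp: f1)
  also have "\<dots> = (\<Prod>(u, v)\<in>X. k u v)"
  proof (rule prod.reindex_bij_witness[of _ "\<lambda>(u, v). (min u v, max u v)" "\<lambda>(p, q). if t p = 1 then (p, q) else (q, p)"])
    fix a assume "a \<in> {s \<in> P. t (fst s) \<noteq> t (snd s)}"
    then obtain p q where a: "a = (p, q)" "(p, q) \<in> P" "t p \<noteq> t q" by (cases a) auto
    have pq: "p < q" by (rule P[OF a(2)])
    have c: "t p = 1 \<and> t q = 0 \<or> t p = 0 \<and> t q = 1" using t[of p] t[of q] a(3) by linarith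
    then show "(case case a of (p, q) \<Rightarrow> if t p = 1 then (p, q) else (q, p) of (u, v) \<Rightarrow> (min u v, max u v)) = a"
      "(case a of (p, q) \<Rightarrow> if t p = 1 then (p, q) else (q, p)) \<in> X"
      "(case case a of (p, q) \<Rightarrow> if t p = 1 then (p, q) else (q, p) of (u, v) \<Rightarrow> k u v) = (case a of (p, q) \<Rightarrow> f p q)"
      using a pq f2[OF a(2)] f3[OF a(2)] by (auto simp: X min_def max_def)
  next
    fix b assume "b \<in> X"
    then obtain u v where b: "b = (u, v)" "(u, v) \<in> P \<or> (v, u) \<in> P" "t u = 1" "t v = 0"
      by (cases b) (auto simp: X)
    then show "(case case b of (u, v) \<Rightarrow> (min u v, max u v) of (p, q) \<Rightarrow> if t p = 1 then (p, q) else (q, p)) = b"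
      "(case b of (u, v) \<Rightarrow> (min u v, max u v)) \<in> {s \<in> P. t (fst s) \<noteq> t (snd s)}"
      using P[of u v] P[of v u] by (auto simp: min_def max_def)
  qed
  finally show ?thesis .
qed

lemma poch_ratio_Suc:
  fixes a b :: "'k::field"
  shows "pochhammer a (Suc k) / pochhammer b (Suc k) = pochhammer a k / pochhammer b k * ((a + of_nat k) / (b + of_nat k))"
  by (simp add: pochhammer_Suc)

section \<open>Comparison of raising and lowering coefficients\<close>

context param
begin

lemma poch_r_nz: "a > 0 \<Longrightarrow> pochhammer (of_nat a * r) k \<noteq> 0"
proof
  assume "a > 0" "pochhammer (of_nat a * r) k = 0"
  then obtain i where "of_nat a * r = - of_nat i" by (auto simp: pochhammer_eq_0_iff)
  then have "of_nat a * r + of_nat i = 0" by simp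
  then show False using nz[of a i] \<open>a > 0\<close> by simp
qed

lemma B_eq: "B n r \<mu> = (\<Prod>(p, q)\<in>odd_pairs n. pochhammer (of_nat (q - p + 1) * r) (\<mu> p - \<mu> q)) /
     (\<Prod>(p, q)\<in>even_pairs n. pochhammer (of_nat (q - p) * r) (\<mu> p - \<mu> q))"
  by (simp add: B_def odd_pairs_def even_pairs_def)

lemma B_nonzero: "B n r \<mu> \<noteq> 0"
proof -
  have "pochhammer (of_nat (q - p + 1) * r) k \<noteq> 0" for p q k by (rule poch_r_nz) simp
  moreover have "pochhammer (of_nat (q - p) * r) k \<noteq> 0" if "(p, q) \<in> even_pairs n" for p q k
    using that by (intro poch_r_nz) (auto simp: even_pairs_def)
  ultimately show ?thesis by (auto simp: B_eq)
qed

text \<open>The contribution of a pair of odd distance to \<open>B / R_norm\<close>. When the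
  difference of entries grows by 1 it changes by a single linear fraction.\<close>

definition ratio_odd :: "(nat \<Rightarrow> nat) \<Rightarrow> nat \<Rightarrow> nat \<Rightarrow> 'k" where
  "ratio_odd \<mu> p q = pochhammer (of_nat (q - p + 1) * r) (\<mu> p - \<mu> q) / pochhammer (of_nat (q - p - 1) * r + 1) (\<mu> p - \<mu> q)"

definition ratio_even :: "(nat \<Rightarrow> nat) \<Rightarrow> nat \<Rightarrow> nat \<Rightarrow> 'k" where
  "ratio_even \<mu> p q = pochhammer (of_nat (q - p) * r + 1) (\<mu> p - \<mu> q) / pochhammer (of_nat (q - p) * r) (\<mu> p - \<mu> q)"

lemma B_over_N: "B n r \<mu> / R_norm n r \<mu> = (\<Prod>(p, q)\<in>odd_pairs n. ratio_odd \<mu> p q) * (\<Prod>(p, q)\<in>even_pairs n. ratio_even \<mu> p q)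
    / (\<Prod>p\<in>last_class n. pochhammer (of_nat (n - p) * r + 1) (\<mu> p))"
proof -
  have O: "(\<Prod>(p, q)\<in>odd_pairs n. ratio_odd \<mu> p q) = (\<Prod>(p, q)\<in>odd_pairs n. pochhammer (of_nat (q - p + 1) * r) (\<mu> p - \<mu> q))
      / (\<Prod>(p, q)\<in>odd_pairs n. pochhammer (of_nat (q - p - 1) * r + 1) (\<mu> p - \<mu> q))"
    by (simp only: ratio_odd_def case_prod_unfold prod_dividef)
  have E: "(\<Prod>(p, q)\<in>even_pairs n. ratio_even \<mu> p q) = (\<Prod>(p, q)\<in>even_pairs n. pochhammer (of_nat (q - p) * r + 1) (\<mu> p - \<mu> q))
      / (\<Prod>(p, q)\<in>even_pairs n. pochhammer (of_nat (q - p) * r) (\<mu> p - \<mu> q))"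
    by (simp only: ratio_even_def case_prod_unfold prod_dividef)
  show ?thesis unfolding B_eq R_norm_def O E by simp
qed

lemma shifted_diff:
  assumes "p < q" "q \<le> n" "\<mu> q \<le> \<mu> p"
  shows "shifted n r \<mu> p - shifted n r \<mu> q = of_nat (q - p) * r + of_nat (\<mu> p - \<mu> q)"
  using assms by (simp add: shifted_def of_nat_diff algebra_simps)

text \<open>\<open>B / R_norm\<close> is a product over pairs, up to the factors of the last class.
  Along a step each pair with one moved index changes by a linear fraction, and these fractions
  assemble to the quotient of the two step coefficients; the last class supplies the weight. So
  normalising by B makes the raising and the lowering relation have the same coefficients.\<close>

lemma ratio_step:
  assumes l: "lam \<in> \<Lambda> n" and s: "s \<in> down_steps n lam"
  defines "\<kappa> \<equiv> lower n lam s"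
  shows "step_coeff n (- r) (shifted n r \<kappa>) s * (R_norm n r lam / R_norm n r \<kappa>) = down_coeff n r lam s * (B n r lam / B n r \<kappa>)"
proof -
  have sS: "s \<in> steps n" and k: "\<kappa> \<in> \<Lambda> n" and le: "\<And>p. step_vec n s p \<le> lam p"
    using s by (auto simp: down_steps_def \<kappa>_def)
  have lk: "lam p = \<kappa> p + step_vec n s p" for p using le[of p] by (simp add: \<kappa>_def lower_def)
  define x where "x = shifted n r \<kappa>"
  have xl: "shifted n r lam p = x p + of_nat (step_vec n s p)" for p by (simp add: x_def shifted_def lk)
  have mono: "\<mu> q \<le> \<mu> p" if "\<mu> \<in> \<Lambda> n" "1 \<le> p" "p < q" "q \<le> n" for \<mu> p q
    using that by (auto simp: \<Lambda>_def)
  \<comment> \<open>Change of the factor of a pair with u moved and v unmoved, expressed at the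
    lower point \<open>x\<close>; \<open>ke\<close> is its analogue for even distance.\<close>
  define ko where "ko u v = (x u - x v + r) / (x u - x v - r + 1)" for u v
  define ke where "ke u v = (x u - x v + 1) / (x u - x v)" for u v
  define fo where "fo p q = ratio_odd lam p q / ratio_odd \<kappa> p q" for p q
  define fe where "fe p q = ratio_even lam p q / ratio_even \<kappa> p q" for p q
  have nzp: "of_nat a * r + 1 + of_nat b \<noteq> 0" for a b :: nat
    using nz[of a "Suc b"] by (simp add: algebra_simps)
  have ratio_odd_nz: "ratio_odd \<mu> p q \<noteq> 0" for \<mu> p q
    unfolding ratio_odd_def using poch_r_nz[of "q - p + 1"] poch_nz by simp
  have ratio_even_nz: "ratio_even \<mu> p q \<noteq> 0" if "p < q" for \<mu> p q
    unfolding ratio_even_def using poch_r_nz[of "q - p"] poch_nz[of "q - p"] that by simp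
  have O: "(\<Prod>(p, q)\<in>odd_pairs n. fo p q) = (\<Prod>(u, v)\<in>cross_odd n s. ko u v)"
  proof (rule prod_pairs_mixed[where t = "step_vec n s"])
    show "(u, v) \<in> cross_odd n s \<longleftrightarrow> ((u, v) \<in> odd_pairs n \<or> (v, u) \<in> odd_pairs n) \<and> step_vec n s u = 1 \<and> step_vec n s v = 0" for u v
      by (cases u v rule: linorder_cases) (auto simp: cross_odd_def odd_pairs_def)
    show "step_vec n s p \<le> 1" for p by (rule step_vec_le_1[OF sS])
    fix p q assume pq: "(p, q) \<in> odd_pairs n"
    then have c: "1 \<le> p" "p < q" "q \<le> n" by (auto simp: odd_pairs_def)
    show "p < q" by (rule c(2))
    show "fo p q = 1" if "step_vec n s p = step_vec n s q" using that ratio_odd_nz by (simp add: fo_def ratio_odd_def lk)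
    show "fo p q = ko p q" if "step_vec n s p = 1" "step_vec n s q = 0"
    proof -
      define \<delta> where "\<delta> = \<kappa> p - \<kappa> q"
      have d: "lam p - lam q = Suc \<delta>" using mono[OF k c] that by (simp add: lk \<delta>_def)
      have e: "x p - x q = of_nat (q - p) * r + of_nat \<delta>"
        unfolding x_def \<delta>_def by (rule shifted_diff[OF c(2,3) mono[OF k c]])
      have r1: "of_nat (q - p + 1) * r + of_nat \<delta> = x p - x q + r"
        by (simp add: e algebra_simps)
      have r2: "of_nat (q - p - 1) * r + 1 + of_nat \<delta> = x p - x q - r + 1"
        using c by (simp add: e of_nat_diff algebra_simps)
      have "ratio_odd lam p q = ratio_odd \<kappa> p q * ko p q"
        unfolding ratio_odd_def d poch_ratio_Suc \<delta>_def r1[unfolded \<delta>_def] r2[unfolded \<delta>_def] ko_def ..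
      then show ?thesis using ratio_odd_nz[of \<kappa> p q] by (simp add: fo_def)
    qed
    \<comment> \<open>Here raising the right entry decreases the difference, so the fraction is
      inverted. Both linear terms also change sign, which cancels in the quotient.\<close>
    show "fo p q = ko q p" if "step_vec n s p = 0" "step_vec n s q = 1"
    proof -
      define \<delta> where "\<delta> = lam p - lam q"
      have d: "\<kappa> p - \<kappa> q = Suc \<delta>" using mono[OF l c] that by (simp add: lk \<delta>_def)
      have e: "x p - x q = of_nat (q - p) * r + of_nat (Suc \<delta>)"
        unfolding x_def d[symmetric] by (rule shifted_diff[OF c(2,3) mono[OF k c]])
      have r1: "of_nat (q - p + 1) * r + of_nat \<delta> = - (x q - x p - r + 1)"
        using e by (simp add: algebra_simps)
      have r2: "of_nat (q - p - 1) * r + 1 + of_nat \<delta> = - (x q - x p + r)"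
        using c e by (simp add: of_nat_diff algebra_simps)
      have "ratio_odd \<kappa> p q = ratio_odd lam p q * ((x q - x p - r + 1) / (x q - x p + r))"
        unfolding ratio_odd_def d poch_ratio_Suc \<delta>_def r1[unfolded \<delta>_def] r2[unfolded \<delta>_def] minus_divide_divide ..
      then show ?thesis using ratio_odd_nz[of lam p q] by (simp add: fo_def ko_def)
    qed
  qed simp
  have E: "(\<Prod>(p, q)\<in>even_pairs n. fe p q) = (\<Prod>(u, v)\<in>cross_even n s. ke u v)"
  proof (rule prod_pairs_mixed[where t = "step_vec n s"])
    show "(u, v) \<in> cross_even n s \<longleftrightarrow> ((u, v) \<in> even_pairs n \<or> (v, u) \<in> even_pairs n) \<and> step_vec n s u = 1 \<and> step_vec n s v = 0" for u v
      by (cases u v rule: linorder_cases) (auto simp: cross_even_def even_pairs_def)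
    show "step_vec n s p \<le> 1" for p by (rule step_vec_le_1[OF sS])
    fix p q assume pq: "(p, q) \<in> even_pairs n"
    then have c: "1 \<le> p" "p < q" "q \<le> n" by (auto simp: even_pairs_def)
    show "p < q" by (rule c(2))
    show "fe p q = 1" if "step_vec n s p = step_vec n s q" using that ratio_even_nz[OF c(2), of \<kappa>] by (simp add: fe_def ratio_even_def lk)
    show "fe p q = ke p q" if "step_vec n s p = 1" "step_vec n s q = 0"
    proof -
      define \<delta> where "\<delta> = \<kappa> p - \<kappa> q"
      have d: "lam p - lam q = Suc \<delta>" using mono[OF k c] that by (simp add: lk \<delta>_def)
      have e: "x p - x q = of_nat (q - p) * r + of_nat \<delta>"
        unfolding x_def \<delta>_def by (rule shifted_diff[OF c(2,3) mono[OF k c]])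
      have r1: "of_nat (q - p) * r + 1 + of_nat \<delta> = x p - x q + 1"
        by (simp add: e algebra_simps)
      have "ratio_even lam p q = ratio_even \<kappa> p q * ke p q"
        unfolding ratio_even_def d poch_ratio_Suc \<delta>_def r1[unfolded \<delta>_def] e[unfolded \<delta>_def, symmetric] ke_def ..
      then show ?thesis using ratio_even_nz[OF c(2), of \<kappa>] by (simp add: fe_def)
    qed
    show "fe p q = ke q p" if "step_vec n s p = 0" "step_vec n s q = 1"
    proof -
      define \<delta> where "\<delta> = lam p - lam q"
      have d: "\<kappa> p - \<kappa> q = Suc \<delta>" using mono[OF l c] that by (simp add: lk \<delta>_def)
      have e: "x p - x q = of_nat (q - p) * r + of_nat (Suc \<delta>)"
        unfolding x_def d[symmetric] by (rule shifted_diff[OF c(2,3) mono[OF k c]])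
      have r1: "of_nat (q - p) * r + 1 + of_nat \<delta> = - (x q - x p)"
        using e by (simp add: algebra_simps)
      have r2: "of_nat (q - p) * r + of_nat \<delta> = - (x q - x p + 1)"
        using e by (simp add: algebra_simps)
      have "ratio_even \<kappa> p q = ratio_even lam p q * ((x q - x p) / (x q - x p + 1))"
        unfolding ratio_even_def d poch_ratio_Suc \<delta>_def r1[unfolded \<delta>_def] r2[unfolded \<delta>_def] minus_divide_divide ..
      then show ?thesis using ratio_even_nz[OF c(2), of lam] by (simp add: fe_def ke_def)
    qed
  qed simp
  \<comment> \<open>The moved index of the last class. Its Pochhammer symbol gains the factor
    \<open>x c + 1\<close>, which is the value of the weight at the upper point.\<close>
  define c where "c = (if odd n then fst s else snd s)"
  have cC: "c \<in> last_class n" "step_vec n s c = 1"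
    using sS by (auto simp: c_def last_class_def odd_idx_def even_idx_def step_vec_def le_Suc_eq)
  have c1: "x c + 1 \<noteq> 0"
    using nz[of "n - c" "Suc (\<kappa> c)"] by (simp add: x_def shifted_def add.assoc add.commute)
  have last_class: "(\<Prod>p\<in>last_class n. pochhammer (of_nat (n - p) * r + 1) (lam p))
      = (\<Prod>p\<in>last_class n. pochhammer (of_nat (n - p) * r + 1) (\<kappa> p)) * (x c + 1)"
  proof -
    have "(\<Prod>p\<in>last_class n. pochhammer (of_nat (n - p) * r + 1) (lam p))
        = (\<Prod>p\<in>last_class n. pochhammer (of_nat (n - p) * r + 1) (\<kappa> p) * (if p = c then x c + 1 else 1))"
    proof (rule prod.cong[OF refl])
      fix p assume p: "p \<in> last_class n"
      show "pochhammer (of_nat (n - p) * r + 1) (lam p)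
          = pochhammer (of_nat (n - p) * r + 1) (\<kappa> p) * (if p = c then x c + 1 else 1)"
      proof (cases "p = c")
        case True
        then show ?thesis using cC(2) by (simp add: lk pochhammer_Suc x_def shifted_def add_ac)
      next
        case False
        then have "step_vec n s p = 0"
          using p sS unfolding step_vec_eq_iff(2)[OF sS] by (auto simp: c_def last_class_def odd_idx_def even_idx_def split: if_splits)
        then show ?thesis using False by (simp add: lk)
      qed
    qed
    also have "\<dots> = (\<Prod>p\<in>last_class n. pochhammer (of_nat (n - p) * r + 1) (\<kappa> p)) * (x c + 1)"
      using cC(1) by (simp add: prod.distrib)
    finally show ?thesis .
  qed
  \<comment> \<open>\<open>NU / DE\<close> is the raising coefficient at the lower point.
    \<open>DU / NE\<close> is the lowering coefficient without weight at the upper point, where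
    moved coordinates are larger by 1.\<close>
  define NU where "NU = (\<Prod>(u, v)\<in>cross_odd n s. x u - x v + r)"
  define DU where "DU = (\<Prod>(u, v)\<in>cross_odd n s. x u - x v - r + 1)"
  define NE where "NE = (\<Prod>(u, v)\<in>cross_even n s. x u - x v + 1)"
  define DE where "DE = (\<Prod>(u, v)\<in>cross_even n s. x u - x v)"
  have gk: "step_coeff n (- r) x s = NU / DE"
    by (simp add: step_coeff_def step_num_eq[OF sS] step_den_eq_cross_even[OF sS] NU_def DE_def)
  have gl: "step_coeff n r (shifted n r lam) s = DU / NE"
  proof -
    have "(\<Prod>(u, v)\<in>cross_odd n s. shifted n r lam u - shifted n r lam v - r) = DU"
      unfolding DU_def by (rule prod.cong) (auto simp: xl cross_odd_def)
    moreover have "(\<Prod>(u, v)\<in>cross_even n s. shifted n r lam u - shifted n r lam v) = NE"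
      unfolding NE_def by (rule prod.cong) (auto simp: xl cross_even_def)
    ultimately show ?thesis by (simp add: step_coeff_def step_num_eq[OF sS] step_den_eq_cross_even[OF sS])
  qed
  have NE0: "NE \<noteq> 0"
  proof -
    have "NE = step_den n (shifted n r lam) s"
      unfolding NE_def step_den_eq_cross_even[OF sS] by (rule prod.cong) (auto simp: xl cross_even_def)
    then show ?thesis using step_den_nonzero[OF sS generic_shifted[OF l]] by simp
  qed
  have DU0: "DU \<noteq> 0"
  proof -
    have "x u - x v - r + 1 \<noteq> 0" if uv: "(u, v) \<in> cross_odd n s" for u v
    proof (cases "u < v")
      case True
      have c: "1 \<le> u" "u < v" "v \<le> n" using uv True by (auto simp: cross_odd_def)
      have "x u - x v - r + 1 = of_nat (v - u - 1) * r + 1 + of_nat (\<kappa> u - \<kappa> v)"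
        using shifted_diff[OF c(2,3) mono[OF k c]] c by (simp add: x_def of_nat_diff algebra_simps)
      then show ?thesis by (simp only:) (rule nzp)
    next
      case False
      then have c: "1 \<le> v" "v < u" "u \<le> n" and st: "step_vec n s u = 1" "step_vec n s v = 0"
        using uv by (cases u v rule: linorder_cases, auto simp: cross_odd_def)+
      define \<delta> where "\<delta> = lam v - lam u"
      have "\<kappa> v - \<kappa> u = Suc \<delta>" using mono[OF l c] st by (simp add: lk \<delta>_def)
      then have "x v - x u = of_nat (u - v) * r + of_nat (Suc \<delta>)"
        using shifted_diff[OF c(2,3) mono[OF k c]] by (simp add: x_def)
      then have "- (x u - x v - r + 1) = of_nat (u - v + 1) * r + of_nat \<delta>"
        by (simp add: algebra_simps)
      then have "- (x u - x v - r + 1) \<noteq> 0" by (simp only:) (rule nz, simp)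
      then show ?thesis unfolding neg_equal_0_iff_equal .
    qed
    then show ?thesis by (auto simp: DU_def)
  qed
  have kO: "(\<Prod>(u, v)\<in>cross_odd n s. ko u v) = NU / DU"
    by (simp only: ko_def NU_def DU_def case_prod_unfold prod_dividef)
  have kE: "(\<Prod>(u, v)\<in>cross_even n s. ke u v) = NE / DE"
    by (simp only: ke_def NE_def DE_def case_prod_unfold prod_dividef)
  have FOl: "(\<Prod>(p, q)\<in>odd_pairs n. ratio_odd lam p q) = (\<Prod>(p, q)\<in>odd_pairs n. ratio_odd \<kappa> p q) * (NU / DU)"
  proof -
    have "(\<Prod>(p, q)\<in>odd_pairs n. ratio_odd lam p q) = (\<Prod>(p, q)\<in>odd_pairs n. ratio_odd \<kappa> p q * fo p q)"
      by (rule prod.cong) (auto simp: fo_def ratio_odd_nz)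
    then show ?thesis by (simp only: case_prod_unfold prod.distrib O[unfolded case_prod_unfold] kO[unfolded case_prod_unfold])
  qed
  have FEl: "(\<Prod>(p, q)\<in>even_pairs n. ratio_even lam p q) = (\<Prod>(p, q)\<in>even_pairs n. ratio_even \<kappa> p q) * (NE / DE)"
  proof -
    have "(\<Prod>(p, q)\<in>even_pairs n. ratio_even lam p q) = (\<Prod>(p, q)\<in>even_pairs n. ratio_even \<kappa> p q * fe p q)"
      by (rule prod.cong) (auto simp: fe_def ratio_even_nz even_pairs_def)
    then show ?thesis by (simp only: case_prod_unfold prod.distrib E[unfolded case_prod_unfold] kE[unfolded case_prod_unfold])
  qed
  have Q: "B n r lam / R_norm n r lam = B n r \<kappa> / R_norm n r \<kappa> * (NU / DU) * (NE / DE) / (x c + 1)"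
    unfolding B_over_N FOl FEl last_class by (simp only: divide_inverse inverse_mult_distrib ac_simps)
  have ccl: "down_coeff n r lam s = (x c + 1) * (DU / NE)"
  proof -
    have "step_weight n s = (Var c :: 'k mvpoly)" by (simp add: step_weight_def c_def)
    then show ?thesis using cC(2) by (simp add: down_coeff_def gl xl)
  qed
  have "down_coeff n r lam s * (B n r lam / R_norm n r lam) = step_coeff n (- r) x s * (B n r \<kappa> / R_norm n r \<kappa>)"
    unfolding Q ccl gk using c1 NE0 DU0 by (simp add: mult.commute)
  then show ?thesis
    unfolding x_def using R_norm_nonzero[of n lam] R_norm_nonzero[of n \<kappa>] B_nonzero[of n \<kappa>]
    by (simp add: field_simps)
qed

end

section \<open>The binomial formula\<close>

lemma odd_size_mono: "preceq n \<mu> lam \<Longrightarrow> odd_size n \<mu> \<le> odd_size n lam"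
  unfolding odd_size_odd_idx preceq_def by (rule sum_mono) (auto simp: odd_idx_def)

definition even_size :: "nat \<Rightarrow> (nat \<Rightarrow> nat) \<Rightarrow> nat" where
  "even_size n \<mu> = (\<Sum>j | j \<in> {1..n} \<and> even j. \<mu> j)"

lemma alt_1: "alt n \<mu> 1 = int (odd_size n \<mu>) - int (even_size n \<mu>)"
proof -
  have "alt n \<mu> 1 = (\<Sum>j=1..n. (if odd j then int (\<mu> j) else 0) - (if even j then int (\<mu> j) else 0))"
    unfolding alt_def by (rule sum.cong) (auto simp: minus_one_power_iff)
  also have "\<dots> = (\<Sum>j\<in>{j \<in> {1..n}. odd j}. int (\<mu> j)) - (\<Sum>j\<in>{j \<in> {1..n}. even j}. int (\<mu> j))"
    unfolding sum_subtractf by (simp only: sum.inter_filter finite_atLeastAtMost)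
  finally show ?thesis by (simp only: odd_size_def even_size_def of_nat_sum)
qed

text \<open>For odd n both sizes coincide. For even n the class consists of the even indices, and
  equality of the alternating sums says that odd and even size change by the same amount.\<close>

lemma class_size_diff:
  assumes "even n \<longrightarrow> alt n \<mu> 1 = alt n lam 1"
  shows "int (class_size n lam) - int (class_size n \<mu>) = int (odd_size n lam) - int (odd_size n \<mu>)"
proof (cases "even n")
  case True
  then have C: "last_class n = {j. j \<in> {1..n} \<and> even j}" by (auto simp: last_class_def)
  have "class_size n \<nu> = even_size n \<nu>" for \<nu> unfolding class_size_def even_size_def C ..
  then show ?thesis using assms True unfolding alt_1 by simp
next
  case False
  then have "last_class n = odd_idx n" by (auto simp: last_class_def odd_idx_def)
  then show ?thesis by (simp add: class_size_def odd_size_odd_idx)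
qed

text \<open>A step takes 1 from the odd size and at most 1 from the even size, and exactly 1 if n is
  even, since then no step uses the index n + 1.\<close>

lemma alt_lower:
  assumes "s \<in> down_steps n lam"
  shows "alt n (lower n lam s) 1 \<le> alt n lam 1"
    and "even n \<Longrightarrow> alt n (lower n lam s) 1 = alt n lam 1"
proof -
  have sS: "s \<in> steps n" using assms by (simp add: down_steps_def)
  let ?E = "{j. j \<in> {1..n} \<and> even j}"
  have l: "lam j = lower n lam s j + step_vec n s j" for j using assms by (simp add: down_steps_def lower_def)
  have "(\<Sum>j\<in>?E. lam j) = (\<Sum>j\<in>?E. lower n lam s j + step_vec n s j)" by (rule sum.cong[OF refl l])
  also have "\<dots> = even_size n (lower n lam s) + (\<Sum>j\<in>?E. step_vec n s j)"
    by (simp only: sum.distrib even_size_def)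
  also have "(\<Sum>j\<in>?E. step_vec n s j) = (\<Sum>j\<in>?E. if j = snd s then 1 else 0)"
    by (rule sum.cong) (use sS in \<open>auto simp: step_vec_cases[OF sS] odd_idx_def\<close>)
  also have "\<dots> = (if snd s \<in> ?E then 1 else 0)" by (rule sum.delta) simp
  finally have e: "even_size n lam = even_size n (lower n lam s) + (if snd s \<in> ?E then 1 else 0)"
    unfolding even_size_def[of n lam] .
  show "alt n (lower n lam s) 1 \<le> alt n lam 1"
    unfolding alt_1 e odd_size_lower[OF assms] by simp
  assume "even n"
  then have "snd s \<in> ?E" using sS by (auto simp: even_idx_def le_Suc_eq)
  then show "alt n (lower n lam s) 1 = alt n lam 1"
    unfolding alt_1 e odd_size_lower[OF assms] by simp
qed

section \<open>Derivatives along a line\<close>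

lemma pderiv_sum': "pderiv (\<Sum>a\<in>A. f a) = (\<Sum>a\<in>A. pderiv (f a))"
  for f :: "_ \<Rightarrow> 'k::field_char_0 poly"
  by (induction A rule: infinite_finite_induct) (simp_all add: pderiv_add)

text \<open>Recentring the line at parameter u turns its derivative there into a linear
  coefficient.\<close>

lemma poly_pderiv_line:
  fixes p :: "'k::field_char_0 mvpoly"
  shows "poly (pderiv (line p x v)) u = coeff (line p (\<lambda>i. x i + u * v i) v) 1"
proof -
  have "coeff (pcompose (line p x v) [:u, 1:]) 1 = coeff (pderiv (pcompose (line p x v) [:u, 1:])) 0"
    by (simp add: coeff_pderiv)
  also have "\<dots> = poly (pderiv (line p x v)) u"
    by (simp add: pderiv_pcompose poly_pcompose pderiv_pCons flip: poly_0_coeff_0)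
  finally show ?thesis by (simp add: line_pcompose)
qed

lemma poly_eqI_pderiv:
  fixes p q :: "'k::field_char_0 poly"
  assumes "pderiv p = pderiv q" "poly p 0 = poly q 0"
  shows "p = q"
proof -
  have "pderiv (p - q) = 0" using assms(1) by (simp add: pderiv_diff)
  then have "degree (p - q) = 0" by (simp add: pderiv_eq_0_iff)
  then obtain c where c: "p - q = [:c:]" by (rule degree_eq_zeroE)
  have "poly (p - q) 0 = 0" using assms(2) by simp
  then have "p - q = 0" by (simp add: c)
  then show ?thesis by simp
qed

section \<open>Generalised binomial coefficients and the differential system\<close>

context param
begin

definition binom_coeff :: "nat \<Rightarrow> (nat \<Rightarrow> nat) \<Rightarrow> (nat \<Rightarrow> nat) \<Rightarrow> 'k" where
  "binom_coeff n \<mu> lam = eval_at (shifted n r lam) (R n r \<mu>) / eval_at (shifted n r \<mu>) (R n r \<mu>)"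

lemma binom_coeff_self: "\<mu> \<in> \<Lambda> n \<Longrightarrow> binom_coeff n \<mu> \<mu> = 1"
  using R_facts(4)[of \<mu> n] R_norm_nonzero[of n \<mu>] by (simp add: binom_coeff_def)

lemma binom_coeff_eq_0:
  "\<mu> \<in> \<Lambda> n \<Longrightarrow> lam \<in> \<Lambda> n \<Longrightarrow> odd_size n lam \<le> odd_size n \<mu> \<Longrightarrow> lam \<noteq> \<mu> \<Longrightarrow> binom_coeff n \<mu> lam = 0"
  using R_facts(3)[of \<mu> n lam] by (simp add: binom_coeff_def)

lemma binom_coeff_recursion:
  assumes m: "\<mu> \<in> \<Lambda> n" and l: "lam \<in> \<Lambda> n" and alt: "even n \<longrightarrow> alt n \<mu> 1 = alt n lam 1"
  shows "of_nat (odd_size n lam - odd_size n \<mu>) * binom_coeff n \<mu> lam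
    = (\<Sum>s\<in>down_steps n lam. down_coeff n r lam s * binom_coeff n \<mu> (lower n lam s))"
proof -
  have "of_nat (class_size n lam) - of_nat (class_size n \<mu>) = (of_int (int (class_size n lam) - int (class_size n \<mu>)) :: 'k)" by simp
  also have "\<dots> = of_nat (odd_size n lam) - of_nat (odd_size n \<mu>)" unfolding class_size_diff[OF alt] by simp
  finally have e: "of_nat (class_size n lam) - of_nat (class_size n \<mu>) = (of_nat (odd_size n lam) - of_nat (odd_size n \<mu>) :: 'k)" .
  have "(\<Sum>s\<in>down_steps n lam. down_coeff n r lam s * binom_coeff n \<mu> (lower n lam s))
      = (\<Sum>s\<in>down_steps n lam. down_coeff n r lam s * eval_at (shifted n r (lower n lam s)) (R n r \<mu>)) / eval_at (shifted n r \<mu>) (R n r \<mu>)"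
    by (simp add: binom_coeff_def sum_divide_distrib)
  also have "\<dots> = (of_nat (odd_size n lam) - of_nat (odd_size n \<mu>)) * binom_coeff n \<mu> lam"
    unfolding R_recursion[OF m l, symmetric] e by (simp add: binom_coeff_def)
  also have "\<dots> = of_nat (odd_size n lam - odd_size n \<mu>) * binom_coeff n \<mu> lam"
  \<comment> \<open>If the natural subtraction truncates, the binomial coefficient itself is
    0.\<close>
  proof (cases "odd_size n \<mu> \<le> odd_size n lam")
    case False
    then have "binom_coeff n \<mu> lam = 0" using m l by (intro binom_coeff_eq_0) auto
    then show ?thesis by simp
  qed (simp add: of_nat_diff)
  finally show ?thesis by simp
qed

text \<open>A non-zero coefficient needs a non-zero summand in the recursion, hence a chain of legal
  steps from lam down to \<mu>. Each of them lowers entries and does not increase the alternating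
  sum. This yields the range of summation.\<close>

lemma binom_coeff_nonzero_preceq:
  assumes m: "\<mu> \<in> \<Lambda> n"
  shows "lam \<in> \<Lambda> n \<Longrightarrow> (even n \<longrightarrow> alt n \<mu> 1 = alt n lam 1) \<Longrightarrow> binom_coeff n \<mu> lam \<noteq> 0 \<Longrightarrow> preceq n \<mu> lam"
proof (induction "odd_size n lam" arbitrary: lam rule: less_induct)
  case less
  show ?case
  proof (cases "lam = \<mu>")
    case False
    then have "odd_size n \<mu> < odd_size n lam" using binom_coeff_eq_0[OF m less.prems(1)] less.prems(3) by force
    then have "of_nat (odd_size n lam - odd_size n \<mu>) * binom_coeff n \<mu> lam \<noteq> 0" using less.prems(3) by simp
    then have "(\<Sum>s\<in>down_steps n lam. down_coeff n r lam s * binom_coeff n \<mu> (lower n lam s)) \<noteq> 0"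
      unfolding binom_coeff_recursion[OF m less.prems(1,2)] .
    from sum.not_neutral_contains_not_neutral[OF this]
    obtain s where s: "s \<in> down_steps n lam" "down_coeff n r lam s * binom_coeff n \<mu> (lower n lam s) \<noteq> 0" .
    have "preceq n \<mu> (lower n lam s)"
    proof (rule less.hyps)
      show "odd_size n (lower n lam s) < odd_size n lam" using odd_size_lower[OF s(1)] by simp
      show "lower n lam s \<in> \<Lambda> n" using s(1) by (simp add: down_steps_def)
      show "even n \<longrightarrow> alt n \<mu> 1 = alt n (lower n lam s) 1"
        using less.prems(2) alt_lower(2)[OF s(1)] by simp
      show "binom_coeff n \<mu> (lower n lam s) \<noteq> 0" using s(2) by simp
    qed
    then show ?thesis
      using alt_lower(1)[OF s(1)] by (auto simp: preceq_def lower_def intro: order.trans)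
  qed (simp add: preceq_def)
qed

text \<open>Both sides, restricted to the line \<open>u \<mapsto> x + u(1,\<dots>,1)\<close>, solve the same
  triangular system of differential equations in \<open>u\<close>.\<close>

lemma binomial_line:
  fixes x :: "nat \<Rightarrow> 'k"
  assumes x: "generic n x" and l: "lam \<in> \<Lambda> n" "odd_size n lam \<le> D" "even n \<longrightarrow> alt n lam 1 = c"
  defines "M \<equiv> {\<mu> \<in> \<Lambda> n. odd_size n \<mu> \<le> D \<and> (even n \<longrightarrow> alt n \<mu> 1 = c)}"
  shows "smult (1 / B n r lam) (line (R_top n r lam) x (\<lambda>_. 1))
    = (\<Sum>\<mu>\<in>M. monom (binom_coeff n \<mu> lam * (eval_at x (R_top n r \<mu>) / B n r \<mu>)) (odd_size n lam - odd_size n \<mu>))"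
  using l
proof (induction "odd_size n lam" arbitrary: lam rule: less_induct)
  case less
  note l = less.prems
  define g where "g \<nu> = smult (1 / B n r \<nu>) (line (R_top n r \<nu>) x (\<lambda>_. 1))" for \<nu>
  define \<rho> where "\<rho> \<mu> = eval_at x (R_top n r \<mu>) / B n r \<mu>" for \<mu>
  define h where "h \<nu> = (\<Sum>\<mu>\<in>M. monom (binom_coeff n \<mu> \<nu> * \<rho> \<mu>) (odd_size n \<nu> - odd_size n \<mu>))" for \<nu>
  have finM: "finite M" by (rule finite_subset[OF _ finite_Lambda[of n D]]) (auto simp: M_def)
  have IH: "g (lower n lam s) = h (lower n lam s)" if s: "s \<in> down_steps n lam" for s
    unfolding g_def h_def \<rho>_def
  proof (rule less.hyps)
    show "odd_size n (lower n lam s) < odd_size n lam" "odd_size n (lower n lam s) \<le> D"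
      using odd_size_lower[OF s] l(2) by simp_all
    show "lower n lam s \<in> \<Lambda> n" using s by (simp add: down_steps_def)
    show "even n \<longrightarrow> alt n (lower n lam s) 1 = c" using l(3) alt_lower(2)[OF s] by simp
  qed
  have dg: "pderiv (g lam) = (\<Sum>s\<in>down_steps n lam. smult (down_coeff n r lam s) (g (lower n lam s)))"
  proof (rule poly_eq_poly_eq_iff[THEN iffD1], rule ext)
    fix u :: 'k
    let ?y = "\<lambda>i. x i + u * 1"
    \<comment> \<open>Adding the same number to all coordinates preserves their differences, so the
      derivative formula applies along the entire line.\<close>
    have y: "generic n ?y" using x by (simp add: generic_def)
    have "poly (pderiv (g lam)) u = 1 / B n r lam * coeff (line (R_top n r lam) ?y (\<lambda>_. 1)) 1"
      unfolding g_def pderiv_smult poly_smult poly_pderiv_line ..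
    also have "\<dots> = (\<Sum>s\<in>down_steps n lam. 1 / B n r lam * (down_coeff n r lam s * (B n r lam / B n r (lower n lam s)) * eval_at ?y (R_top n r (lower n lam s))))"
      unfolding R_top_derivative[OF l(1) y] sum_distrib_left
      by (rule sum.cong[OF refl]) (simp only: ratio_step[OF l(1)])
    also have "\<dots> = (\<Sum>s\<in>down_steps n lam. poly (smult (down_coeff n r lam s) (g (lower n lam s))) u)"
      using B_nonzero[of n lam] by (intro sum.cong refl) (simp add: g_def poly_line)
    finally show "poly (pderiv (g lam)) u = poly (\<Sum>s\<in>down_steps n lam. smult (down_coeff n r lam s) (g (lower n lam s))) u"
      by (simp add: poly_sum)
  qed
  have dh: "pderiv (h lam) = (\<Sum>s\<in>down_steps n lam. smult (down_coeff n r lam s) (h (lower n lam s)))"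
  proof -
    have "pderiv (h lam) = (\<Sum>\<mu>\<in>M. pderiv (monom (binom_coeff n \<mu> lam * \<rho> \<mu>) (odd_size n lam - odd_size n \<mu>)))"
      by (simp add: h_def pderiv_sum')
    also have "\<dots> = (\<Sum>\<mu>\<in>M. \<Sum>s\<in>down_steps n lam. smult (down_coeff n r lam s)
        (monom (binom_coeff n \<mu> (lower n lam s) * \<rho> \<mu>) (odd_size n (lower n lam s) - odd_size n \<mu>)))"
    proof (rule sum.cong[OF refl])
      fix \<mu> assume m: "\<mu> \<in> M"
      let ?e = "odd_size n lam - odd_size n \<mu>"
      have "pderiv (monom (binom_coeff n \<mu> lam * \<rho> \<mu>) ?e) = monom ((of_nat ?e * binom_coeff n \<mu> lam) * \<rho> \<mu>) (?e - 1)"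
        by (simp add: pderiv_monom)
      also have "of_nat ?e * binom_coeff n \<mu> lam = (\<Sum>s\<in>down_steps n lam. down_coeff n r lam s * binom_coeff n \<mu> (lower n lam s))"
        using m l by (intro binom_coeff_recursion) (auto simp: M_def)
      also have "monom ((\<Sum>s\<in>down_steps n lam. down_coeff n r lam s * binom_coeff n \<mu> (lower n lam s)) * \<rho> \<mu>) (?e - 1)
          = (\<Sum>s\<in>down_steps n lam. smult (down_coeff n r lam s) (monom (binom_coeff n \<mu> (lower n lam s) * \<rho> \<mu>) (?e - 1)))"
        by (simp add: sum_distrib_right smult_monom monom_sum mult.assoc)
      \<comment> \<open>A step lowers the size by one, so the exponents agree, also where the
        subtraction truncates.\<close>
      also have "\<dots> = (\<Sum>s\<in>down_steps n lam. smult (down_coeff n r lam s)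
          (monom (binom_coeff n \<mu> (lower n lam s) * \<rho> \<mu>) (odd_size n (lower n lam s) - odd_size n \<mu>)))"
        by (rule sum.cong[OF refl]) (simp add: odd_size_lower)
      finally show "pderiv (monom (binom_coeff n \<mu> lam * \<rho> \<mu>) ?e) = (\<Sum>s\<in>down_steps n lam. smult (down_coeff n r lam s)
          (monom (binom_coeff n \<mu> (lower n lam s) * \<rho> \<mu>) (odd_size n (lower n lam s) - odd_size n \<mu>)))" .
    qed
    also have "\<dots> = (\<Sum>s\<in>down_steps n lam. smult (down_coeff n r lam s) (h (lower n lam s)))"
      by (subst sum.swap) (simp add: h_def poly_eq_iff coeff_sum sum_distrib_left)
    finally show ?thesis .
  qed
  \<comment> \<open>At u = 0 terms of positive exponent vanish. A term with exponent 0 has \<mu> at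
    least as large as lam, so its coefficient is 0 unless the two are equal.\<close>
  have "poly (h lam) 0 = \<rho> lam"
  proof -
    have "poly (h lam) 0 = (\<Sum>\<mu>\<in>M. if \<mu> = lam then \<rho> lam else 0)"
      unfolding h_def poly_sum
    proof (rule sum.cong[OF refl])
      fix \<mu> assume m: "\<mu> \<in> M"
      then have mL: "\<mu> \<in> \<Lambda> n" by (simp add: M_def)
      show "poly (monom (binom_coeff n \<mu> lam * \<rho> \<mu>) (odd_size n lam - odd_size n \<mu>)) 0 = (if \<mu> = lam then \<rho> lam else 0)"
        using binom_coeff_self[OF mL] binom_coeff_eq_0[OF mL l(1)]
        by (cases "\<mu> = lam"; cases "odd_size n lam \<le> odd_size n \<mu>") (auto simp: poly_monom power_0_left)
    qed
    also have "\<dots> = \<rho> lam" using finM l by (simp add: M_def)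
    finally show ?thesis .
  qed
  moreover have "poly (g lam) 0 = \<rho> lam" by (simp add: g_def \<rho>_def poly_line)
  moreover have "pderiv (g lam) = pderiv (h lam)" unfolding dg dh by (rule sum.cong[OF refl]) (simp add: IH)
  ultimately have "g lam = h lam" by (metis poly_eqI_pderiv)
  then show ?case by (simp only: g_def h_def \<rho>_def)
qed

end

lemma param_I:
  fixes r :: "'k::field_char_0"
  assumes neg: "\<not> (\<exists>q::rat. q < 0 \<and> r = of_rat q)" and r0: "r \<noteq> 0"
  shows "param r"
proof
  fix a b :: nat assume ab: "a > 0 \<or> b > 0"
  show "of_nat a * r + of_nat b \<noteq> 0"
  proof
    assume e: "of_nat a * r + of_nat b = 0"
    then have a: "a > 0" using ab by (cases "a = 0") auto
    then have b: "b > 0" using e r0 by (cases "b = 0") auto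
    have "r = of_rat (- (of_nat b / of_nat a))"
      using a e by (simp add: of_rat_minus of_rat_divide field_simps add_eq_0_iff)
    moreover have "- (of_nat b / of_nat a) < (0 :: rat)" using a b by simp
    ultimately show False using neg by blast
  qed
qed

theorem theorem8p5:
  fixes n :: nat and r :: "'k::field_char_0" and lam :: "nat \<Rightarrow> nat"
  assumes "n \<ge> 1"
    and "\<not> (\<exists>q::rat. q < 0 \<and> r = of_rat q)"
    and "r \<noteq> 0"
    and "lam \<in> \<Lambda> n"
  shows "Const (1 / B n r lam) * subst (\<lambda>i. 1 + Var i) (R_top n r lam) =
    (\<Sum>\<mu> | \<mu> \<in> \<Lambda> n \<and> preceq n \<mu> lam \<and> (even n \<longrightarrow> alt n \<mu> 1 = alt n lam 1).
       Const (eval_at (shifted n r lam) (R n r \<mu>) / eval_at (shifted n r \<mu>) (R n r \<mu>)) *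
       (Const (1 / B n r \<mu>) * R_top n r \<mu>))"
proof (rule eqI_generic[of n])
  interpret param r by (rule param_I[OF assms(2,3)])
  fix x :: "nat \<Rightarrow> 'k" assume x: "generic n x"
  define M where "M = {\<mu> \<in> \<Lambda> n. odd_size n \<mu> \<le> odd_size n lam \<and> (even n \<longrightarrow> alt n \<mu> 1 = alt n lam 1)}"
  define M' where "M' = {\<mu>. \<mu> \<in> \<Lambda> n \<and> preceq n \<mu> lam \<and> (even n \<longrightarrow> alt n \<mu> 1 = alt n lam 1)}"
  define \<rho> where "\<rho> \<mu> = eval_at x (R_top n r \<mu>) / B n r \<mu>" for \<mu>
  have finM: "finite M" by (rule finite_subset[OF _ finite_Lambda[of n "odd_size n lam"]]) (auto simp: M_def)
  have sub: "M' \<subseteq> M" by (auto simp: M_def M'_def odd_size_mono)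
  have "eval_at x (Const (1 / B n r lam) * subst (\<lambda>i. 1 + Var i) (R_top n r lam))
      = poly (smult (1 / B n r lam) (line (R_top n r lam) x (\<lambda>_. 1))) 1"
    by (simp add: eval_at_subst poly_line add.commute)
  \<comment> \<open>At u = 1 the line passes through (1,...,1) + x, and every power of u becomes
    1.\<close>
  also have "\<dots> = (\<Sum>\<mu>\<in>M. binom_coeff n \<mu> lam * \<rho> \<mu>)"
    unfolding M_def \<rho>_def
    by (subst binomial_line[OF x assms(4) order.refl, of "alt n lam 1"]) (simp_all add: poly_sum poly_monom)
  also have "\<dots> = (\<Sum>\<mu>\<in>M'. binom_coeff n \<mu> lam * \<rho> \<mu>)"
  proof (rule sum.mono_neutral_right[OF finM sub], rule ballI)
    fix \<mu> assume "\<mu> \<in> M - M'"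
    then have "binom_coeff n \<mu> lam = 0" using binom_coeff_nonzero_preceq[of \<mu> n lam] assms(4) by (auto simp: M_def M'_def)
    then show "binom_coeff n \<mu> lam * \<rho> \<mu> = 0" by simp
  qed
  finally show "eval_at x (Const (1 / B n r lam) * subst (\<lambda>i. 1 + Var i) (R_top n r lam)) =
    eval_at x (\<Sum>\<mu> | \<mu> \<in> \<Lambda> n \<and> preceq n \<mu> lam \<and> (even n \<longrightarrow> alt n \<mu> 1 = alt n lam 1).
       Const (eval_at (shifted n r lam) (R n r \<mu>) / eval_at (shifted n r \<mu>) (R n r \<mu>)) *
       (Const (1 / B n r \<mu>) * R_top n r \<mu>))"
    by (simp add: binom_coeff_def \<rho>_def M'_def)
qed

end
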